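(* Let $e_1,e_2,e_3\in\mathbb{C}$ be pairwise distinct, $n,H\in\mathbb{C}$, $p(x)=4(x-e_1)(x-e_2)(x-e_3)$. Let $f$ be a solution of the symmetric square of the Lamé equation $p(x)y''+\frac12p'(x)y'-(n(n+1)x-H)y=0$, and for $\mu\in\mathbb{C}$ let $I_\mu(x)=\int_\gamma f(t)(x-t)^{-1-\mu}\,dt$ be its Euler integral over a Pochhammer double loop $\gamma$. Then the derivative $y=I_\mu'$ satisfies the following second-order equation in each of the following cases. (a) If $\mu=-\frac12$: $$p(x)y''+p'(x)y'+\Big(4H-\sum_{i=1}^3e_i-(2n+3)(2n-1)x\Big)y=0.$$ (b) If $\mu=n$: $$p(x)y''+\Big(\tfrac32+n\Big)p'(x)y'+\Big(4H-4(n+1)^2\sum_{i=1}^3e_i+4(n+1)(2n+3)x\Big)y=0.$$ (c) If $\mu=-n-1$: $$p(x)y''+\Big(\tfrac12-n\Big)p'(x)y'+\Big(4\Big(H-n^2\sum_{i=1}^3e_i\Big)+4n(2n-1)x\Big)y=0.$$ When $\sum_{i=1}^3 e_i=0$, the equation in (c) is the Halphen transform of the Lamé equation. Thus the Halphen transform of a Lamé equation is obtained as the symmetric square followed by an Euler transform.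
   Context: The symmetric square of the Lamé equation is the third-order equation satisfied by all products of two of its solutions: $$p(x)y'''+\tfrac32p'(x)y''+\Big(\tfrac{p''(x)}2-4(n(n+1)x-H)\Big)y'-2n(n+1)y=0.$$ A Pochhammer double loop is a closed path in the $t$-plane that is a commutator of a simple loop around $t=x$ and a simple loop around a singular point of $f$; the integrand is continued analytically along it. Halphen transform (for $\sum e_i=0$, so $p(x)=4x^3-g_2x-g_3$): write the Lamé equation in elliptic form $\frac{d^2y}{du^2}-(n(n+1)\wp(u)-H)y=0$ with the Weierstrass function $\wp$, put $u=2v$, $y=\wp'(v)^{-n}z$, and then $x=\wp(v)$. The resulting equation for $z$ as a function of $x$, namely $p(x)z''+(\frac12-n)p'(x)z'+4(n(2n-1)x+H)z=0$, is called the Halphen transform of the Lamé equation. *)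

theory Defs
  imports "HOL-Complex_Analysis.Complex_Analysis"
begin

section \<open>Linear differential equations\<close>

text \<open>\<open>(A, B, C)\<close> stands for the equation \<open>A y'' + B y' + C y = 0\<close>.\<close>

type_synonym ode2 = "(complex \<Rightarrow> complex) \<times> (complex \<Rightarrow> complex) \<times> (complex \<Rightarrow> complex)"

definition ode2_solution :: "ode2 \<Rightarrow> complex set \<Rightarrow> (complex \<Rightarrow> complex) \<Rightarrow> bool" where
  "ode2_solution E S y \<longleftrightarrow> y holomorphic_on S \<and>
     (case E of (A, B, C) \<Rightarrow>
        \<forall>x\<in>S. A x * (deriv ^^ 2) y x + B x * deriv y x + C x * y x = 0)"

definition lame_p :: "complex \<Rightarrow> complex \<Rightarrow> complex \<Rightarrow> complex \<Rightarrow> complex" where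
  "lame_p e1 e2 e3 x = 4 * (x - e1) * (x - e2) * (x - e3)"

definition lame_ode :: "complex \<Rightarrow> complex \<Rightarrow> complex \<Rightarrow> complex \<Rightarrow> complex \<Rightarrow> ode2" where
  "lame_ode e1 e2 e3 n H =
     (lame_p e1 e2 e3,
      \<lambda>x. 1/2 * deriv (lame_p e1 e2 e3) x,
      \<lambda>x. - (n * (n + 1) * x - H))"

definition sym_square_lame_solution ::
  "complex \<Rightarrow> complex \<Rightarrow> complex \<Rightarrow> complex \<Rightarrow> complex \<Rightarrow> complex set \<Rightarrow> (complex \<Rightarrow> complex) \<Rightarrow> bool" where
  "sym_square_lame_solution e1 e2 e3 n H S y \<longleftrightarrow> y holomorphic_on S \<and>
     (\<forall>x\<in>S. lame_p e1 e2 e3 x * (deriv ^^ 3) y x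
        + 3/2 * deriv (lame_p e1 e2 e3) x * (deriv ^^ 2) y x
        + ((deriv ^^ 2) (lame_p e1 e2 e3) x / 2 - 4 * (n * (n + 1) * x - H)) * deriv y x
        - 2 * n * (n + 1) * y x = 0)"

text \<open>Products of two solutions of the Lame equation solve the third-order equation above,
  so it is indeed the symmetric square.\<close>

lemma sym_square_lame_solution_mult:
  assumes S: "open S"
    and u: "ode2_solution (lame_ode e1 e2 e3 n H) S u"
    and v: "ode2_solution (lame_ode e1 e2 e3 n H) S v"
  shows "sym_square_lame_solution e1 e2 e3 n H S (\<lambda>x. u x * v x)"
proof -
  define p where "p = lame_p e1 e2 e3"
  define q where "q = (\<lambda>x. n * (n + 1) * x - H)"
  have holp: "p holomorphic_on UNIV"
    unfolding p_def lame_p_def [abs_def] by (intro holomorphic_intros)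
  have dp: "(p has_field_derivative deriv p x) (at x)"
    and dp': "(deriv p has_field_derivative deriv (deriv p) x) (at x)" for x
    using holp holomorphic_deriv [OF holp] holomorphic_derivI open_UNIV by blast+
  have dq: "(q has_field_derivative n * (n + 1)) (at x)" for x
    unfolding q_def by (auto intro!: derivative_eq_intros)
  have D: "(w has_field_derivative deriv w x) (at x)"
       "(deriv w has_field_derivative deriv (deriv w) x) (at x)"
       "(deriv (deriv w) has_field_derivative deriv (deriv (deriv w)) x) (at x)"
    if "w holomorphic_on S" "x \<in> S" for w x
    using that S holomorphic_deriv holomorphic_derivI by metis+
  have E2: "p x * deriv (deriv w) x + 1/2 * deriv p x * deriv w x - q x * w x = 0"
    if "ode2_solution (lame_ode e1 e2 e3 n H) S w" "x \<in> S" for w x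
    using that by (auto simp: ode2_solution_def lame_ode_def p_def q_def eval_nat_numeral algebra_simps)
  have E3: "p x * deriv (deriv (deriv w)) x + 3/2 * deriv p x * deriv (deriv w) x
      + (1/2 * deriv (deriv p) x - q x) * deriv w x - n * (n + 1) * w x = 0"
    if w: "ode2_solution (lame_ode e1 e2 e3 n H) S w" and x: "x \<in> S" for w x
  proof -
    have hw: "w holomorphic_on S"
      using w by (auto simp: ode2_solution_def)
    have "((\<lambda>x. p x * deriv (deriv w) x + 1/2 * deriv p x * deriv w x - q x * w x)
       has_field_derivative
        (p x * deriv (deriv (deriv w)) x + 3/2 * deriv p x * deriv (deriv w) x
      + (1/2 * deriv (deriv p) x - q x) * deriv w x - n * (n + 1) * w x)) (at x)"
      by (rule derivative_eq_intros dp dp' dq D[OF hw x] refl)+ (simp add: algebra_simps)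
    moreover have "((\<lambda>x. p x * deriv (deriv w) x + 1/2 * deriv p x * deriv w x - q x * w x)
       has_field_derivative 0) (at x)"
      by (rule has_field_derivative_transform_within_open [OF _ S x, of "\<lambda>_. 0"])
         (use E2 [OF w] in auto)
    ultimately show ?thesis
      using DERIV_unique by blast
  qed
  have hu: "u holomorphic_on S" and hv: "v holomorphic_on S"
    using u v by (auto simp: ode2_solution_def)
  have d1: "deriv (\<lambda>x. u x * v x) x = deriv u x * v x + u x * deriv v x" if "x \<in> S" for x
    by (rule DERIV_imp_deriv) (auto intro!: derivative_eq_intros D[OF hu that] D[OF hv that])
  have d2: "deriv (deriv (\<lambda>x. u x * v x)) x
      = deriv (deriv u) x * v x + 2 * deriv u x * deriv v x + u x * deriv (deriv v) x"
    if x: "x \<in> S" for x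
  proof (rule DERIV_imp_deriv, rule has_field_derivative_transform_within_open [OF _ S x])
    show "((\<lambda>x. deriv u x * v x + u x * deriv v x) has_field_derivative
        deriv (deriv u) x * v x + 2 * deriv u x * deriv v x + u x * deriv (deriv v) x) (at x)"
      by (rule derivative_eq_intros D[OF hu x] D[OF hv x] refl)+ (simp add: algebra_simps)
  qed (simp add: d1)
  have d3: "deriv (deriv (deriv (\<lambda>x. u x * v x))) x
      = deriv (deriv (deriv u)) x * v x + 3 * deriv (deriv u) x * deriv v x
        + 3 * deriv u x * deriv (deriv v) x + u x * deriv (deriv (deriv v)) x"
    if x: "x \<in> S" for x
  proof (rule DERIV_imp_deriv, rule has_field_derivative_transform_within_open [OF _ S x])
    show "((\<lambda>x. deriv (deriv u) x * v x + 2 * deriv u x * deriv v x + u x * deriv (deriv v) x)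
        has_field_derivative
        deriv (deriv (deriv u)) x * v x + 3 * deriv (deriv u) x * deriv v x
        + 3 * deriv u x * deriv (deriv v) x + u x * deriv (deriv (deriv v)) x) (at x)"
      by (rule derivative_eq_intros D[OF hu x] D[OF hv x] refl)+ (simp add: algebra_simps)
  qed (simp add: d2)
  show ?thesis
    unfolding sym_square_lame_solution_def
  proof (intro conjI ballI)
    show "(\<lambda>x. u x * v x) holomorphic_on S"
      by (intro holomorphic_intros hu hv)
  next
    fix x assume x: "x \<in> S"
    have "p x * deriv (deriv (deriv (\<lambda>x. u x * v x))) x
        + 3/2 * deriv p x * deriv (deriv (\<lambda>x. u x * v x)) x
        + (deriv (deriv p) x / 2 - 4 * q x) * deriv (\<lambda>x. u x * v x) x
        - 2 * (n * (n + 1)) * (u x * v x) = 0"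
    proof -
      have comb: "p0 * (u3 * v0 + 3 * u2 * v1 + 3 * u1 * v2 + u0 * v3)
          + 3/2 * p1 * (u2 * v0 + 2 * u1 * v1 + u0 * v2)
          + (p2 / 2 - 4 * q0) * (u1 * v0 + u0 * v1) - 2 * N * (u0 * v0) = 0"
        if "p0 * u2 + 1/2 * p1 * u1 - q0 * u0 = 0" "p0 * v2 + 1/2 * p1 * v1 - q0 * v0 = 0"
           "p0 * u3 + 3/2 * p1 * u2 + (1/2 * p2 - q0) * u1 - N * u0 = 0"
           "p0 * v3 + 3/2 * p1 * v2 + (1/2 * p2 - q0) * v1 - N * v0 = 0"
        for p0 p1 p2 q0 N u0 u1 u2 u3 v0 v1 v2 v3 :: complex
      proof -
        have "p0 * (u3 * v0 + 3 * u2 * v1 + 3 * u1 * v2 + u0 * v3)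
            + 3/2 * p1 * (u2 * v0 + 2 * u1 * v1 + u0 * v2)
            + (p2 / 2 - 4 * q0) * (u1 * v0 + u0 * v1) - 2 * N * (u0 * v0)
          = v0 * (p0 * u3 + 3/2 * p1 * u2 + (1/2 * p2 - q0) * u1 - N * u0)
            + u0 * (p0 * v3 + 3/2 * p1 * v2 + (1/2 * p2 - q0) * v1 - N * v0)
            + 3 * v1 * (p0 * u2 + 1/2 * p1 * u1 - q0 * u0)
            + 3 * u1 * (p0 * v2 + 1/2 * p1 * v1 - q0 * v0)"
          by (simp add: field_simps)
        then show ?thesis
          by (simp only: that mult_zero_right add_0_right)
      qed
      show ?thesis
        unfolding d1 [OF x] d2 [OF x] d3 [OF x]
        by (rule comb [OF E2 [OF u x] E2 [OF v x] E3 [OF u x] E3 [OF v x]])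
    qed
    then show "lame_p e1 e2 e3 x * (deriv ^^ 3) (\<lambda>x. u x * v x) x
        + 3/2 * deriv (lame_p e1 e2 e3) x * (deriv ^^ 2) (\<lambda>x. u x * v x) x
        + ((deriv ^^ 2) (lame_p e1 e2 e3) x / 2 - 4 * (n * (n + 1) * x - H)) * deriv (\<lambda>x. u x * v x) x
        - 2 * n * (n + 1) * (u x * v x) = 0"
      by (simp add: p_def q_def eval_nat_numeral mult.assoc)
  qed
qed

definition euler_ode_a :: "complex \<Rightarrow> complex \<Rightarrow> complex \<Rightarrow> complex \<Rightarrow> complex \<Rightarrow> ode2" where
  "euler_ode_a e1 e2 e3 n H =
     (lame_p e1 e2 e3,
      \<lambda>x. deriv (lame_p e1 e2 e3) x,
      \<lambda>x. 4 * H - (e1 + e2 + e3) - (2 * n + 3) * (2 * n - 1) * x)"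

definition euler_ode_b :: "complex \<Rightarrow> complex \<Rightarrow> complex \<Rightarrow> complex \<Rightarrow> complex \<Rightarrow> ode2" where
  "euler_ode_b e1 e2 e3 n H =
     (lame_p e1 e2 e3,
      \<lambda>x. (3/2 + n) * deriv (lame_p e1 e2 e3) x,
      \<lambda>x. 4 * H - 4 * (n + 1)^2 * (e1 + e2 + e3) + 4 * (n + 1) * (2 * n + 3) * x)"

definition euler_ode_c :: "complex \<Rightarrow> complex \<Rightarrow> complex \<Rightarrow> complex \<Rightarrow> complex \<Rightarrow> ode2" where
  "euler_ode_c e1 e2 e3 n H =
     (lame_p e1 e2 e3,
      \<lambda>x. (1/2 - n) * deriv (lame_p e1 e2 e3) x,
      \<lambda>x. 4 * (H - n^2 * (e1 + e2 + e3)) + 4 * n * (2 * n - 1) * x)"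


section \<open>Euler integrals over Pochhammer double loops\<close>

definition simple_loop :: "(real \<Rightarrow> complex) \<Rightarrow> bool" where
  "simple_loop g \<longleftrightarrow> valid_path g \<and> simple_path g \<and> pathfinish g = pathstart g"

text \<open>\<open>A\<close> is the set of all finite singular points; a simple loop around one of them separates it
  from the others. A loop around \<open>\<infinity>\<close> has all finite singular points in its interior.
  Either orientation is allowed.\<close>

definition loop_around :: "complex set \<Rightarrow> complex \<Rightarrow> (real \<Rightarrow> complex) \<Rightarrow> bool" where
  "loop_around A z g \<longleftrightarrow> simple_loop g \<and>
     z \<in> inside (path_image g) \<and> A - {z} \<subseteq> outside (path_image g)"

definition loop_around_infinity :: "complex set \<Rightarrow> (real \<Rightarrow> complex) \<Rightarrow> bool" where
  "loop_around_infinity A g \<longleftrightarrow> simple_loop g \<and> A \<subseteq> inside (path_image g)"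

definition commutator_path :: "(real \<Rightarrow> complex) \<Rightarrow> (real \<Rightarrow> complex) \<Rightarrow> real \<Rightarrow> complex" where
  "commutator_path a c = a +++ (c +++ (reversepath a +++ reversepath c))"

text \<open>\<open>A\<close> is the set of finite singular points of the function to be transformed, and the double
  loop is \<open>commutator_path a c\<close>.\<close>

definition pochhammer_loops ::
  "complex set \<Rightarrow> complex \<Rightarrow> (real \<Rightarrow> complex) \<Rightarrow> (real \<Rightarrow> complex) \<Rightarrow> bool" where
  "pochhammer_loops A x a c \<longleftrightarrow> x \<notin> A \<and> pathstart a = pathstart c \<and>
     loop_around (insert x A) x a \<and>
     ((\<exists>e\<in>A. loop_around (insert x A) e c) \<or> loop_around_infinity (insert x A) c)"

text \<open>\<open>F s\<close> represents the germ at \<open>\<gamma> s\<close> of the function obtained from \<open>f\<close> by analytic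
  continuation along \<open>\<gamma>\<close>.\<close>

definition analytic_continuation_along ::
  "(real \<Rightarrow> complex) \<Rightarrow> (complex \<Rightarrow> complex) \<Rightarrow> (real \<Rightarrow> complex \<Rightarrow> complex) \<Rightarrow> bool" where
  "analytic_continuation_along \<gamma> f F \<longleftrightarrow>
     (\<forall>\<^sub>F t in nhds (\<gamma> 0). F 0 t = f t) \<and>
     (\<forall>s\<in>{0..1}. \<exists>D. open D \<and> \<gamma> s \<in> D \<and> F s holomorphic_on D \<and>
        (\<forall>\<^sub>F r in at s within {0..1}. \<gamma> r \<in> D \<and> (\<forall>\<^sub>F t in nhds (\<gamma> r). F r t = F s t)))"

text \<open>\<open>L x s\<close> is a branch of \<open>log (x - \<gamma> s)\<close>, so that \<open>exp (- (1 + \<mu>) * L x s)\<close> is the kernel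
  \<open>(x - t) powr (-1 - \<mu>)\<close> continued along \<open>\<gamma>\<close>.\<close>

definition log_branch_along ::
  "(real \<Rightarrow> complex) \<Rightarrow> complex set \<Rightarrow> (complex \<Rightarrow> real \<Rightarrow> complex) \<Rightarrow> bool" where
  "log_branch_along \<gamma> X L \<longleftrightarrow>
     continuous_on (X \<times> {0..1}) (\<lambda>(x, s). L x s) \<and>
     (\<forall>x\<in>X. \<forall>s\<in>{0..1}. exp (L x s) = x - \<gamma> s)"

text \<open>\<open>I\<close> is, on the open set \<open>X\<close>, an Euler integral with parameter \<open>\<mu>\<close> of the function element
  \<open>f\<close> given on \<open>U\<close>, with \<open>A\<close> the finite singular points of \<open>f\<close>. The double loop starts in \<open>U\<close> and
  is kept fixed while \<open>x\<close> varies in \<open>X\<close>; the values of the continued integrand depend on the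
  parameter \<open>s\<close> of the path, not only on \<open>\<gamma> s\<close>.\<close>

definition is_euler_integral ::
  "complex set \<Rightarrow> complex set \<Rightarrow> (complex \<Rightarrow> complex) \<Rightarrow> complex \<Rightarrow> complex set \<Rightarrow>
   (complex \<Rightarrow> complex) \<Rightarrow> bool" where
  "is_euler_integral A U f \<mu> X I \<longleftrightarrow>
     (\<exists>a c \<gamma> F L.
        \<gamma> = commutator_path a c \<and>
        (\<forall>x\<in>X. pochhammer_loops A x a c) \<and>
        pathstart \<gamma> \<in> U \<and>
        analytic_continuation_along \<gamma> f F \<and>
        log_branch_along \<gamma> X L \<and>
        (\<forall>x\<in>X. I x = integral {0..1}
           (\<lambda>s. F s (\<gamma> s) * exp ((- 1 - \<mu>) * L x s) * vector_derivative \<gamma> (at s within {0..1}))))"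


section \<open>The Halphen transform\<close>

definition period_lattice :: "complex \<Rightarrow> complex \<Rightarrow> complex set" where
  "period_lattice \<omega>1 \<omega>2 = {of_int j * \<omega>1 + of_int k * \<omega>2 | j k. True}"

definition weierstrass_p :: "complex set \<Rightarrow> complex \<Rightarrow> complex" where
  "weierstrass_p \<Lambda> u = 1 / u^2 + (\<Sum>\<^sub>\<infinity>\<omega>\<in>\<Lambda> - {0}. 1 / (u - \<omega>)^2 - 1 / \<omega>^2)"

definition weierstrass_g2 :: "complex set \<Rightarrow> complex" where
  "weierstrass_g2 \<Lambda> = 60 * (\<Sum>\<^sub>\<infinity>\<omega>\<in>\<Lambda> - {0}. 1 / \<omega>^4)"

definition weierstrass_g3 :: "complex set \<Rightarrow> complex" where
  "weierstrass_g3 \<Lambda> = 140 * (\<Sum>\<^sub>\<infinity>\<omega>\<in>\<Lambda> - {0}. 1 / \<omega>^6)"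

definition elliptic_lame_ode :: "complex set \<Rightarrow> complex \<Rightarrow> complex \<Rightarrow> ode2" where
  "elliptic_lame_ode \<Lambda> n H =
     (\<lambda>u. 1, \<lambda>u. 0, \<lambda>u. - (n * (n + 1) * weierstrass_p \<Lambda> u - H))"

text \<open>\<open>E\<close> is the equation for \<open>z\<close> as a function of \<open>x = \<wp>(v)\<close> that results from the elliptic
  Lame equation for \<open>y\<close> by \<open>u = 2 v\<close>, \<open>y = \<wp>'(v) powr (-n) * z\<close>. Here \<open>l\<close> is a branch of
  \<open>log \<wp>'\<close>, whose existence on \<open>V\<close> forces \<open>\<wp>'\<close> not to vanish there.\<close>

definition halphen_substitution :: "complex set \<Rightarrow> complex \<Rightarrow> complex \<Rightarrow> ode2 \<Rightarrow> bool" where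
  "halphen_substitution \<Lambda> n H E \<longleftrightarrow>
     (\<forall>V l y z.
        open V \<and> (\<forall>v\<in>V. 2 * v \<notin> \<Lambda>) \<and>
        l holomorphic_on V \<and> (\<forall>v\<in>V. exp (l v) = deriv (weierstrass_p \<Lambda>) v) \<and>
        z holomorphic_on weierstrass_p \<Lambda> ` V \<and>
        (\<forall>v\<in>V. y (2 * v) = exp (- n * l v) * z (weierstrass_p \<Lambda> v)) \<longrightarrow>
        (ode2_solution (elliptic_lame_ode \<Lambda> n H) ((\<lambda>v. 2 * v) ` V) y \<longleftrightarrow>
         ode2_solution E (weierstrass_p \<Lambda> ` V) z))"

definition halphen_ode :: "complex \<Rightarrow> complex \<Rightarrow> complex \<Rightarrow> complex \<Rightarrow> complex \<Rightarrow> ode2" where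
  "halphen_ode e1 e2 e3 n H =
     (lame_p e1 e2 e3,
      \<lambda>x. (1/2 - n) * deriv (lame_p e1 e2 e3) x,
      \<lambda>x. 4 * (n * (2 * n - 1) * x + H))"

end

theory Submission imports Defs begin

text \<open>The second-order equations come from an adjoint identity. Let \<open>S\<close> be the
differential operator of the symmetric square and \<open>k = (x - t)\<^sup>\<beta>\<close> with \<open>\<beta> = -1 - \<mu>\<close>. The operator
\<open>S\<close> is skew-adjoint, so \<open>k S f + f S k\<close> is the derivative in \<open>t\<close> of a bilinear expression in the
jets of \<open>f\<close> and \<open>k\<close>. Integrate this over the double loop. If both \<open>f\<close> and the logarithm
of \<open>x - t\<close> return to their initial branches, the boundary terms cancel, and \<open>S f = 0\<close> leaves
\<open>\<integral> f S k dt = 0\<close>. Since the coefficients of \<open>S\<close> are polynomials of degree at most three, \<open>S k\<close>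
expands into \<open>(x - t)\<close> to the powers \<open>\<beta> - 3, \<dots>, \<beta>\<close> with coefficients depending on \<open>x\<close>
(\<open>adjoint_on_kernel_power\<close>). Differentiation of the integral with respect to \<open>x\<close> lowers the
exponent by one, so the first three powers give \<open>I'''\<close>, \<open>I''\<close> and \<open>I'\<close>. The last one gives \<open>I\<close>
itself, with coefficient \<open>2 (2 \<beta> + 1) (\<beta> - n) (\<beta> + n + 1)\<close>. The three cases of the theorem are the
three zeros of this polynomial in \<open>\<beta>\<close>, where what remains is a second-order equation for \<open>I'\<close>
(\<open>euler_transform_relation\<close>).

The branches do return. The continuation of \<open>f\<close> is known only along the double loop
\<open>a c a\<^sup>- c\<^sup>-\<close>, where \<open>a\<close> is a simple loop around \<open>x\<close> with the singular points of the equation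
outside. Such a loop has a simply connected neighbourhood without singular points
(\<open>simply_connected_nbhd_of_simple_loop\<close>), to which every germ of a solution extends
(\<open>linear_ode_germ_extends\<close>). Hence \<open>a\<close> and \<open>a\<^sup>-\<close> act trivially on all branches, and \<open>c\<close> and
\<open>c\<^sup>-\<close> cancel. For the logarithm, the increments over the four pieces cancel in pairs.

For the Halphen transform, the substitution \<open>u = 2 v\<close>, \<open>x = \<wp>(v)\<close> is carried
out by the chain rule (\<open>halphen_substitution_pointwise\<close>). It needs the differential equation of
\<open>\<wp>\<close> and the duplication formula, which are developed from the lattice sums: the first
by Liouville's theorem, the second because \<open>\<wp>(u)\<close> and the right-hand side of the duplication
formula at \<open>u / 2\<close> satisfy the same first-order equation and have the same principal part at \<open>0\<close>,
which forces them to agree (\<open>vanishes_by_initial_exponents\<close>).\<close>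

section \<open>Extension of germs of solutions of linear differential equations\<close>

text \<open>Comparison of coefficients in \<open>U' = M U\<close> expresses the coefficient of index
\<open>k + 1\<close> by the earlier ones; if these are at most \<open>K * s^(-j)\<close>, the geometric series for \<open>s < r\<close> bounds
the new one by \<open>q / (k + 1) * K * s^(- k - 1)\<close> with a constant \<open>q\<close>. So the bound is inherited as soon as
\<open>q \<le> k + 1\<close>, and \<open>K\<close> only has to cover the finitely many coefficients before that.\<close>

lemma fps_linear_system_geometric_bound:
  fixes U :: "nat \<Rightarrow> complex fps" and M :: "nat \<Rightarrow> nat \<Rightarrow> complex fps" and r s C :: real
  assumes sys: "\<And>i. i < N \<Longrightarrow> fps_deriv (U i) = (\<Sum>j<N. M i j * U j)"
    and M: "\<And>i j l. i < N \<Longrightarrow> j < N \<Longrightarrow> norm (fps_nth (M i j) l) * r ^ l \<le> C"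
    and s: "0 < s" "s < r"
  obtains K where "\<And>i k. i < N \<Longrightarrow> norm (fps_nth (U i) k) * s ^ k \<le> K"
proof -
  define q where "q = s * (real N * (\<bar>C\<bar> * (1 / (1 - s / r))))"
  define k0 where "k0 = nat \<lceil>q\<rceil>"
  define K where "K = (\<Sum>i<N. \<Sum>k\<le>k0. norm (fps_nth (U i) k) * s ^ k)"
  have K0: "K \<ge> 0"
    unfolding K_def by (intro sum_nonneg mult_nonneg_nonneg) (use s in auto)
  have geo: "(\<Sum>l\<le>k. (s / r) ^ l) \<le> 1 / (1 - s / r)" for k
  proof -
    have "(\<Sum>l\<le>k. (s / r) ^ l) \<le> (\<Sum>l. (s / r) ^ l)"
      by (rule sum_le_suminf) (use s in \<open>auto intro!: summable_geometric\<close>)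
    then show ?thesis
      using s by (subst (asm) suminf_geometric) auto
  qed
  have M': "norm (fps_nth (M i j) l) * s ^ l \<le> \<bar>C\<bar> * (s / r) ^ l" if "i < N" "j < N" for i j l
  proof -
    have "norm (fps_nth (M i j) l) * s ^ l = norm (fps_nth (M i j) l) * r ^ l * (s / r) ^ l"
      using s by (simp add: power_divide)
    also have "\<dots> \<le> \<bar>C\<bar> * (s / r) ^ l"
      by (rule mult_right_mono) (use M[OF that, of l] s in auto)
    finally show ?thesis .
  qed
  have "norm (fps_nth (U i) k) * s ^ k \<le> K" if "i < N" for i k
    using that
  proof (induction k arbitrary: i rule: less_induct)
    case (less k)
    show ?case
    proof (cases "k \<le> k0")
      case True
      have "norm (fps_nth (U i) k) * s ^ k \<le> (\<Sum>k\<le>k0. norm (fps_nth (U i) k) * s ^ k)"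
        by (rule member_le_sum[of k "{..k0}" "\<lambda>k. norm (fps_nth (U i) k) * s ^ k"])
           (use True s in auto)
      also have "\<dots> \<le> K"
        unfolding K_def
        by (rule member_le_sum[of i "{..<N}" "\<lambda>i. \<Sum>k\<le>k0. norm (fps_nth (U i) k) * s ^ k"])
           (use less.prems s in \<open>auto intro!: sum_nonneg\<close>)
      finally show ?thesis .
    next
      case False
      then obtain m where m: "k = Suc m" by (cases k) auto
      have qm: "q \<le> real (Suc m)"
        using False m unfolding k0_def by linarith
      have "of_nat (Suc m) * fps_nth (U i) (Suc m) = fps_nth (fps_deriv (U i)) m"
        by simp
      also have "\<dots> = (\<Sum>j<N. \<Sum>l\<le>m. fps_nth (M i j) l * fps_nth (U j) (m - l))"
        by (simp add: sys[OF less.prems] fps_sum_nth fps_mult_nth atMost_atLeast0)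
      finally have "real (Suc m) * norm (fps_nth (U i) (Suc m))
          = norm (\<Sum>j<N. \<Sum>l\<le>m. fps_nth (M i j) l * fps_nth (U j) (m - l))"
        by (metis norm_mult norm_of_nat)
      then have "real (Suc m) * norm (fps_nth (U i) (Suc m)) * s ^ Suc m
          = s * (norm (\<Sum>j<N. \<Sum>l\<le>m. fps_nth (M i j) l * fps_nth (U j) (m - l)) * s ^ m)"
        by simp
      also have "\<dots> \<le> s * ((\<Sum>j<N. \<Sum>l\<le>m. norm (fps_nth (M i j) l) * norm (fps_nth (U j) (m - l))) * s ^ m)"
      proof -
        have "norm (\<Sum>j<N. \<Sum>l\<le>m. fps_nth (M i j) l * fps_nth (U j) (m - l))
            \<le> (\<Sum>j<N. \<Sum>l\<le>m. norm (fps_nth (M i j) l) * norm (fps_nth (U j) (m - l)))"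
          by (intro order.trans[OF norm_sum] sum_mono) (simp add: norm_mult)
        then show ?thesis
          using s by (intro mult_left_mono mult_right_mono) auto
      qed
      also have "\<dots> = s * (\<Sum>j<N. \<Sum>l\<le>m. (norm (fps_nth (M i j) l) * s ^ l) * (norm (fps_nth (U j) (m - l)) * s ^ (m - l)))"
      proof -
        have "s ^ m = s ^ l * s ^ (m - l)" if "l \<le> m" for l
          using that by (simp flip: power_add)
        then have "norm (fps_nth (M i j) l) * norm (fps_nth (U j) (m - l)) * s ^ m
            = (norm (fps_nth (M i j) l) * s ^ l) * (norm (fps_nth (U j) (m - l)) * s ^ (m - l))"
          if "l \<le> m" for j l
          using that by (simp only: mult_ac)
        then show ?thesis
          unfolding sum_distrib_right by (intro arg_cong[of _ _ "(*) s"] sum.cong refl) auto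
      qed
      also have "\<dots> \<le> s * (\<Sum>j<N. \<Sum>l\<le>m. (\<bar>C\<bar> * (s / r) ^ l) * K)"
      proof -
        have "(norm (fps_nth (M i j) l) * s ^ l) * (norm (fps_nth (U j) (m - l)) * s ^ (m - l))
            \<le> (\<bar>C\<bar> * (s / r) ^ l) * K" if "j < N" "l \<le> m" for j l
        proof (rule mult_mono)
          show "norm (fps_nth (U j) (m - l)) * s ^ (m - l) \<le> K"
            using less.IH[of "m - l" j] m that by auto
        qed (use M' less.prems that s in auto)
        then show ?thesis
          using s by (intro mult_left_mono sum_mono) auto
      qed
      also have "\<dots> = s * (real N * (\<bar>C\<bar> * (\<Sum>l\<le>m. (s / r) ^ l))) * K"
        by (simp add: sum_distrib_left sum_distrib_right mult_ac)
      also have "\<dots> \<le> q * K"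
        unfolding q_def using geo s K0 by (intro mult_right_mono mult_left_mono) auto
      also have "\<dots> \<le> real (Suc m) * K"
        using qm K0 by (intro mult_right_mono) auto
      finally have "real (Suc m) * (norm (fps_nth (U i) (Suc m)) * s ^ Suc m) \<le> real (Suc m) * K"
        by (simp only: mult.assoc)
      then have "norm (fps_nth (U i) (Suc m)) * s ^ Suc m \<le> K"
        by (subst (asm) mult_le_cancel_left_pos) simp_all
      then show ?thesis
        using m by simp
    qed
  qed
  with that show ?thesis by blast
qed

text \<open>Given \<open>t\<close> below the common radius \<open>R\<close> of the coefficients, choose \<open>t < s < r < R\<close>: the
coefficients \<open>M\<close> are bounded at scale \<open>r\<close>, hence the solution at scale \<open>s\<close>, and it converges at \<open>t\<close>.\<close>

lemma fps_linear_system_conv_radius: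
  fixes U :: "nat \<Rightarrow> complex fps" and M :: "nat \<Rightarrow> nat \<Rightarrow> complex fps"
  assumes sys: "\<And>i. i < N \<Longrightarrow> fps_deriv (U i) = (\<Sum>j<N. M i j * U j)"
    and M: "\<And>i j. i < N \<Longrightarrow> j < N \<Longrightarrow> fps_conv_radius (M i j) \<ge> R"
    and i: "i < N"
  shows "fps_conv_radius (U i) \<ge> R"
  unfolding fps_conv_radius_def
proof (rule conv_radius_geI_ex')
  fix t :: real assume t: "0 < t" "ereal t < R"
  obtain r where r: "t < r" "ereal r < R"
    using ereal_dense2[OF t(2)] by auto
  obtain s where s: "t < s" "s < r"
    using dense r by blast
  have bdd: "\<exists>C. \<forall>l. norm (fps_nth (M i j) l) * r ^ l \<le> C" if "i < N" "j < N" for i j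
  proof -
    have "ereal (norm (of_real r :: complex)) < conv_radius (fps_nth (M i j))"
      using r t M[OF that] by (auto simp: fps_conv_radius_def intro: less_le_trans)
    then have "summable (\<lambda>l. norm (fps_nth (M i j) l * of_real r ^ l))"
      by (rule abs_summable_in_conv_radius)
    then have "Bseq (\<lambda>l. norm (fps_nth (M i j) l * of_real r ^ l))"
      by (intro convergent_imp_Bseq) (use summable_LIMSEQ_zero convergentI in blast)
    then obtain C where "\<And>l. norm (norm (fps_nth (M i j) l * of_real r ^ l)) \<le> C"
      by (elim BseqE) blast
    then show ?thesis
      using r t by (auto simp: norm_mult norm_power)
  qed
  then obtain C where C: "\<And>i j l. i < N \<Longrightarrow> j < N \<Longrightarrow> norm (fps_nth (M i j) l) * r ^ l \<le> C i j"
    by metis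
  define C' where "C' = (\<Sum>i<N. \<Sum>j<N. \<bar>C i j\<bar>)"
  have C': "norm (fps_nth (M i j) l) * r ^ l \<le> C'" if "i < N" "j < N" for i j l
  proof -
    have "norm (fps_nth (M i j) l) * r ^ l \<le> \<bar>C i j\<bar>"
      using C[OF that, of l] by linarith
    also have "\<dots> \<le> (\<Sum>j<N. \<bar>C i j\<bar>)"
      by (rule member_le_sum) (use that in auto)
    also have "\<dots> \<le> C'"
      unfolding C'_def by (rule member_le_sum[of i "{..<N}" "\<lambda>i. \<Sum>j<N. \<bar>C i j\<bar>"])
         (use that in \<open>auto intro!: sum_nonneg\<close>)
    finally show ?thesis .
  qed
  obtain K where K: "\<And>i k. i < N \<Longrightarrow> norm (fps_nth (U i) k) * s ^ k \<le> K"
    using fps_linear_system_geometric_bound[OF sys C', of s] s t r by (metis less_trans)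
  show "summable (\<lambda>n. fps_nth (U i) n * of_real t ^ n)"
  proof (rule summable_comparison_test')
    show "summable (\<lambda>n. K * (t / s) ^ n)"
      using t s by (intro summable_mult summable_geometric) auto
    fix n :: nat
    have "norm (fps_nth (U i) n * of_real t ^ n) = (norm (fps_nth (U i) n) * s ^ n) * (t / s) ^ n"
      using t s by (simp add: norm_mult norm_power power_divide)
    also have "\<dots> \<le> K * (t / s) ^ n"
      by (intro mult_right_mono K i) (use t s in auto)
    finally show "norm (fps_nth (U i) n * of_real t ^ n) \<le> K * (t / s) ^ n" .
  qed
qed

text \<open>The Taylor series of the germ at \<open>0\<close> solves the system formally, so it converges on the whole disc;
the system persists there by the identity theorem.\<close>

lemma linear_system_germ_extends_to_disc:
  fixes M :: "nat \<Rightarrow> nat \<Rightarrow> complex \<Rightarrow> complex" and v :: "nat \<Rightarrow> complex \<Rightarrow> complex"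
  assumes M: "\<And>i j. i < N \<Longrightarrow> j < N \<Longrightarrow> M i j holomorphic_on ball 0 1"
    and V: "open V" "0 \<in> V" "V \<subseteq> ball 0 1"
    and v: "\<And>i. i < N \<Longrightarrow> v i holomorphic_on V"
    and sys: "\<And>i z. i < N \<Longrightarrow> z \<in> V \<Longrightarrow> deriv (v i) z = (\<Sum>j<N. M i j z * v j z)"
  shows "\<exists>u. \<forall>i<N. u i holomorphic_on ball 0 1 \<and> (\<forall>\<^sub>F z in nhds 0. u i z = v i z) \<and>
    (\<forall>z\<in>ball 0 1. deriv (u i) z = (\<Sum>j<N. M i j z * u j z))"
proof -
  define U where "U i = fps_expansion (v i) 0" for i
  define MM where "MM i j = fps_expansion (M i j) 0" for i j
  define u where "u i = eval_fps (U i)" for i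
  have U: "v i has_fps_expansion U i" if "i < N" for i
    unfolding U_def using V v[OF that] by blast
  have MM: "M i j has_fps_expansion MM i j" if "i < N" "j < N" for i j
    unfolding MM_def by (rule has_fps_expansion_fps_expansion[OF _ _ M[OF that]]) auto
  have radM: "fps_conv_radius (MM i j) \<ge> 1" if "i < N" "j < N" for i j
    unfolding MM_def using conv_radius_fps_expansion[of "M i j" 0 "ereal 1"] M[OF that]
    by (simp add: one_ereal_def)
  have fps: "fps_deriv (U i) = (\<Sum>j<N. MM i j * U j)" if "i < N" for i
  proof -
    have 1: "deriv (v i) has_fps_expansion fps_deriv (U i)"
      by (rule has_fps_expansion_deriv[OF U[OF that]])
    have 2: "(\<lambda>z. \<Sum>j<N. M i j z * v j z) has_fps_expansion (\<Sum>j<N. MM i j * U j)"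
      by (intro has_fps_expansion_sum has_fps_expansion_mult U MM that) auto
    have "\<forall>\<^sub>F z in nhds 0. z \<in> V"
      using V eventually_nhds_in_open by blast
    then have "\<forall>\<^sub>F z in nhds 0. deriv (v i) z = (\<Sum>j<N. M i j z * v j z)"
      by eventually_elim (use sys that in auto)
    then have "deriv (v i) has_fps_expansion (\<Sum>j<N. MM i j * U j)"
      using 2 by (subst has_fps_expansion_cong[OF _ refl])
    then show ?thesis
      using 1 fps_expansion_unique_complex by blast
  qed
  have radU: "fps_conv_radius (U i) \<ge> 1" if "i < N" for i
    using fps_linear_system_conv_radius[of N U MM 1 i] fps radM that by blast
  have holu: "u i holomorphic_on ball 0 1" if "i < N" for i
    unfolding u_def
    by (rule holomorphic_on_eval_fps, rule order.trans[OF _ eball_mono[OF radU[OF that]]])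
       (simp add: one_ereal_def)
  have eq: "\<forall>\<^sub>F z in nhds 0. u i z = v i z" if "i < N" for i
    using U[OF that] by (auto simp: u_def has_fps_expansion_def)
  have "deriv (u i) z = (\<Sum>j<N. M i j z * u j z)" if i: "i < N" and z: "z \<in> ball 0 1" for i z
  proof -
    have "\<forall>\<^sub>F z in nhds 0. \<forall>j\<in>{..<N}. u j z = v j z"
      by (intro eventually_ball_finite) (use eq in auto)
    then have ev: "\<forall>\<^sub>F z in nhds 0. z \<in> V \<and> (\<forall>j\<in>{..<N}. u j z = v j z)"
      using V eventually_nhds_in_open eventually_conj by blast
    then obtain T where T: "open T" "0 \<in> T" "\<And>z. z \<in> T \<Longrightarrow> z \<in> V \<and> (\<forall>j\<in>{..<N}. u j z = v j z)"
      unfolding eventually_nhds by blast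
    have d: "deriv (u i) w - (\<Sum>j<N. M i j w * u j w) = 0" if w: "w \<in> T" for w
    proof -
      have "deriv (u i) w = deriv (v i) w"
        by (rule deriv_cong_ev) (use T w i in \<open>auto simp: eventually_nhds intro!: exI[of _ T]\<close>)
      then show ?thesis
        using T(3)[OF w] sys[OF i, of w] by simp
    qed
    have "deriv (u i) z - (\<Sum>j<N. M i j z * u j z) = 0"
    proof (rule analytic_continuation_open[of T "ball 0 1" "\<lambda>z. deriv (u i) z - (\<Sum>j<N. M i j z * u j z)" "\<lambda>_. 0"])
      show "(\<lambda>z. deriv (u i) z - (\<Sum>j<N. M i j z * u j z)) holomorphic_on ball 0 1"
        by (intro holomorphic_intros holomorphic_deriv holu M i open_ball) auto
    qed (use T V z d in auto)
    then show ?thesis by simp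
  qed
  with holu eq show ?thesis
    by (intro exI[of _ u]) blast
qed

text \<open>A Riemann map pulls the equation back to the unit disc, where its first-order companion system is
covered by the previous lemma. Power series at \<open>b\<close> alone would only reach the largest disc
around \<open>b\<close> contained in \<open>W\<close>.\<close>

lemma linear_ode_germ_extends:
  fixes q :: "nat \<Rightarrow> complex \<Rightarrow> complex"
  assumes W: "open W" "simply_connected W" "W \<noteq> UNIV" "b \<in> W"
    and q: "\<And>j. j < N \<Longrightarrow> q j holomorphic_on W"
    and V: "open V" "b \<in> V" "g holomorphic_on V"
    and N: "0 < N"
    and ode: "\<And>z. z \<in> V \<Longrightarrow> z \<in> W \<Longrightarrow> (deriv ^^ N) g z = (\<Sum>j<N. q j z * (deriv ^^ j) g z)"
  obtains G where "G holomorphic_on W" "\<forall>\<^sub>F z in nhds b. G z = g z"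
proof -
  obtain f h where f: "f holomorphic_on W" "\<And>z. z \<in> W \<Longrightarrow> f z \<in> ball 0 1 \<and> h (f z) = z"
    and h: "h holomorphic_on ball 0 1" "\<And>w. w \<in> ball 0 1 \<Longrightarrow> h w \<in> W \<and> f (h w) = w"
    using Riemann_mapping_theorem[of W] W by blast
  \<comment> \<open>A Riemann map need not send \<open>b\<close> to \<open>0\<close>; a disc automorphism corrects this.\<close>
  obtain p r where p: "p (f b) = 0" "p holomorphic_on ball 0 1" "p ` ball 0 1 \<subseteq> ball 0 1"
    and r: "r holomorphic_on ball 0 1" "r ` ball 0 1 \<subseteq> ball 0 1"
    and pr: "\<And>z. z \<in> ball 0 1 \<Longrightarrow> p (r z) = z" and rp: "\<And>z. z \<in> ball 0 1 \<Longrightarrow> r (p z) = z"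
    using ball_biholomorphism_exists[of "f b"] f(2)[OF W(4)] by blast
  define \<phi> where "\<phi> = h \<circ> r"
  define \<psi> where "\<psi> = p \<circ> f"
  have \<phi>: "\<phi> holomorphic_on ball 0 1" "\<And>w. w \<in> ball 0 1 \<Longrightarrow> \<phi> w \<in> W"
  proof -
    have rin: "r w \<in> ball 0 1" if "w \<in> ball 0 1" for w
      using r(2) that by blast
    then show "\<phi> w \<in> W" if "w \<in> ball 0 1" for w
      unfolding \<phi>_def o_def using h(2) that by blast
    show "\<phi> holomorphic_on ball 0 1"
      unfolding \<phi>_def using rin by (intro holomorphic_on_compose_gen[OF r(1) h(1)]) auto
  qed
  have \<psi>: "\<psi> holomorphic_on W" "\<And>z. z \<in> W \<Longrightarrow> \<psi> z \<in> ball 0 1" "\<And>z. z \<in> W \<Longrightarrow> \<phi> (\<psi> z) = z" "\<psi> b = 0"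
  proof -
    have pin: "p w \<in> ball 0 1" if "w \<in> ball 0 1" for w
      using p(3) that by blast
    then show "\<psi> z \<in> ball 0 1" if "z \<in> W" for z
      unfolding \<psi>_def o_def using f(2) that by blast
    show "\<psi> holomorphic_on W"
      unfolding \<psi>_def using f(2) by (intro holomorphic_on_compose_gen[OF f(1) p(2)]) auto
    show "\<phi> (\<psi> z) = z" if "z \<in> W" for z
      using f(2)[OF that] rp[of "f z"] by (simp add: \<phi>_def \<psi>_def)
    show "\<psi> b = 0"
      by (simp add: \<psi>_def p(1))
  qed
  have \<phi>0: "\<phi> 0 = b"
    using \<psi>(3)[OF W(4)] \<psi>(4) by simp
  define V' where "V' = ball 0 1 \<inter> \<phi> -` V"
  have V': "open V'" "0 \<in> V'" "V' \<subseteq> ball 0 1"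
    unfolding V'_def using \<phi>0 V \<phi>(1)
    by (auto intro!: continuous_open_preimage holomorphic_on_imp_continuous_on)
  \<comment> \<open>The unknowns are the derivatives of \<open>g\<close> in the old coordinate, which keeps the companion form; only the factor \<open>deriv \<phi>\<close> enters.\<close>
  define v where "v i = (\<lambda>w. (deriv ^^ i) g (\<phi> w))" for i
  define M where "M i j = (\<lambda>w. deriv \<phi> w * (if Suc i < N then (if j = Suc i then 1 else 0) else q j (\<phi> w)))" for i j
  have hol\<phi>V: "\<phi> holomorphic_on V'"
    using \<phi>(1) V'(3) holomorphic_on_subset by blast
  have holg: "(deriv ^^ i) g holomorphic_on V" for i
    using V by (intro holomorphic_higher_deriv)
  have holv: "v i holomorphic_on V'" for i
    unfolding v_def
    by (rule holomorphic_on_compose_gen[OF hol\<phi>V holg, unfolded o_def]) (auto simp: V'_def)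
  have holM: "M i j holomorphic_on ball 0 1" if "i < N" "j < N" for i j
  proof -
    have "(\<lambda>w. q j (\<phi> w)) holomorphic_on ball 0 1"
      by (rule holomorphic_on_compose_gen[OF \<phi>(1) q[OF that(2)], unfolded o_def]) (use \<phi>(2) in auto)
    then show ?thesis
      unfolding M_def using \<phi>(1)
      by (cases "Suc i < N"; cases "j = Suc i") (simp_all, (intro holomorphic_intros; simp)+)
  qed
  have sys: "deriv (v i) w = (\<Sum>j<N. M i j w * v j w)" if i: "i < N" and w: "w \<in> V'" for i w
  proof -
    have "deriv (v i) w = (deriv ^^ Suc i) g (\<phi> w) * deriv \<phi> w"
    proof (rule DERIV_imp_deriv)
      have "((deriv ^^ i) g has_field_derivative deriv ((deriv ^^ i) g) (\<phi> w)) (at (\<phi> w))"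
        using w by (intro holomorphic_derivI[OF holg V(1)]) (auto simp: V'_def)
      moreover have "(\<phi> has_field_derivative deriv \<phi> w) (at w)"
        using w by (intro holomorphic_derivI[OF hol\<phi>V V'(1)])
      ultimately show "(v i has_field_derivative (deriv ^^ Suc i) g (\<phi> w) * deriv \<phi> w) (at w)"
        unfolding v_def using DERIV_chain2 by fastforce
    qed
    also have "\<dots> = (\<Sum>j<N. M i j w * v j w)"
    proof (cases "Suc i < N")
      case True
      then have "(\<Sum>j<N. M i j w * v j w) = (\<Sum>j<N. if j = Suc i then deriv \<phi> w * v (Suc i) w else 0)"
        by (intro sum.cong) (auto simp: M_def)
      then show ?thesis
        using True by (simp add: v_def mult.commute)
    next
      case False
      then have [simp]: "Suc i = N" using i by simp
      show ?thesis
        using w \<phi>(2)[of w] V'(3) unfolding \<open>Suc i = N\<close>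
        by (subst ode) (auto simp: V'_def M_def v_def sum_distrib_left sum_distrib_right mult_ac)
    qed
    finally show ?thesis .
  qed
  have "\<exists>u. \<forall>i<N. u i holomorphic_on ball 0 1 \<and> (\<forall>\<^sub>F z in nhds 0. u i z = v i z) \<and>
      (\<forall>z\<in>ball 0 1. deriv (u i) z = (\<Sum>j<N. M i j z * u j z))"
    by (rule linear_system_germ_extends_to_disc[OF holM V' holv sys])
  then obtain u where u: "\<And>i. i < N \<Longrightarrow> u i holomorphic_on ball 0 1"
    "\<And>i. i < N \<Longrightarrow> \<forall>\<^sub>F z in nhds 0. u i z = v i z"
    by blast
  show ?thesis
  proof (rule that[of "u 0 \<circ> \<psi>"])
    show "u 0 \<circ> \<psi> holomorphic_on W"
      using \<psi>(2) by (intro holomorphic_on_compose_gen[OF \<psi>(1) u(1)[OF N]]) auto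
    have "continuous (at b) \<psi>"
      using holomorphic_on_imp_continuous_on[OF \<psi>(1)] W continuous_on_eq_continuous_at by blast
    then have "filterlim \<psi> (nhds 0) (nhds b)"
      using \<psi>(4) tendsto_at_iff_tendsto_nhds[of \<psi> b] by (simp add: continuous_at)
    then have "\<forall>\<^sub>F z in nhds b. u 0 (\<psi> z) = v 0 (\<psi> z)"
      using u(2)[OF N] by (auto simp: filterlim_iff)
    moreover have "\<forall>\<^sub>F z in nhds b. z \<in> W"
      using W eventually_nhds_in_open by blast
    ultimately show "\<forall>\<^sub>F z in nhds b. (u 0 \<circ> \<psi>) z = g z"
      by eventually_elim (simp add: v_def \<psi>(3))
  qed
qed

section \<open>Analytic continuation and logarithms along a commutator\<close>

text \<open>Join every point of \<open>A\<close> to infinity outside the loop. The union \<open>T\<close> of these paths with the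
complement of a large disc is closed and connected, so each component of its complement has a
connected complement itself and is therefore simply connected. The loop lies in one of them.\<close>

lemma simply_connected_nbhd_of_simple_loop:
  assumes a: "simple_loop a" and A: "finite A" "A \<subseteq> outside (path_image a)"
  obtains W where "open W" "simply_connected W" "W \<noteq> UNIV" "path_image a \<subseteq> W" "W \<inter> A = {}"
proof -
  define O' where "O' = outside (path_image a)"
  have sp: "simple_path a" "pathfinish a = pathstart a"
    using a by (auto simp: simple_loop_def)
  have pa: "path a"
    using sp simple_path_imp_path by blast
  have bdd: "bounded (path_image a)"
    using pa by (rule bounded_path_image)
  have O': "open O'" "connected O'"
    using Jordan_inside_outside[OF sp] by (auto simp: O'_def)
  have pcO: "path_connected O'"
    using O' connected_open_path_connected by blast
  obtain R where R: "R > 0" "path_image a \<subseteq> ball 0 R"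
    using bounded_subset_ballD[OF bdd] by blast
  define F where "F = - ball (0::complex) R"
  have FO: "F \<subseteq> O'"
    unfolding F_def O'_def
    by (rule outside_subset_convex) (use R in auto)
  have conF: "connected F"
    unfolding F_def by (rule connected_complement_bounded_convex) auto
  have RF: "of_real R \<in> F"
    using R by (simp add: F_def)
  have "\<exists>g. path g \<and> path_image g \<subseteq> O' \<and> pathstart g = e \<and> pathfinish g = of_real R" if "e \<in> A" for e
    using pcO that A(2) FO RF unfolding path_connected_def O'_def by blast
  then obtain g where g: "\<And>e. e \<in> A \<Longrightarrow> path (g e) \<and> path_image (g e) \<subseteq> O' \<and> pathstart (g e) = e \<and> pathfinish (g e) = of_real R"
    by metis
  define T where "T = \<Union> (insert F ((\<lambda>e. path_image (g e)) ` A))"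
  have clT: "closed T"
    unfolding T_def using A(1) g by (intro closed_Union) (auto simp: F_def closed_path_image)
  have conT: "connected T"
    unfolding T_def
  proof (rule connected_Union)
    have "of_real R \<in> \<Inter> (insert F ((\<lambda>e. path_image (g e)) ` A))"
      using RF g by (auto simp: pathfinish_in_path_image dest!: g) (metis g pathfinish_in_path_image)
    then show "\<Inter> (insert F ((\<lambda>e. path_image (g e)) ` A)) \<noteq> {}"
      by blast
  qed (use conF g connected_path_image in auto)
  have TO: "T \<subseteq> O'"
    unfolding T_def using FO g by auto
  have AT: "A \<subseteq> T"
  proof
    fix e assume "e \<in> A"
    then have "e \<in> path_image (g e)"
      using g pathstart_in_path_image by metis
    then show "e \<in> T"
      using \<open>e \<in> A\<close> by (auto simp: T_def)
  qed
  have disj: "path_image a \<subseteq> - T"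
    using TO outside_no_overlap[of "path_image a"] unfolding O'_def by blast
  define W where "W = connected_component_set (- T) (pathstart a)"
  have comp: "W \<in> components (- T)"
    unfolding W_def components_def using disj pathstart_in_path_image by blast
  have "W \<subseteq> - T"
    using comp in_components_subset by blast
  then have WB: "W \<subseteq> ball 0 R" and WA: "W \<inter> A = {}"
    using AT by (auto simp: T_def F_def)
  have opW: "open W"
    using comp clT open_components by blast
  have bdW: "bounded W"
    using WB bounded_ball bounded_subset by blast
  show ?thesis
  proof (rule that[of W])
    show "simply_connected W"
      using simply_connected_iff_simple[OF opW bdW] component_complement_connected[OF conT comp]
        in_components_connected[OF comp] by blast
    show "path_image a \<subseteq> W"
      unfolding W_def
      by (rule connected_component_maximal) (use pa disj pathstart_in_path_image in \<open>auto simp: connected_path_image\<close>)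
    show "W \<noteq> UNIV"
      using bdW not_bounded_UNIV by metis
  qed (use opW WA in auto)
qed

text \<open>The hypothesis says that the truth value of \<open>P\<close> is locally constant on the unit interval, with
\<open>Q\<close> its value near \<open>s\<close>. Local constancy rather than openness of \<open>P\<close> and of its negation is what the
identity theorem provides for germs along a path.\<close>

lemma path_induct_locally:
  fixes P :: "real \<Rightarrow> bool"
  assumes "P a0" "a0 \<in> {0..1}" "s \<in> {0..1}"
    and loc: "\<And>s. s \<in> {0..1} \<Longrightarrow> \<exists>Q. (P s \<longleftrightarrow> Q) \<and> (\<forall>\<^sub>F r in at s within {0..1}. P r \<longleftrightarrow> Q)"
  shows "P s"
proof -
  have "P a0 = P s"
    by (rule connected_local_const[of "{0..1::real}"]) (use assms loc in \<open>auto, metis (mono_tags, lifting) eventually_mono\<close>)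
  with assms show ?thesis by simp
qed

text \<open>Unlike the domain in the definition of a continuation, a ball is connected, as the identity
theorem requires; the parameter \<open>r = s\<close> is included.\<close>

lemma continuation_ball:
  assumes "analytic_continuation_along \<gamma> f F" "path \<gamma>" "s \<in> {0..1}"
  shows "\<exists>\<epsilon>>0. \<exists>\<delta>>0. F s holomorphic_on ball (\<gamma> s) \<epsilon> \<and>
    (\<forall>r\<in>{0..1}. dist r s < \<delta> \<longrightarrow> \<gamma> r \<in> ball (\<gamma> s) \<epsilon> \<and> (\<forall>\<^sub>F t in nhds (\<gamma> r). F r t = F s t))"
proof -
  obtain D where D: "open D" "\<gamma> s \<in> D" "F s holomorphic_on D"
    and ev: "\<forall>\<^sub>F r in at s within {0..1}. \<gamma> r \<in> D \<and> (\<forall>\<^sub>F t in nhds (\<gamma> r). F r t = F s t)"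
    using assms unfolding analytic_continuation_along_def by meson
  obtain \<epsilon> where \<epsilon>: "\<epsilon> > 0" "ball (\<gamma> s) \<epsilon> \<subseteq> D"
    using D open_contains_ball by blast
  have "continuous_on {0..1} \<gamma>"
    using assms(2) by (simp add: path_def)
  then have "(\<gamma> \<longlongrightarrow> \<gamma> s) (at s within {0..1})"
    using assms(3) by (simp add: continuous_on_def)
  then have "\<forall>\<^sub>F r in at s within {0..1}. dist (\<gamma> r) (\<gamma> s) < \<epsilon>"
    using \<epsilon>(1) tendstoD by blast
  with ev have "\<forall>\<^sub>F r in at s within {0..1}. dist (\<gamma> r) (\<gamma> s) < \<epsilon> \<and> (\<forall>\<^sub>F t in nhds (\<gamma> r). F r t = F s t)"
    by eventually_elim auto
  then obtain \<delta> where \<delta>: "\<delta> > 0" "\<And>r. r \<in> {0..1} \<Longrightarrow> r \<noteq> s \<Longrightarrow> dist r s < \<delta> \<Longrightarrow>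
      dist (\<gamma> r) (\<gamma> s) < \<epsilon> \<and> (\<forall>\<^sub>F t in nhds (\<gamma> r). F r t = F s t)"
    unfolding eventually_at by blast
  have "F s holomorphic_on ball (\<gamma> s) \<epsilon>"
    using D \<epsilon> holomorphic_on_subset by blast
  moreover have "\<gamma> r \<in> ball (\<gamma> s) \<epsilon> \<and> (\<forall>\<^sub>F t in nhds (\<gamma> r). F r t = F s t)"
    if "r \<in> {0..1}" "dist r s < \<delta>" for r
    using \<delta>(2)[OF that(1) _ that(2)] \<epsilon>(1) by (cases "r = s") (auto simp: dist_commute)
  ultimately show ?thesis
    using \<epsilon>(1) \<delta>(1) by blast
qed

text \<open>By the identity theorem, the germ at \<open>\<gamma> r\<close> of a function holomorphic on a ball vanishes for one
\<open>r\<close> near \<open>s\<close> exactly if it vanishes for all of them.\<close>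

lemma continuation_vanishes:
  assumes cont: "analytic_continuation_along \<gamma> h H" and p: "path \<gamma>"
    and 0: "\<forall>\<^sub>F t in nhds (\<gamma> 0). h t = 0" and s: "s \<in> {0..1}"
  shows "\<forall>\<^sub>F t in nhds (\<gamma> s). H s t = 0"
proof (rule path_induct_locally[of "\<lambda>s. \<forall>\<^sub>F t in nhds (\<gamma> s). H s t = 0" 0])
  have "\<forall>\<^sub>F t in nhds (\<gamma> 0). H 0 t = h t"
    using cont by (simp add: analytic_continuation_along_def)
  with 0 show "\<forall>\<^sub>F t in nhds (\<gamma> 0). H 0 t = 0"
    by eventually_elim simp
next
  fix s :: real assume s: "s \<in> {0..1}"
  obtain \<epsilon> \<delta> where E: "\<epsilon> > 0" "\<delta> > 0" "H s holomorphic_on ball (\<gamma> s) \<epsilon>"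
    "\<And>r. r \<in> {0..1} \<Longrightarrow> dist r s < \<delta> \<Longrightarrow> \<gamma> r \<in> ball (\<gamma> s) \<epsilon> \<and> (\<forall>\<^sub>F t in nhds (\<gamma> r). H r t = H s t)"
    using continuation_ball[OF cont p s] by blast
  define Q where "Q \<longleftrightarrow> (\<forall>t\<in>ball (\<gamma> s) \<epsilon>. H s t = 0)"
  have *: "(\<forall>\<^sub>F t in nhds (\<gamma> r). H r t = 0) \<longleftrightarrow> Q" if r: "r \<in> {0..1}" "dist r s < \<delta>" for r
  proof -
    have rb: "\<gamma> r \<in> ball (\<gamma> s) \<epsilon>" and rg: "\<forall>\<^sub>F t in nhds (\<gamma> r). H r t = H s t"
      using E(4)[OF r] by auto
    show ?thesis
    proof
      assume "\<forall>\<^sub>F t in nhds (\<gamma> r). H r t = 0"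
      with rg have "\<forall>\<^sub>F t in nhds (\<gamma> r). H s t = 0"
        by eventually_elim simp
      moreover have "\<forall>\<^sub>F t in nhds (\<gamma> r). t \<in> ball (\<gamma> s) \<epsilon>"
        using rb eventually_nhds_in_open open_ball by blast
      ultimately have "\<forall>\<^sub>F t in nhds (\<gamma> r). H s t = 0 \<and> t \<in> ball (\<gamma> s) \<epsilon>"
        by eventually_elim simp
      then obtain T where T: "open T" "\<gamma> r \<in> T" "\<And>t. t \<in> T \<Longrightarrow> H s t = 0 \<and> t \<in> ball (\<gamma> s) \<epsilon>"
        unfolding eventually_nhds by blast
      show Q
        unfolding Q_def
      proof
        fix t assume t: "t \<in> ball (\<gamma> s) \<epsilon>"
        show "H s t = 0"
          by (rule analytic_continuation_open[of T "ball (\<gamma> s) \<epsilon>" "H s" "\<lambda>_. 0" t]) (use t T E(1,3) in auto)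
      qed
    next
      assume Q
      have "\<forall>\<^sub>F t in nhds (\<gamma> r). t \<in> ball (\<gamma> s) \<epsilon>"
        using rb eventually_nhds_in_open open_ball by blast
      with rg show "\<forall>\<^sub>F t in nhds (\<gamma> r). H r t = 0"
        by eventually_elim (use \<open>Q\<close> in \<open>auto simp: Q_def\<close>)
    qed
  qed
  have "\<forall>\<^sub>F r in at s within {0..1}. (\<forall>\<^sub>F t in nhds (\<gamma> r). H r t = 0) \<longleftrightarrow> Q"
    unfolding eventually_at using E(2) * by blast
  moreover have "(\<forall>\<^sub>F t in nhds (\<gamma> s). H s t = 0) \<longleftrightarrow> Q"
    using *[OF s] E(2) by simp
  ultimately show "\<exists>Q. ((\<forall>\<^sub>F t in nhds (\<gamma> s). H s t = 0) \<longleftrightarrow> Q) \<and>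
      (\<forall>\<^sub>F r in at s within {0..1}. (\<forall>\<^sub>F t in nhds (\<gamma> r). H r t = 0) \<longleftrightarrow> Q)"
    by blast
qed (use s in auto)

text \<open>This applies to sums, products and differential operators alike: they preserve
holomorphy and depend only on germs. In the sequel it serves for the difference of two continuations
and for the operator of the symmetric square.\<close>

lemma continuation_local_operator:
  fixes T :: "(complex \<Rightarrow> complex) \<Rightarrow> (complex \<Rightarrow> complex) \<Rightarrow> complex \<Rightarrow> complex"
  assumes F: "analytic_continuation_along \<gamma> f F" and G: "analytic_continuation_along \<gamma> g G"
    and hol: "\<And>D f g. open D \<Longrightarrow> f holomorphic_on D \<Longrightarrow> g holomorphic_on D \<Longrightarrow> T f g holomorphic_on D"
    and germ: "\<And>z f f' g g'. \<forall>\<^sub>F t in nhds z. f t = f' t \<Longrightarrow> \<forall>\<^sub>F t in nhds z. g t = g' t \<Longrightarrow>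
      \<forall>\<^sub>F t in nhds z. T f g t = T f' g' t"
  shows "analytic_continuation_along \<gamma> (T f g) (\<lambda>s. T (F s) (G s))"
  unfolding analytic_continuation_along_def
proof (intro conjI ballI)
  show "\<forall>\<^sub>F t in nhds (\<gamma> 0). T (F 0) (G 0) t = T f g t"
    using F G by (intro germ) (simp_all add: analytic_continuation_along_def)
next
  fix s :: real assume s: "s \<in> {0..1}"
  obtain D where D: "open D" "\<gamma> s \<in> D" "F s holomorphic_on D"
    and ev: "\<forall>\<^sub>F r in at s within {0..1}. \<gamma> r \<in> D \<and> (\<forall>\<^sub>F t in nhds (\<gamma> r). F r t = F s t)"
    using F s unfolding analytic_continuation_along_def by meson
  obtain E where E: "open E" "\<gamma> s \<in> E" "G s holomorphic_on E"
    and ev': "\<forall>\<^sub>F r in at s within {0..1}. \<gamma> r \<in> E \<and> (\<forall>\<^sub>F t in nhds (\<gamma> r). G r t = G s t)"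
    using G s unfolding analytic_continuation_along_def by meson
  have "T (F s) (G s) holomorphic_on D \<inter> E"
    using D E by (intro hol) (auto elim: holomorphic_on_subset)
  moreover have "\<forall>\<^sub>F r in at s within {0..1}. \<gamma> r \<in> D \<inter> E \<and>
      (\<forall>\<^sub>F t in nhds (\<gamma> r). T (F r) (G r) t = T (F s) (G s) t)"
    using ev ev' by eventually_elim (simp add: germ)
  ultimately show "\<exists>D. open D \<and> \<gamma> s \<in> D \<and> T (F s) (G s) holomorphic_on D \<and>
      (\<forall>\<^sub>F r in at s within {0..1}. \<gamma> r \<in> D \<and> (\<forall>\<^sub>F t in nhds (\<gamma> r). T (F r) (G r) t = T (F s) (G s) t))"
    using D E by (intro exI[of _ "D \<inter> E"]) auto
qed

lemma continuation_unique:
  assumes F: "analytic_continuation_along \<gamma> f F" and G: "analytic_continuation_along \<gamma> g G"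
    and "path \<gamma>" "\<forall>\<^sub>F t in nhds (\<gamma> 0). f t = g t" "s \<in> {0..1}"
  shows "\<forall>\<^sub>F t in nhds (\<gamma> s). F s t = G s t"
proof -
  have diff: "analytic_continuation_along \<gamma> (\<lambda>t. f t - g t) (\<lambda>s t. F s t - G s t)"
  proof (rule continuation_local_operator[OF F G, where T = "\<lambda>f g t. f t - g t"])
    fix z :: complex and f f' g g' :: "complex \<Rightarrow> complex"
    assume "\<forall>\<^sub>F t in nhds z. f t = f' t" "\<forall>\<^sub>F t in nhds z. g t = g' t"
    then show "\<forall>\<^sub>F t in nhds z. f t - g t = f' t - g' t"
      by eventually_elim simp
  qed (intro holomorphic_intros)
  have "\<forall>\<^sub>F t in nhds (\<gamma> s). F s t - G s t = 0"
    by (rule continuation_vanishes[OF diff assms(3) _ assms(5)])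
       (use assms(4) in \<open>auto elim: eventually_mono\<close>)
  then show ?thesis by simp
qed

lemma continuation_reparametrize:
  assumes F: "analytic_continuation_along \<gamma> f F" and p: "path \<gamma>"
    and \<phi>: "continuous_on {0..1} \<phi>" "\<And>s. s \<in> {0..1} \<Longrightarrow> \<phi> s \<in> {0..1}"
    and \<eta>: "\<And>s. s \<in> {0..1} \<Longrightarrow> \<eta> s = \<gamma> (\<phi> s)"
  shows "analytic_continuation_along \<eta> (F (\<phi> 0)) (\<lambda>s. F (\<phi> s))"
  unfolding analytic_continuation_along_def
proof (intro conjI ballI)
  fix s :: real assume s: "s \<in> {0..1}"
  obtain \<epsilon> \<delta> where E: "\<epsilon> > 0" "\<delta> > 0" "F (\<phi> s) holomorphic_on ball (\<gamma> (\<phi> s)) \<epsilon>"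
    "\<And>r. r \<in> {0..1} \<Longrightarrow> dist r (\<phi> s) < \<delta> \<Longrightarrow> \<gamma> r \<in> ball (\<gamma> (\<phi> s)) \<epsilon> \<and> (\<forall>\<^sub>F t in nhds (\<gamma> r). F r t = F (\<phi> s) t)"
    using continuation_ball[OF F p \<phi>(2)[OF s]] by blast
  have "(\<phi> \<longlongrightarrow> \<phi> s) (at s within {0..1})"
    using \<phi>(1) s by (simp add: continuous_on_def)
  then have "\<forall>\<^sub>F r in at s within {0..1}. dist (\<phi> r) (\<phi> s) < \<delta>"
    using E(2) tendstoD by blast
  moreover have "\<forall>\<^sub>F r in at s within {0..1}. r \<in> {0..1}"
    by (simp add: eventually_at_filter)
  ultimately have "\<forall>\<^sub>F r in at s within {0..1}. \<eta> r \<in> ball (\<eta> s) \<epsilon> \<and> (\<forall>\<^sub>F t in nhds (\<eta> r). F (\<phi> r) t = F (\<phi> s) t)"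
  proof eventually_elim
    case (elim r)
    then show ?case
      using E(4)[of "\<phi> r"] \<phi>(2)[of r] \<eta>[of r] \<eta>[OF s] by simp
  qed
  then show "\<exists>D. open D \<and> \<eta> s \<in> D \<and> F (\<phi> s) holomorphic_on D \<and>
      (\<forall>\<^sub>F r in at s within {0..1}. \<eta> r \<in> D \<and> (\<forall>\<^sub>F t in nhds (\<eta> r). F (\<phi> r) t = F (\<phi> s) t))"
    using E \<eta>[OF s] by (intro exI[of _ "ball (\<eta> s) \<epsilon>"]) auto
qed simp

lemma continuation_within_domain:
  assumes "path \<gamma>" "path_image \<gamma> \<subseteq> W" "open W" "G holomorphic_on W"
  shows "analytic_continuation_along \<gamma> G (\<lambda>_. G)"
  unfolding analytic_continuation_along_def
proof (intro conjI ballI exI[of _ W])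
  fix s :: real assume "s \<in> {0..1}"
  have "\<forall>\<^sub>F r in at s within {0..1}. r \<in> {0..1}"
    by (simp add: eventually_at_filter)
  then show "\<forall>\<^sub>F r in at s within {0..1}. \<gamma> r \<in> W \<and> (\<forall>\<^sub>F t in nhds (\<gamma> r). G t = G t)"
    by eventually_elim (use assms in \<open>auto simp: path_image_def\<close>)
qed (use assms in \<open>auto simp: path_image_def\<close>)

lemma joinpaths_halves:
  shows "s \<le> 1 \<Longrightarrow> (g +++ h) (s / 2) = g s"
    and "0 \<le> s \<Longrightarrow> pathfinish g = pathstart h \<Longrightarrow> (g +++ h) ((1 + s) / 2) = h s"
proof -
  show "(g +++ h) (s / 2) = g s" if "s \<le> 1"
    using that by (simp add: joinpaths_def)
  show "(g +++ h) ((1 + s) / 2) = h s" if "0 \<le> s" "pathfinish g = pathstart h"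
  proof (cases "s = 0")
    case True
    then show ?thesis
      using that(2) by (simp add: joinpaths_def pathstart_def pathfinish_def)
  next
    case False
    with that(1) have "\<not> (1 + s) / 2 \<le> 1 / 2"
      by simp
    moreover have "2 * ((1 + s) / 2) - 1 = s"
      by (simp add: field_simps)
    ultimately show ?thesis
      by (simp only: joinpaths_def if_False)
  qed
qed

lemma commutator_path_pieces:
  assumes "pathfinish a = pathstart a" "pathfinish c = pathstart c" "pathstart a = pathstart c" "s \<in> {0..1}"
  shows "commutator_path a c (s / 2) = a s" "commutator_path a c (1/2 + s / 4) = c s"
    "commutator_path a c (3/4 + s / 8) = reversepath a s" "commutator_path a c (7/8 + s / 8) = reversepath c s"
proof -
  have e: "1/2 + s / 4 = (1 + s / 2) / 2" "3/4 + s / 8 = (1 + (1 + s / 2) / 2) / 2"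
    "7/8 + s / 8 = (1 + (1 + (1 + s) / 2) / 2) / 2"
    by (simp_all add: field_simps)
  show "commutator_path a c (s / 2) = a s" "commutator_path a c (1/2 + s / 4) = c s"
    "commutator_path a c (3/4 + s / 8) = reversepath a s" "commutator_path a c (7/8 + s / 8) = reversepath c s"
    unfolding e commutator_path_def using assms by (simp_all add: joinpaths_halves)
qed

lemma path_commutator_path:
  assumes "path a" "path c" "pathfinish a = pathstart a" "pathfinish c = pathstart c" "pathstart a = pathstart c"
  shows "path (commutator_path a c)"
  using assms by (simp add: commutator_path_def)

text \<open>A germ that extends to a neighbourhood of \<open>a\<close> is not changed by continuation along \<open>a\<close>. Hence along
\<open>a c a\<^sup>- c\<^sup>-\<close> the branch is the same before and after \<open>a\<close>, and the same before and after \<open>a\<^sup>-\<close>; so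
\<open>c\<^sup>-\<close> starts with the branch with which \<open>c\<close> ended and undoes \<open>c\<close>. The extension is asked for the
branches met on the way, not for \<open>f\<close> alone, since \<open>c\<close> may change the branch.\<close>

lemma commutator_continuation_closes_up:
  assumes a: "path a" "pathfinish a = pathstart a" and c: "path c" "pathfinish c = pathstart c"
    and ac: "pathstart a = pathstart c"
    and F: "analytic_continuation_along (commutator_path a c) f F"
    and ext: "\<And>s. s \<in> {0..1} \<Longrightarrow> commutator_path a c s = pathstart a \<Longrightarrow>
      \<exists>W G. open W \<and> path_image a \<subseteq> W \<and> G holomorphic_on W \<and> (\<forall>\<^sub>F t in nhds (pathstart a). G t = F s t)"
  shows "\<forall>\<^sub>F t in nhds (pathstart a). F 1 t = F 0 t"
proof -
  define b where "b = pathstart a"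
  define \<gamma> where "\<gamma> = commutator_path a c"
  note pieces = commutator_path_pieces[OF a(2) c(2) ac, folded \<gamma>_def]
  have p\<gamma>: "path \<gamma>"
    unfolding \<gamma>_def using path_commutator_path a c ac by blast
  have at_b: "a 0 = b" "a 1 = b" "c 0 = b" "c 1 = b"
    using a(2) c(2) ac by (auto simp: b_def pathstart_def pathfinish_def)
  have g_b: "\<gamma> 0 = b" "\<gamma> (1/2) = b" "\<gamma> (3/4) = b" "\<gamma> (7/8) = b" "\<gamma> 1 = b"
    using pieces(1)[of 0] pieces(2)[of 0] pieces(3)[of 0] pieces(4)[of 0] pieces(4)[of 1] at_b
    by (auto simp: reversepath_def)
  note F' = F[folded \<gamma>_def]
  have Fa: "analytic_continuation_along a (F 0) (\<lambda>s. F (s / 2))"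
  proof -
    have "continuous_on {0..1} (\<lambda>s::real. s / 2)"
      by (intro continuous_intros) auto
    then have "analytic_continuation_along a (F ((\<lambda>s::real. s / 2) 0)) (\<lambda>s. F ((\<lambda>s::real. s / 2) s))"
      by (rule continuation_reparametrize[OF F' p\<gamma>]) (use pieces(1) in auto)
    then show ?thesis by simp
  qed
  have Fc: "analytic_continuation_along c (F (1/2)) (\<lambda>s. F (1/2 + s / 4))"
  proof -
    have "continuous_on {0..1} (\<lambda>s::real. 1/2 + s / 4)"
      by (intro continuous_intros) auto
    then have "analytic_continuation_along c (F ((\<lambda>s::real. 1/2 + s / 4) 0)) (\<lambda>s. F ((\<lambda>s::real. 1/2 + s / 4) s))"
      by (rule continuation_reparametrize[OF F' p\<gamma>]) (use pieces(2) in auto)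
    then show ?thesis by simp
  qed
  have Fa': "analytic_continuation_along (reversepath a) (F (3/4)) (\<lambda>s. F (3/4 + s / 8))"
  proof -
    have "continuous_on {0..1} (\<lambda>s::real. 3/4 + s / 8)"
      by (intro continuous_intros) auto
    then have "analytic_continuation_along (reversepath a) (F ((\<lambda>s::real. 3/4 + s / 8) 0)) (\<lambda>s. F ((\<lambda>s::real. 3/4 + s / 8) s))"
      by (rule continuation_reparametrize[OF F' p\<gamma>]) (use pieces(3) in auto)
    then show ?thesis by simp
  qed
  have Fc': "analytic_continuation_along (reversepath c) (F (7/8)) (\<lambda>s. F (7/8 + s / 8))"
  proof -
    have "continuous_on {0..1} (\<lambda>s::real. 7/8 + s / 8)"
      by (intro continuous_intros) auto
    then have "analytic_continuation_along (reversepath c) (F ((\<lambda>s::real. 7/8 + s / 8) 0)) (\<lambda>s. F ((\<lambda>s::real. 7/8 + s / 8) s))"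
      by (rule continuation_reparametrize[OF F' p\<gamma>]) (use pieces(4) in auto)
    then show ?thesis by simp
  qed
  \<comment> \<open>The continuation along \<open>c\<close>, run backwards; the branches met along the last piece of \<open>\<gamma>\<close> agree with it by uniqueness.\<close>
  have Fcr: "analytic_continuation_along (reversepath c) (F (3/4)) (\<lambda>s. F (1/2 + (1 - s) / 4))"
  proof -
    have "continuous_on {0..1} (\<lambda>s::real. 1 - s)"
      by (intro continuous_intros)
    then have "analytic_continuation_along (reversepath c) ((\<lambda>s. F (1/2 + s / 4)) ((\<lambda>s::real. 1 - s) 0)) (\<lambda>s. (\<lambda>s. F (1/2 + s / 4)) ((\<lambda>s::real. 1 - s) s))"
      by (rule continuation_reparametrize[OF Fc c(1)]) (use reversepath_def[of c] in auto)
    then show ?thesis by simp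
  qed
  \<comment> \<open>Both \<open>a\<close> and \<open>reversepath a\<close> are instances of \<open>\<eta>\<close>.\<close>
  have triv: "\<forall>\<^sub>F t in nhds b. H 1 t = F s t"
    if H: "analytic_continuation_along \<eta> (F s) H" and \<eta>: "path \<eta>" "path_image \<eta> = path_image a" "\<eta> 0 = b" "\<eta> 1 = b"
      and s: "s \<in> {0..1}" "\<gamma> s = b" for \<eta> H s
  proof -
    obtain W G where W: "open W" "path_image a \<subseteq> W" "G holomorphic_on W" "\<forall>\<^sub>F t in nhds b. G t = F s t"
      using ext[of s] s by (auto simp: \<gamma>_def b_def)
    have "\<forall>\<^sub>F t in nhds (\<eta> 1). G t = H 1 t"
      using continuation_unique[OF continuation_within_domain[OF \<eta>(1) _ W(1,3)] H \<eta>(1), of 1] W \<eta> by auto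
    with W(4) show ?thesis
      unfolding \<eta> by eventually_elim simp
  qed
  have rev: "reversepath a 0 = b" "reversepath a 1 = b" "reversepath c 0 = b" "reversepath c 1 = b"
    by (simp_all add: reversepath_def at_b)
  have 1: "\<forall>\<^sub>F t in nhds b. F (1/2) t = F 0 t"
    using triv[OF Fa a(1)] at_b g_b by simp
  have 2: "\<forall>\<^sub>F t in nhds b. F (7/8) t = F (3/4) t"
    using triv[OF Fa' _ _ rev(1,2)] a(1) g_b by simp
  have 3: "\<forall>\<^sub>F t in nhds b. F 1 t = F (1/2) t"
    using continuation_unique[OF Fc' Fcr, of 1] 2 c(1) rev(3,4) by simp
  from 1 3 show ?thesis
    unfolding b_def by eventually_elim simp
qed

text \<open>The difference is continuous with values in the discrete set \<open>2 \<pi> i \<int>\<close>.\<close>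

lemma log_branches_differ_by_constant:
  fixes l1 l2 :: "'a::topological_space \<Rightarrow> complex"
  assumes T: "connected T" and c: "continuous_on T l1" "continuous_on T l2"
    and e: "\<And>x. x \<in> T \<Longrightarrow> exp (l1 x) = exp (l2 x)" and xy: "x \<in> T" "y \<in> T"
  shows "l1 x - l2 x = l1 y - l2 y"
proof -
  have "(\<lambda>x. l1 x - l2 x) constant_on T"
  proof (rule continuous_discrete_range_constant[OF T])
    show "continuous_on T (\<lambda>x. l1 x - l2 x)"
      using c by (intro continuous_intros)
    fix x assume x: "x \<in> T"
    have "2 * pi \<le> norm ((l1 y - l2 y) - (l1 x - l2 x))" if y: "y \<in> T" "l1 y - l2 y \<noteq> l1 x - l2 x" for y
    proof -
      have "exp (l1 y - l2 y) = exp (l1 x - l2 x)"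
        using e x y by (simp add: exp_diff)
      then obtain n :: int where n: "l1 y - l2 y = l1 x - l2 x + of_int (2 * n) * pi * \<i>"
        unfolding exp_eq by blast
      then have "n \<noteq> 0"
        using y(2) by auto
      then have "1 \<le> \<bar>real_of_int n\<bar>"
        by linarith
      then have "2 * pi \<le> 2 * pi * \<bar>real_of_int n\<bar>"
        by simp
      then show ?thesis
        unfolding n by (simp add: norm_mult)
    qed
    then show "\<exists>e>0. \<forall>y. y \<in> T \<and> l1 y - l2 y \<noteq> l1 x - l2 x \<longrightarrow> e \<le> norm ((l1 y - l2 y) - (l1 x - l2 x))"
      by (intro exI[of _ "2 * pi"]) auto
  qed
  then show ?thesis
    using xy by (auto simp: constant_on_def)
qed

text \<open>On each of the pairs \<open>a, a\<^sup>-\<close> and \<open>c, c\<^sup>-\<close> the two logarithms belong to the same points, traversed in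
opposite directions. They differ by a constant, so their increments cancel.\<close>

lemma commutator_log_closes_up:
  fixes l :: "real \<Rightarrow> complex"
  assumes a: "pathfinish a = pathstart a" and c: "pathfinish c = pathstart c"
    and ac: "pathstart a = pathstart c"
    and l: "continuous_on {0..1} l" "\<And>s. s \<in> {0..1} \<Longrightarrow> exp (l s) = x - commutator_path a c s"
  shows "l 1 = l 0"
proof -
  note pieces = commutator_path_pieces[OF a c ac]
  have cl: "continuous_on {0..1} (\<lambda>s. l (\<phi> s))"
    if "continuous_on {0..1} \<phi>" "\<And>s. s \<in> {0..1} \<Longrightarrow> \<phi> s \<in> {0..1}" for \<phi> :: "real \<Rightarrow> real"
    by (rule continuous_on_compose2[OF l(1)]) (use that in auto)
  have "l (1 / 2) - l (3/4 + (1 - 1) / 8) = l (0 / 2) - l (3/4 + (1 - 0) / 8)"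
  proof (rule log_branches_differ_by_constant[of "{0..1::real}" "\<lambda>s. l (s / 2)" "\<lambda>s. l (3/4 + (1 - s) / 8)" 1 0])
    fix s :: real assume s: "s \<in> {0..1}"
    have "3/4 + (1 - s) / 8 \<in> {0..1}"
      using s by (auto simp: field_simps)
    with s show "exp (l (s / 2)) = exp (l (3/4 + (1 - s) / 8))"
      using pieces(1)[OF s] pieces(3)[of "1 - s"] l(2)[of "s / 2"] l(2)[of "3/4 + (1 - s) / 8"]
      by (simp add: reversepath_def)
  next
    show "continuous_on {0..1} (\<lambda>s. l (s / 2))" "continuous_on {0..1} (\<lambda>s. l (3/4 + (1 - s) / 8))"
      by (rule cl; auto intro!: continuous_intros simp: field_simps)+
  qed auto
  moreover have "l (1/2 + 1 / 4) - l (7/8 + (1 - 1) / 8) = l (1/2 + 0 / 4) - l (7/8 + (1 - 0) / 8)"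
  proof (rule log_branches_differ_by_constant[of "{0..1::real}" "\<lambda>s. l (1/2 + s / 4)" "\<lambda>s. l (7/8 + (1 - s) / 8)" 1 0])
    fix s :: real assume s: "s \<in> {0..1}"
    have "1/2 + s / 4 \<in> {0..1}" "7/8 + (1 - s) / 8 \<in> {0..1}"
      using s by (auto simp: field_simps)
    with s show "exp (l (1/2 + s / 4)) = exp (l (7/8 + (1 - s) / 8))"
      using pieces(2)[OF s] pieces(4)[of "1 - s"] l(2)[of "1/2 + s / 4"] l(2)[of "7/8 + (1 - s) / 8"]
      by (simp add: reversepath_def)
  next
    show "continuous_on {0..1} (\<lambda>s. l (1/2 + s / 4))" "continuous_on {0..1} (\<lambda>s. l (7/8 + (1 - s) / 8))"
      by (rule cl; auto intro!: continuous_intros simp: field_simps)+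
  qed auto
  ultimately show ?thesis
    by (simp add: algebra_simps)
qed

section \<open>Euler integrals of solutions of the symmetric square\<close>

definition lame_p1 :: "complex \<Rightarrow> complex \<Rightarrow> complex \<Rightarrow> complex \<Rightarrow> complex" where
  "lame_p1 e1 e2 e3 x = 4 * ((x - e2) * (x - e3) + (x - e1) * (x - e3) + (x - e1) * (x - e2))"

definition lame_p2 :: "complex \<Rightarrow> complex \<Rightarrow> complex \<Rightarrow> complex \<Rightarrow> complex" where
  "lame_p2 e1 e2 e3 x = 24 * x - 8 * (e1 + e2 + e3)"

lemma lame_p_has_derivs:
  "(lame_p e1 e2 e3 has_field_derivative lame_p1 e1 e2 e3 x) (at x)"
  "(lame_p1 e1 e2 e3 has_field_derivative lame_p2 e1 e2 e3 x) (at x)"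
  unfolding lame_p_def [abs_def] lame_p1_def [abs_def] lame_p2_def
  by (auto intro!: derivative_eq_intros simp: algebra_simps)

lemma deriv_lame_p:
  "deriv (lame_p e1 e2 e3) = lame_p1 e1 e2 e3" "(deriv ^^ 2) (lame_p e1 e2 e3) = lame_p2 e1 e2 e3"
proof -
  show 1: "deriv (lame_p e1 e2 e3) = lame_p1 e1 e2 e3"
    using lame_p_has_derivs(1) by (intro ext DERIV_imp_deriv)
  have "deriv (lame_p1 e1 e2 e3) = lame_p2 e1 e2 e3"
    using lame_p_has_derivs(2) by (intro ext DERIV_imp_deriv)
  with 1 show "(deriv ^^ 2) (lame_p e1 e2 e3) = lame_p2 e1 e2 e3"
    by (simp add: numeral_2_eq_2)
qed

text \<open>The left-hand side is the operator of the symmetric square in the variable \<open>t\<close>, applied to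
\<open>(x - t)\<^sup>\<beta>\<close> and divided by \<open>(x - t)\<^sup>\<beta>\<^sup>-\<^sup>3\<close>; the right-hand side is its expansion in powers of
\<open>x - t\<close>. The factorization of the last coefficient singles out the three values of \<open>\<mu>\<close>.\<close>

lemma adjoint_on_kernel_power:
  fixes x t \<beta> n H :: complex
  shows "- \<beta> * (\<beta> - 1) * (\<beta> - 2) * lame_p e1 e2 e3 t + 3/2 * \<beta> * (\<beta> - 1) * lame_p1 e1 e2 e3 t * (x - t)
    - \<beta> * (lame_p2 e1 e2 e3 t / 2 - 4 * (n * (n + 1) * t - H)) * (x - t)^2 - 2 * n * (n + 1) * (x - t)^3
    = - \<beta> * (\<beta> - 1) * (\<beta> - 2) * lame_p e1 e2 e3 x + \<beta> * (\<beta> - 1) * (\<beta> - 1/2) * lame_p1 e1 e2 e3 x * (x - t)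
    + (4 * \<beta> * (n * (n + 1) * x - H) - \<beta>^3 / 2 * lame_p2 e1 e2 e3 x) * (x - t)^2
    + 2 * ((2 * \<beta> + 1) * (\<beta> - n) * (\<beta> + n + 1)) * (x - t)^3"
  unfolding lame_p_def lame_p1_def lame_p2_def
  by (simp add: field_simps power2_eq_square power3_eq_cube)

lemma continuation_differential_operator:
  fixes q :: "nat \<Rightarrow> complex \<Rightarrow> complex"
  assumes F: "analytic_continuation_along \<gamma> f F" and q: "\<And>j. q j holomorphic_on UNIV"
  shows "analytic_continuation_along \<gamma> (\<lambda>t. \<Sum>j<N. q j t * (deriv ^^ j) f t)
    (\<lambda>s t. \<Sum>j<N. q j t * (deriv ^^ j) (F s) t)"
proof (rule continuation_local_operator[OF F F, where T = "\<lambda>f _ t. \<Sum>j<N. q j t * (deriv ^^ j) f t"])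
  fix D :: "complex set" and f :: "complex \<Rightarrow> complex"
  assume "open D" "f holomorphic_on D"
  then show "(\<lambda>t. \<Sum>j<N. q j t * (deriv ^^ j) f t) holomorphic_on D"
    using q by (intro holomorphic_intros holomorphic_higher_deriv) (auto intro: holomorphic_on_subset)
next
  fix z :: complex and g h :: "complex \<Rightarrow> complex"
  assume "\<forall>\<^sub>F t in nhds z. g t = h t"
  then have "\<forall>\<^sub>F y in nhds z. \<forall>\<^sub>F t in nhds y. g t = h t"
    by (simp add: eventually_eventually)
  then show "\<forall>\<^sub>F t in nhds z. (\<Sum>j<N. q j t * (deriv ^^ j) g t) = (\<Sum>j<N. q j t * (deriv ^^ j) h t)"
  proof eventually_elim
    case (elim t)
    then have "(deriv ^^ j) g t = (deriv ^^ j) h t" for j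
      by (intro higher_deriv_cong_ev refl)
    then show ?case by simp
  qed
qed

text \<open>The data of an Euler integral along an arbitrary path. That the path is a commutator enters only
through the return of the branches, which appears later as a hypothesis.\<close>

locale euler_integrand =
  fixes \<gamma> :: "real \<Rightarrow> complex" and f :: "complex \<Rightarrow> complex" and F :: "real \<Rightarrow> complex \<Rightarrow> complex"
    and X :: "complex set" and L :: "complex \<Rightarrow> real \<Rightarrow> complex"
  assumes valid: "valid_path \<gamma>"
    and continuation: "analytic_continuation_along \<gamma> f F"
    and open_X: "open X"
    and log_branch: "log_branch_along \<gamma> X L"
begin

definition speed :: "real \<Rightarrow> complex" where
  "speed s = vector_derivative \<gamma> (at s within {0..1})"

text \<open>The exponent is a parameter because each differentiation with respect to \<open>x\<close> lowers it by one. The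
Euler integral with parameter \<open>\<mu>\<close> is the case \<open>\<beta> = -1 - \<mu>\<close>.\<close>

definition kernel_integral :: "complex \<Rightarrow> complex \<Rightarrow> complex" where
  "kernel_integral \<beta> x = integral {0..1} (\<lambda>s. F s (\<gamma> s) * exp (\<beta> * L x s) * speed s)"

lemma path: "path \<gamma>"
  using valid by (rule valid_path_imp_path)

lemma exp_L: "x \<in> X \<Longrightarrow> s \<in> {0..1} \<Longrightarrow> exp (L x s) = x - \<gamma> s"
  using log_branch by (simp add: log_branch_along_def)

lemma off_path: "x \<in> X \<Longrightarrow> s \<in> {0..1} \<Longrightarrow> x \<noteq> \<gamma> s"
  using exp_L[of x s] by (metis exp_not_eq_zero right_minus_eq)

lemma speed_exceptions:
  obtains S where "finite S" "\<And>s. s \<in> {0<..<1} - S \<Longrightarrow> (\<gamma> has_vector_derivative speed s) (at s)"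
proof -
  obtain S where S: "finite S" "\<gamma> C1_differentiable_on {0..1} - S"
    using valid by (auto simp: valid_path_def piecewise_C1_differentiable_on_def)
  have "(\<gamma> has_vector_derivative speed s) (at s)" if s: "s \<in> {0<..<1} - S" for s
  proof -
    have "\<gamma> differentiable at s"
      using S(2) s unfolding C1_differentiable_on_eq by auto
    moreover have "at s within {0..1} = at s"
      using s by (intro at_within_interior) auto
    ultimately show ?thesis
      by (simp add: speed_def vector_derivative_works)
  qed
  with S(1) that show ?thesis by blast
qed

text \<open>Near a point of \<open>X \<times> {0..1}\<close> the branch is, up to a constant, the principal logarithm of
\<open>(x - t) / (x0 - \<gamma> s0)\<close>, a quotient close to \<open>1\<close>. This makes the kernel locally a holomorphic
function of \<open>x\<close> and \<open>t\<close>.\<close>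

lemma log_branch_local:
  assumes x0: "x0 \<in> X" and s0: "s0 \<in> {0..1}" and e: "e > 0"
  shows "\<exists>\<rho>>0. \<exists>\<eta>>0. \<exists>\<delta>>0. \<eta> \<le> e \<and> ball x0 \<rho> \<subseteq> X \<and>
    (\<forall>x\<in>ball x0 \<rho>. \<forall>t\<in>ball (\<gamma> s0) \<eta>. (x - t) / (x0 - \<gamma> s0) \<notin> \<real>\<^sub>\<le>\<^sub>0) \<and>
    (\<forall>r\<in>{0..1}. dist r s0 < \<delta> \<longrightarrow> \<gamma> r \<in> ball (\<gamma> s0) \<eta> \<and>
      (\<forall>x\<in>ball x0 \<rho>. L x r = L x0 s0 + Ln ((x - \<gamma> r) / (x0 - \<gamma> s0))))"
proof -
  define d where "d = norm (x0 - \<gamma> s0)"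
  have d: "d > 0"
    using off_path[OF x0 s0] by (simp add: d_def)
  obtain \<rho>' where \<rho>': "\<rho>' > 0" "ball x0 \<rho>' \<subseteq> X"
    using open_X x0 open_contains_ball by blast
  \<comment> \<open>With both radii at most \<open>d / 4\<close> the quotient stays within \<open>1 / 2\<close> of \<open>1\<close>, off the cut of \<open>Ln\<close>.\<close>
  define \<rho> where "\<rho> = min \<rho>' (d / 4)"
  define \<eta> where "\<eta> = min e (d / 4)"
  have \<rho>: "\<rho> > 0" "ball x0 \<rho> \<subseteq> X"
    using \<rho>' d by (auto simp: \<rho>_def)
  have \<eta>: "\<eta> > 0" "\<eta> \<le> e"
    using e d by (auto simp: \<eta>_def)
  have slit: "(x - t) / (x0 - \<gamma> s0) \<notin> \<real>\<^sub>\<le>\<^sub>0" if x: "x \<in> ball x0 \<rho>" and t: "t \<in> ball (\<gamma> s0) \<eta>" for x t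
  proof
    assume "(x - t) / (x0 - \<gamma> s0) \<in> \<real>\<^sub>\<le>\<^sub>0"
    then have "Re ((x - t) / (x0 - \<gamma> s0)) \<le> 0"
      by (simp add: complex_nonpos_Reals_iff)
    then have "1 \<le> Re (1 - (x - t) / (x0 - \<gamma> s0))"
      by simp
    also have "\<dots> \<le> norm (1 - (x - t) / (x0 - \<gamma> s0))"
      by (rule complex_Re_le_cmod)
    also have "1 - (x - t) / (x0 - \<gamma> s0) = ((x0 - x) - (\<gamma> s0 - t)) / (x0 - \<gamma> s0)"
      using d by (simp add: d_def field_simps)
    also have "norm \<dots> = norm ((x0 - x) - (\<gamma> s0 - t)) / d"
      by (simp add: norm_divide d_def)
    also have "\<dots> \<le> (norm (x0 - x) + norm (\<gamma> s0 - t)) / d"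
      using d by (intro divide_right_mono norm_triangle_ineq4) auto
    also have "\<dots> \<le> (d / 4 + d / 4) / d"
      using x t d by (intro divide_right_mono add_mono) (auto simp: dist_norm \<rho>_def \<eta>_def)
    also have "\<dots> < 1"
      using d by simp
    finally show False by simp
  qed
  have "continuous_on {0..1} \<gamma>"
    using path by (simp add: path_def)
  then obtain \<delta> where \<delta>: "\<delta> > 0" "\<And>r. r \<in> {0..1} \<Longrightarrow> dist r s0 < \<delta> \<Longrightarrow> dist (\<gamma> r) (\<gamma> s0) < \<eta>"
    using s0 \<eta>(1) unfolding continuous_on_iff by blast
  define K where "K = {0..1} \<inter> ball s0 \<delta>"
  have K: "r \<in> K \<longleftrightarrow> r \<in> {0..1} \<and> dist r s0 < \<delta>" for r
    by (auto simp: K_def dist_commute)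
  have \<gamma>K: "\<gamma> r \<in> ball (\<gamma> s0) \<eta>" if "r \<in> K" for r
    using \<delta>(2)[of r] that by (simp add: K dist_commute)
  have conT: "connected (ball x0 \<rho> \<times> K)"
    unfolding K_def
    by (intro connected_Times convex_connected convex_Int convex_ball) auto
  have eq: "L x r = L x0 s0 + Ln ((x - \<gamma> r) / (x0 - \<gamma> s0))" if x: "x \<in> ball x0 \<rho>" and r: "r \<in> K" for x r
  proof -
    define l1 where "l1 = (\<lambda>(x, s). L x s)"
    define l2 where "l2 = (\<lambda>z. L x0 s0 + Ln ((fst z - \<gamma> (snd z)) / (x0 - \<gamma> s0)))"
    have "l1 (x, r) - l2 (x, r) = l1 (x0, s0) - l2 (x0, s0)"
    proof (rule log_branches_differ_by_constant[OF conT])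
      show "continuous_on (ball x0 \<rho> \<times> K) l1"
        using log_branch \<rho>(2) unfolding l1_def log_branch_along_def
        by (elim conjE continuous_on_subset) (auto simp: K)
      have "continuous_on (ball x0 \<rho> \<times> K) (\<lambda>z. \<gamma> (snd z))"
        by (rule continuous_on_compose2[of "{0..1}" \<gamma>])
           (use path K in \<open>auto simp: path_def intro!: continuous_intros\<close>)
      then show "continuous_on (ball x0 \<rho> \<times> K) l2"
        unfolding l2_def
        by (intro continuous_intros) (use d slit \<gamma>K in \<open>auto simp: d_def\<close>)
      fix z assume "z \<in> ball x0 \<rho> \<times> K"
      then obtain x' r' where z: "z = (x', r')" "x' \<in> ball x0 \<rho>" "r' \<in> K" by auto
      have "x' \<in> X" "r' \<in> {0..1}"
        using z \<rho>(2) K by auto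
      then show "exp (l1 z) = exp (l2 z)"
        using z exp_L off_path x0 s0 by (simp add: l1_def l2_def exp_add)
    qed (use x r \<rho> s0 \<delta> K in auto)
    then show ?thesis
      using d by (simp add: l1_def l2_def d_def)
  qed
  show ?thesis
    using \<rho> \<eta> \<delta>(1) slit eq \<gamma>K K by (intro exI[of _ \<rho>] exI[of _ \<eta>] exI[of _ \<delta>] conjI) blast+
qed

abbreviation integrand :: "complex \<Rightarrow> complex \<Rightarrow> real \<Rightarrow> complex" where
  "integrand \<beta> x s \<equiv> F s (\<gamma> s) * exp (\<beta> * L x s) * speed s"

text \<open>Differentiability under the integral sign for the part \<open>{u..v}\<close> of the path. One neighbourhood
serves all exponents, so that derivatives of every order exist on it; the property passes from two
adjacent intervals to their union.\<close>

definition differentiable_piece :: "complex \<Rightarrow> real \<Rightarrow> real \<Rightarrow> bool" where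
  "differentiable_piece x0 u v \<longleftrightarrow> (\<exists>N g. open N \<and> x0 \<in> N \<and>
     (\<forall>\<beta>. \<forall>x\<in>N. (integrand \<beta> x has_integral g \<beta> x) {u..v} \<and>
        (g \<beta> has_field_derivative \<beta> * g (\<beta> - 1) x) (at x)))"

text \<open>A piecewise continuously differentiable path may have unbounded speed near its exceptional
parameters, so the Leibniz rule does not apply to the integrand as it stands. On a short piece the
integrand is holomorphic in \<open>t\<close> on a disc, and by means of a primitive the piece of the path can be
replaced by the chord between its end points, where the rule applies.\<close>

lemma integral_over_short_piece:
  assumes x0: "x0 \<in> X" and s0: "s0 \<in> {0..1}"
  shows "\<exists>d>0. \<forall>u v. 0 \<le> u \<and> u \<le> s0 \<and> s0 \<le> v \<and> v \<le> 1 \<and> v - u < d \<longrightarrow> differentiable_piece x0 u v"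
proof -
  obtain \<epsilon> \<delta>1 where \<epsilon>: "\<epsilon> > 0" "\<delta>1 > 0" "F s0 holomorphic_on ball (\<gamma> s0) \<epsilon>"
    "\<And>r. r \<in> {0..1} \<Longrightarrow> dist r s0 < \<delta>1 \<Longrightarrow> (\<forall>\<^sub>F t in nhds (\<gamma> r). F r t = F s0 t)"
    using continuation_ball[OF continuation path s0] by blast
  obtain \<rho> \<eta> \<delta>2 where loc: "\<rho> > 0" "\<eta> > 0" "\<delta>2 > 0" "\<eta> \<le> \<epsilon>" "ball x0 \<rho> \<subseteq> X"
    "\<And>x t. x \<in> ball x0 \<rho> \<Longrightarrow> t \<in> ball (\<gamma> s0) \<eta> \<Longrightarrow> (x - t) / (x0 - \<gamma> s0) \<notin> \<real>\<^sub>\<le>\<^sub>0"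
    "\<And>r. r \<in> {0..1} \<Longrightarrow> dist r s0 < \<delta>2 \<Longrightarrow> \<gamma> r \<in> ball (\<gamma> s0) \<eta>"
    "\<And>r x. r \<in> {0..1} \<Longrightarrow> dist r s0 < \<delta>2 \<Longrightarrow> x \<in> ball x0 \<rho> \<Longrightarrow> L x r = L x0 s0 + Ln ((x - \<gamma> r) / (x0 - \<gamma> s0))"
    using log_branch_local[OF x0 s0 \<epsilon>(1)] by blast
  define D where "D = ball (\<gamma> s0) \<eta>"
  define N where "N = ball x0 \<rho>"
  \<comment> \<open>\<open>h \<beta> x t\<close> is the integrand without the speed, as a function of the point \<open>t\<close> instead of the parameter.\<close>
  define l where "l x t = L x0 s0 + Ln ((x - t) / (x0 - \<gamma> s0))" for x t
  define h where "h \<beta> x t = F s0 t * exp (\<beta> * l x t)" for \<beta> x t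
  have D: "open D" "convex D" and N: "open N" "convex N" "x0 \<in> N"
    using loc by (auto simp: D_def N_def)
  have slit: "(x - t) / (x0 - \<gamma> s0) \<notin> \<real>\<^sub>\<le>\<^sub>0" if "x \<in> N" "t \<in> D" for x t
    using loc(6) that by (simp add: N_def D_def)
  have nz: "x0 - \<gamma> s0 \<noteq> 0"
    using off_path[OF x0 s0] by simp
  have xt: "x - t \<noteq> 0" if "x \<in> N" "t \<in> D" for x t
    using slit[OF that] by auto
  have expl: "exp (l x t) = x - t" if "x \<in> N" "t \<in> D" for x t
    using xt[OF that] nz exp_L[OF x0 s0] by (simp add: l_def exp_add)
  have holF: "F s0 holomorphic_on D"
    using \<epsilon>(3) loc(4) holomorphic_on_subset subset_ball unfolding D_def by blast
  have hol_h: "h \<beta> x holomorphic_on D" if "x \<in> N" for \<beta> x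
    unfolding h_def l_def using slit[OF that] nz
    by (intro holomorphic_intros holF) auto
  have h_x: "((\<lambda>x. h \<beta> x t) has_field_derivative \<beta> * h (\<beta> - 1) x t) (at x)" if "x \<in> N" "t \<in> D" for \<beta> x t
  proof -
    have "((\<lambda>x. (x - t) / (x0 - \<gamma> s0)) has_field_derivative 1 / (x0 - \<gamma> s0)) (at x)"
      using nz by (auto intro!: derivative_eq_intros)
    then have "((\<lambda>x. Ln ((x - t) / (x0 - \<gamma> s0))) has_field_derivative
        inverse ((x - t) / (x0 - \<gamma> s0)) * (1 / (x0 - \<gamma> s0))) (at x)"
      by (rule DERIV_chain2[where f = Ln and g = "\<lambda>x. (x - t) / (x0 - \<gamma> s0)", OF has_field_derivative_Ln[OF slit[OF that]]])
    moreover have "inverse ((x - t) / (x0 - \<gamma> s0)) * (1 / (x0 - \<gamma> s0)) = 1 / (x - t)"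
      using nz by (simp add: divide_inverse)
    ultimately have "((\<lambda>x. Ln ((x - t) / (x0 - \<gamma> s0))) has_field_derivative 1 / (x - t)) (at x)"
      by simp
    from DERIV_add[OF DERIV_const this, of "L x0 s0"]
    have "((\<lambda>x. l x t) has_field_derivative 1 / (x - t)) (at x)"
      by (simp add: l_def)
    then have "((\<lambda>x. h \<beta> x t) has_field_derivative F s0 t * (exp (\<beta> * l x t) * (\<beta> * (1 / (x - t))))) (at x)"
      unfolding h_def by (auto intro!: derivative_eq_intros)
    also have "exp (\<beta> * l x t) = exp ((\<beta> - 1) * l x t) * exp (l x t)"
      by (simp add: algebra_simps flip: exp_add)
    also have "F s0 t * (exp ((\<beta> - 1) * l x t) * exp (l x t) * (\<beta> * (1 / (x - t)))) = \<beta> * h (\<beta> - 1) x t"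
      using xt[OF that] expl[OF that] by (simp add: h_def)
    finally show ?thesis .
  qed
  have cont_h: "continuous_on (N \<times> D) (\<lambda>z. h \<beta> (fst z) (snd z))" for \<beta>
  proof -
    have "continuous_on (N \<times> D) (\<lambda>z. F s0 (snd z))"
      by (rule continuous_on_compose2[OF holomorphic_on_imp_continuous_on[OF holF]])
         (auto intro!: continuous_intros)
    then show ?thesis
      unfolding h_def l_def by (intro continuous_intros) (use slit nz in auto)
  qed
  show ?thesis
  proof (intro exI[of _ "min \<delta>1 \<delta>2"] conjI allI impI)
    fix u v assume uv: "0 \<le> u \<and> u \<le> s0 \<and> s0 \<le> v \<and> v \<le> 1 \<and> v - u < min \<delta>1 \<delta>2"
    have near: "r \<in> {0..1} \<and> dist r s0 < \<delta>1 \<and> dist r s0 < \<delta>2" if "r \<in> {u..v}" for r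
      using uv that by (auto simp: dist_real_def)
    have \<gamma>D: "\<gamma> r \<in> D" if "r \<in> {u..v}" for r
      using loc(7) near[OF that] by (simp add: D_def)
    have eq_h: "integrand \<beta> x r = h \<beta> x (\<gamma> r) * speed r" if "x \<in> N" "r \<in> {u..v}" for \<beta> x r
    proof -
      have "F r (\<gamma> r) = F s0 (\<gamma> r)"
        using \<epsilon>(4)[of r] near[OF that(2)] by (auto dest: eventually_nhds_x_imp_x)
      moreover have "L x r = l x (\<gamma> r)"
        using loc(8)[of r x] near[OF that(2)] that(1) by (simp add: l_def N_def)
      ultimately show ?thesis
        by (simp add: h_def)
    qed
    define p where "p = linepath (\<gamma> u) (\<gamma> v)"
    have pD: "p r \<in> D" if "r \<in> {0..1}" for r
    proof -
      have "p r \<in> closed_segment (\<gamma> u) (\<gamma> v)"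
        using that unfolding p_def by (intro linepath_in_path)
      also have "\<dots> \<subseteq> D"
        using \<gamma>D[of u] \<gamma>D[of v] uv by (intro closed_segment_subset D) auto
      finally show ?thesis .
    qed
    define g where "g \<beta> x = integral {0..1} (\<lambda>r. h \<beta> x (p r) * (\<gamma> v - \<gamma> u))" for \<beta> x
    have cont_hp: "continuous_on (N \<times> {0..1}) (\<lambda>z. h \<beta> (fst z) (p (snd z)) * (\<gamma> v - \<gamma> u))" for \<beta>
    proof -
      have "continuous_on (N \<times> {0..1}) (\<lambda>z. (fst z, p (snd z)))"
        unfolding p_def linepath_def by (intro continuous_intros)
      then have "continuous_on (N \<times> {0..1}) (\<lambda>z. h \<beta> (fst (fst z, p (snd z))) (snd (fst z, p (snd z))))"
        by (rule continuous_on_compose2[OF cont_h]) (use pD in auto)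
      then show ?thesis
        by (intro continuous_intros) simp
    qed
    have int_hp: "(\<lambda>r. h \<beta> x (p r) * (\<gamma> v - \<gamma> u)) integrable_on {0..1}" if "x \<in> N" for \<beta> x
    proof (rule integrable_continuous_real)
      have "continuous_on {0..1} (\<lambda>r. h \<beta> (fst (x, r)) (p (snd (x, r))) * (\<gamma> v - \<gamma> u))"
        by (rule continuous_on_compose2[OF cont_hp]) (use that in \<open>auto intro!: continuous_intros\<close>)
      then show "continuous_on {0..1} (\<lambda>r. h \<beta> x (p r) * (\<gamma> v - \<gamma> u))"
        by simp
    qed
    have deriv_g: "(g \<beta> has_field_derivative \<beta> * g (\<beta> - 1) x) (at x)" if x: "x \<in> N" for \<beta> x
    proof -
      have "((\<lambda>x. integral (cbox 0 1) (\<lambda>r. h \<beta> x (p r) * (\<gamma> v - \<gamma> u))) has_field_derivative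
          integral (cbox 0 1) (\<lambda>r. \<beta> * (h (\<beta> - 1) x (p r) * (\<gamma> v - \<gamma> u)))) (at x within N)"
      proof (rule leibniz_rule_field_derivative[OF _ _ _ x N(2)])
        fix x r assume "x \<in> N" "r \<in> cbox 0 (1::real)"
        then have "((\<lambda>x. h \<beta> x (p r)) has_field_derivative \<beta> * h (\<beta> - 1) x (p r)) (at x)"
          using pD by (intro h_x) auto
        then show "((\<lambda>x. h \<beta> x (p r) * (\<gamma> v - \<gamma> u)) has_field_derivative
            \<beta> * (h (\<beta> - 1) x (p r) * (\<gamma> v - \<gamma> u))) (at x within N)"
          using DERIV_cmult_right has_field_derivative_at_within by (fastforce simp: mult.assoc)
      next
        show "(\<lambda>r. h \<beta> x (p r) * (\<gamma> v - \<gamma> u)) integrable_on cbox 0 1" if "x \<in> N" for x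
          using int_hp[OF that] by simp
        show "continuous_on (N \<times> cbox 0 1) (\<lambda>(x, r). \<beta> * (h (\<beta> - 1) x (p r) * (\<gamma> v - \<gamma> u)))"
          using cont_hp[of "\<beta> - 1"] by (auto simp: case_prod_beta intro!: continuous_intros)
      qed
      then have "(g \<beta> has_field_derivative integral {0..1} (\<lambda>r. \<beta> * (h (\<beta> - 1) x (p r) * (\<gamma> v - \<gamma> u)))) (at x)"
        unfolding g_def cbox_interval at_within_open[OF x N(1)] .
      also have "integral {0..1} (\<lambda>r. \<beta> * (h (\<beta> - 1) x (p r) * (\<gamma> v - \<gamma> u))) = \<beta> * g (\<beta> - 1) x"
        unfolding g_def by (rule integral_mult_right)
      finally show ?thesis .
    qed
    \<comment> \<open>The path and the chord \<open>p\<close> give the same integral, the difference of a primitive \<open>H\<close> at the end points.\<close>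
    have int_g: "(integrand \<beta> x has_integral g \<beta> x) {u..v}" if x: "x \<in> N" for \<beta> x
    proof -
      obtain H where H': "\<And>t. t \<in> D \<Longrightarrow> (H has_field_derivative h \<beta> x t) (at t within D)"
        using holomorphic_convex_primitive'[OF D(2,1) hol_h[OF x]] by blast
      have H: "(H has_field_derivative h \<beta> x t) (at t)" if "t \<in> D" for t
        using H'[OF that] unfolding at_within_open[OF that D(1)] .
      have "path_image p \<subseteq> D" "valid_path p"
        using pD by (auto simp: path_image_def) (simp add: p_def)
      then have "(h \<beta> x has_contour_integral H (pathfinish p) - H (pathstart p)) p"
        by (intro contour_integral_primitive[OF H'])
      then have "((\<lambda>r. h \<beta> x (p r) * (\<gamma> v - \<gamma> u)) has_integral H (\<gamma> v) - H (\<gamma> u)) {0..1}"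
        unfolding p_def has_contour_integral_linepath by simp
      then have gH: "g \<beta> x = H (\<gamma> v) - H (\<gamma> u)"
        unfolding g_def by (rule integral_unique)
      obtain S where S: "finite S" "\<And>s. s \<in> {0<..<1} - S \<Longrightarrow> (\<gamma> has_vector_derivative speed s) (at s)"
        using speed_exceptions by blast
      have "((\<lambda>r. speed r * h \<beta> x (\<gamma> r)) has_integral (H \<circ> \<gamma>) v - (H \<circ> \<gamma>) u) {u..v}"
      proof (rule fundamental_theorem_of_calculus_interior_strong[OF S(1)])
        show "((H \<circ> \<gamma>) has_vector_derivative speed r * h \<beta> x (\<gamma> r)) (at r)" if "r \<in> {u<..<v} - S" for r
          by (rule field_vector_diff_chain_at) (use that uv S(2) H \<gamma>D in auto)
        have "continuous_on {u..v} \<gamma>"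
          using path uv unfolding path_def by (elim continuous_on_subset) auto
        then show "continuous_on {u..v} (H \<circ> \<gamma>)"
          unfolding o_def
        proof (rule continuous_on_compose2[rotated])
          show "continuous_on D H"
            using H by (meson DERIV_isCont continuous_at_imp_continuous_on)
        qed (use \<gamma>D in auto)
      qed (use uv in auto)
      then have "((\<lambda>r. h \<beta> x (\<gamma> r) * speed r) has_integral g \<beta> x) {u..v}"
        by (simp add: gH mult.commute)
      then show ?thesis
        by (rule has_integral_eq[rotated]) (simp add: eq_h[OF x])
    qed
    show "differentiable_piece x0 u v"
      unfolding differentiable_piece_def using N deriv_g int_g by blast
  qed (use \<epsilon>(2) loc(3) in auto)
qed

text \<open>Bisection of the unit interval reduces both claims to short pieces.\<close>

lemma kernel_integral_deriv:
  assumes x0: "x0 \<in> X"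
  shows "integrand \<beta> x0 integrable_on {0..1}"
    and "(kernel_integral \<beta> has_field_derivative \<beta> * kernel_integral (\<beta> - 1) x0) (at x0)"
proof -
  define P where "P u v \<longleftrightarrow> (0 \<le> u \<and> v \<le> 1 \<longrightarrow> differentiable_piece x0 u v)" for u v
  have "P 0 1"
  proof (rule Bolzano[of 0 1 P])
    fix a b c :: real assume P: "P a b" "P b c" and le: "a \<le> b" "b \<le> c"
    show "P a c"
      unfolding P_def
    proof
      assume ac: "0 \<le> a \<and> c \<le> 1"
      obtain N1 g1 where 1: "open N1" "x0 \<in> N1"
        "\<forall>\<beta>. \<forall>x\<in>N1. (integrand \<beta> x has_integral g1 \<beta> x) {a..b} \<and>
          (g1 \<beta> has_field_derivative \<beta> * g1 (\<beta> - 1) x) (at x)"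
        using P(1) ac le unfolding P_def differentiable_piece_def by (elim impE exE conjE) auto
      obtain N2 g2 where 2: "open N2" "x0 \<in> N2"
        "\<forall>\<beta>. \<forall>x\<in>N2. (integrand \<beta> x has_integral g2 \<beta> x) {b..c} \<and>
          (g2 \<beta> has_field_derivative \<beta> * g2 (\<beta> - 1) x) (at x)"
        using P(2) ac le unfolding P_def differentiable_piece_def by (elim impE exE conjE) auto
      have "(integrand \<beta> x has_integral g1 \<beta> x + g2 \<beta> x) {a..c}" if "x \<in> N1 \<inter> N2" for \<beta> x
        using 1(3)[rule_format, of x \<beta>] 2(3)[rule_format, of x \<beta>] that le by (intro has_integral_combine[of a b c]) auto
      moreover have "((\<lambda>x. g1 \<beta> x + g2 \<beta> x) has_field_derivative \<beta> * (g1 (\<beta> - 1) x + g2 (\<beta> - 1) x)) (at x)"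
        if "x \<in> N1 \<inter> N2" for \<beta> x
        unfolding distrib_left using 1(3) 2(3) that by (intro DERIV_add) auto
      ultimately show "differentiable_piece x0 a c"
        unfolding differentiable_piece_def using 1(1,2) 2(1,2)
        by (intro exI[of _ "N1 \<inter> N2"] exI[of _ "\<lambda>\<beta> x. g1 \<beta> x + g2 \<beta> x"]) auto
    qed
  next
    fix s0 :: real assume "0 \<le> s0" "s0 \<le> 1"
    then obtain d where "d > 0" "\<forall>u v. 0 \<le> u \<and> u \<le> s0 \<and> s0 \<le> v \<and> v \<le> 1 \<and> v - u < d \<longrightarrow> differentiable_piece x0 u v"
      using integral_over_short_piece[OF x0, of s0] by auto
    then show "\<exists>d>0. \<forall>a b. a \<le> s0 \<and> s0 \<le> b \<and> b - a < d \<longrightarrow> P a b"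
      unfolding P_def by blast
  qed simp
  then obtain N g where N: "open N" "x0 \<in> N"
    and Ng: "\<forall>\<beta>. \<forall>x\<in>N. (integrand \<beta> x has_integral g \<beta> x) {0..1} \<and>
      (g \<beta> has_field_derivative \<beta> * g (\<beta> - 1) x) (at x)"
    unfolding P_def differentiable_piece_def by (elim impE exE conjE) auto
  have g: "(integrand \<beta> x has_integral g \<beta> x) {0..1}"
    "(g \<beta> has_field_derivative \<beta> * g (\<beta> - 1) x) (at x)" if "x \<in> N" for \<beta> x
    using Ng that by auto
  have eq: "kernel_integral \<beta> x = g \<beta> x" if "x \<in> N" for \<beta> x
    using g(1)[OF that] unfolding kernel_integral_def by (rule integral_unique)
  show "integrand \<beta> x0 integrable_on {0..1}"
    using g(1) N by blast
  have "(g \<beta> has_field_derivative \<beta> * kernel_integral (\<beta> - 1) x0) (at x0)"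
    using g(2)[OF N(2)] eq[OF N(2)] by simp
  then show "(kernel_integral \<beta> has_field_derivative \<beta> * kernel_integral (\<beta> - 1) x0) (at x0)"
    by (rule has_field_derivative_transform_within_open[OF _ N]) (simp add: eq)
qed

text \<open>Along the path the derivatives of the continued function become functions of the parameter, which
can be differentiated by the chain rule although \<open>F s\<close> itself varies with \<open>s\<close>.\<close>

definition jet :: "nat \<Rightarrow> real \<Rightarrow> complex" where
  "jet j s = (deriv ^^ j) (F s) (\<gamma> s)"

lemma jet_local:
  assumes s: "s \<in> {0..1}"
  shows "\<exists>\<epsilon>>0. \<exists>\<delta>>0. F s holomorphic_on ball (\<gamma> s) \<epsilon> \<and>
    (\<forall>r\<in>{0..1}. dist r s < \<delta> \<longrightarrow> \<gamma> r \<in> ball (\<gamma> s) \<epsilon> \<and> (\<forall>j. jet j r = (deriv ^^ j) (F s) (\<gamma> r)))"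
proof -
  obtain \<epsilon> \<delta> where E: "\<epsilon> > 0" "\<delta> > 0" "F s holomorphic_on ball (\<gamma> s) \<epsilon>"
    and near: "\<forall>r\<in>{0..1}. dist r s < \<delta> \<longrightarrow> \<gamma> r \<in> ball (\<gamma> s) \<epsilon> \<and> (\<forall>\<^sub>F t in nhds (\<gamma> r). F r t = F s t)"
    using continuation_ball[OF continuation path s] by blast
  have "jet j r = (deriv ^^ j) (F s) (\<gamma> r)" if "r \<in> {0..1}" "dist r s < \<delta>" for r j
    unfolding jet_def using near that by (intro higher_deriv_cong_ev) auto
  with E near show ?thesis
    by blast
qed

lemma jet_vector_derivative:
  assumes s: "s \<in> {0<..<1}" and d: "(\<gamma> has_vector_derivative speed s) (at s)"
  shows "(jet j has_vector_derivative jet (Suc j) s * speed s) (at s)"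
proof -
  have s': "s \<in> {0..1}" using s by auto
  obtain \<epsilon> \<delta> where E: "\<epsilon> > 0" "\<delta> > 0" "F s holomorphic_on ball (\<gamma> s) \<epsilon>"
    and near: "\<forall>r\<in>{0..1}. dist r s < \<delta> \<longrightarrow> \<gamma> r \<in> ball (\<gamma> s) \<epsilon> \<and> (\<forall>j. jet j r = (deriv ^^ j) (F s) (\<gamma> r))"
    using jet_local[OF s'] by blast
  have hol: "(deriv ^^ j) (F s) holomorphic_on ball (\<gamma> s) \<epsilon>"
    using E by (intro holomorphic_higher_deriv) auto
  have "((deriv ^^ j) (F s) has_field_derivative deriv ((deriv ^^ j) (F s)) (\<gamma> s)) (at (\<gamma> s))"
    by (rule holomorphic_derivI[OF hol]) (use E in auto)
  then have "(((deriv ^^ j) (F s) \<circ> \<gamma>) has_vector_derivative speed s * deriv ((deriv ^^ j) (F s)) (\<gamma> s)) (at s)"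
    by (rule field_vector_diff_chain_at[OF d])
  also have "speed s * deriv ((deriv ^^ j) (F s)) (\<gamma> s) = jet (Suc j) s * speed s"
    by (simp add: jet_def)
  finally show ?thesis
  proof (rule has_vector_derivative_transform_within_open)
    show "open ({0<..<1} \<inter> ball s \<delta>)" by auto
    show "((deriv ^^ j) (F s) \<circ> \<gamma>) r = jet j r" if "r \<in> {0<..<1} \<inter> ball s \<delta>" for r
      using near that by (auto simp: dist_commute)
  qed (use s E in auto)
qed

lemma jet_continuous: "continuous_on {0..1} (jet j)"
  unfolding continuous_on_eq_continuous_within
proof
  fix s :: real assume s: "s \<in> {0..1}"
  obtain \<epsilon> \<delta> where E: "\<epsilon> > 0" "\<delta> > 0" "F s holomorphic_on ball (\<gamma> s) \<epsilon>"
    and near: "\<forall>r\<in>{0..1}. dist r s < \<delta> \<longrightarrow> \<gamma> r \<in> ball (\<gamma> s) \<epsilon> \<and> (\<forall>j. jet j r = (deriv ^^ j) (F s) (\<gamma> r))"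
    using jet_local[OF s] by blast
  have "(deriv ^^ j) (F s) holomorphic_on ball (\<gamma> s) \<epsilon>"
    using E by (intro holomorphic_higher_deriv) auto
  then have "isCont ((deriv ^^ j) (F s)) (\<gamma> s)"
    using E(1) by (meson centre_in_ball continuous_on_eq_continuous_at holomorphic_on_imp_continuous_on open_ball)
  moreover have "continuous (at s within {0..1}) \<gamma>"
    using path s by (simp add: path_def continuous_on_eq_continuous_within)
  ultimately have "continuous (at s within {0..1}) (\<lambda>r. (deriv ^^ j) (F s) (\<gamma> r))"
    by (rule continuous_within_compose3)
  then show "continuous (at s within {0..1}) (jet j)"
    by (rule continuous_transform_within[OF _ E(2) s]) (use near in auto)
qed

lemma kernel_continuous: "x \<in> X \<Longrightarrow> continuous_on {0..1} (\<lambda>s. exp (\<beta> * L x s))"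
proof -
  assume x: "x \<in> X"
  have "continuous_on {0..1} (\<lambda>s. case (x, s) of (x, s) \<Rightarrow> L x s)"
    by (rule continuous_on_compose2[of "X \<times> {0..1}"])
       (use log_branch x in \<open>auto simp: log_branch_along_def intro!: continuous_intros\<close>)
  then show ?thesis
    by (auto intro!: continuous_intros)
qed

lemma kernel_vector_derivative:
  assumes x: "x \<in> X" and s: "s \<in> {0<..<1}" and d: "(\<gamma> has_vector_derivative speed s) (at s)"
  shows "((\<lambda>s. exp (\<beta> * L x s)) has_vector_derivative - \<beta> * exp ((\<beta> - 1) * L x s) * speed s) (at s)"
proof -
  have s': "s \<in> {0..1}" using s by auto
  define c where "c = x - \<gamma> s"
  have c: "c \<noteq> 0" using off_path[OF x s'] by (simp add: c_def)
  obtain \<rho> \<delta> :: real where loc: "\<rho> > 0" "\<delta> > 0"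
    "\<forall>r\<in>{0..1}. dist r s < \<delta> \<longrightarrow> (\<forall>y\<in>ball x \<rho>. L y r = L x s + Ln ((y - \<gamma> r) / (x - \<gamma> s)))"
    using log_branch_local[OF x s', of 1] by auto
  have Lr: "L x r = L x s + Ln ((x - \<gamma> r) / c)" if "r \<in> {0..1}" "dist r s < \<delta>" for r
    using loc that by (simp add: c_def)
  define h where "h t = exp (\<beta> * (L x s + Ln ((x - t) / c)))" for t
  have slit: "(x - \<gamma> s) / c \<notin> \<real>\<^sub>\<le>\<^sub>0"
    using c by (simp add: c_def)
  have "((\<lambda>t. (x - t) / c) has_field_derivative - 1 / c) (at (\<gamma> s))"
    using c by (auto intro!: derivative_eq_intros)
  then have "((\<lambda>t. Ln ((x - t) / c)) has_field_derivative inverse ((x - \<gamma> s) / c) * (- 1 / c)) (at (\<gamma> s))"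
    by (rule DERIV_chain2[where f = Ln and g = "\<lambda>t. (x - t) / c", OF has_field_derivative_Ln[OF slit]])
  also have "inverse ((x - \<gamma> s) / c) * (- 1 / c) = - 1 / c"
    using c by (simp add: c_def)
  finally have "((\<lambda>t. L x s + Ln ((x - t) / c)) has_field_derivative 0 + - 1 / c) (at (\<gamma> s))"
    by (rule DERIV_add[OF DERIV_const])
  then have "((\<lambda>t. \<beta> * (L x s + Ln ((x - t) / c))) has_field_derivative \<beta> * (0 + - 1 / c)) (at (\<gamma> s))"
    by (rule DERIV_cmult)
  then have "(h has_field_derivative exp (\<beta> * (L x s + Ln ((x - \<gamma> s) / c))) * (\<beta> * (0 + - 1 / c))) (at (\<gamma> s))"
    unfolding h_def by (rule DERIV_chain2[where f = exp and g = "\<lambda>t. \<beta> * (L x s + Ln ((x - t) / c))", OF DERIV_exp])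
  also have "exp (\<beta> * (L x s + Ln ((x - \<gamma> s) / c))) = exp (\<beta> * L x s)"
    using c by (simp flip: c_def)
  also have "exp (\<beta> * L x s) = exp ((\<beta> - 1) * L x s) * exp (L x s)"
    by (simp add: algebra_simps flip: exp_add)
  also have "exp (L x s) = c"
    using exp_L[OF x s'] by (simp add: c_def)
  finally have "(h has_field_derivative - \<beta> * exp ((\<beta> - 1) * L x s)) (at (\<gamma> s))"
    using c by (simp add: mult.commute)
  then have "((h \<circ> \<gamma>) has_vector_derivative speed s * (- \<beta> * exp ((\<beta> - 1) * L x s))) (at s)"
    by (rule field_vector_diff_chain_at[OF d])
  also have "speed s * (- \<beta> * exp ((\<beta> - 1) * L x s)) = - \<beta> * exp ((\<beta> - 1) * L x s) * speed s"
    by simp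
  finally show ?thesis
  proof (rule has_vector_derivative_transform_within_open)
    show "open ({0<..<1} \<inter> ball s \<delta>)" by auto
    show "(h \<circ> \<gamma>) r = exp (\<beta> * L x r)" if "r \<in> {0<..<1} \<inter> ball s \<delta>" for r
      using Lr[of r] that by (auto simp: dist_commute h_def)
  qed (use s loc in auto)
qed

text \<open>Lagrange's identity for the skew-adjoint operator of the symmetric square, integrated over a path
along which all branches return. The concomitant is
\<open>\<Psi> = p (k f'' - k' f' + k'' f) + p' / 2 (k f' + k' f) - 4 (n (n + 1) t - H) k f\<close> with the kernel
\<open>k = (x - t)\<^sup>\<beta>\<close>. The condition on \<open>\<beta>\<close> removes the term with \<open>(x - t)\<^sup>\<beta>\<close>; the three terms left
are multiples of the integrals that represent \<open>I'\<close>, \<open>I''\<close> and \<open>I'''\<close>.\<close>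

lemma euler_transform_relation:
  fixes e1 e2 e3 n H \<beta> x :: complex
  defines "p \<equiv> lame_p e1 e2 e3" and "p1 \<equiv> lame_p1 e1 e2 e3" and "p2 \<equiv> lame_p2 e1 e2 e3"
  assumes x: "x \<in> X"
    and ode: "\<And>s. s \<in> {0..1} \<Longrightarrow> p (\<gamma> s) * jet 3 s + 3/2 * p1 (\<gamma> s) * jet 2 s
        + (p2 (\<gamma> s) / 2 - 4 * (n * (n + 1) * \<gamma> s - H)) * jet 1 s - 2 * (n * (n + 1)) * jet 0 s = 0"
    and closed: "\<gamma> 1 = \<gamma> 0" "\<And>j. jet j 1 = jet j 0" "L x 1 = L x 0"
    and \<beta>: "(2 * \<beta> + 1) * (\<beta> - n) * (\<beta> + n + 1) = 0"
  shows "\<beta> * (\<beta> - 1) * (\<beta> - 2) * p x * kernel_integral (\<beta> - 3) x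
      - \<beta> * (\<beta> - 1) * (\<beta> - 1/2) * p1 x * kernel_integral (\<beta> - 2) x
      + (\<beta>^3 / 2 * p2 x - 4 * \<beta> * (n * (n + 1) * x - H)) * kernel_integral (\<beta> - 1) x = 0"
proof -
  define E where "E j s = exp ((\<beta> - of_nat j) * L x s)" for j :: nat and s
  define q where "q t = n * (n + 1) * t - H" for t
  define c1 where "c1 = 4 * \<beta> * (n * (n + 1) * x - H) - \<beta>^3 / 2 * p2 x"
  define c2 where "c2 = \<beta> * (\<beta> - 1) * (\<beta> - 1/2) * p1 x"
  define c3 where "c3 = - \<beta> * (\<beta> - 1) * (\<beta> - 2) * p x"
  define \<Psi> where "\<Psi> s = p (\<gamma> s) * (E 0 s * jet 2 s + \<beta> * (E 1 s * jet 1 s) + \<beta> * (\<beta> - 1) * (E 2 s * jet 0 s))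
      + 1/2 * (p1 (\<gamma> s) * (jet 1 s * E 0 s - \<beta> * (jet 0 s * E 1 s)))
      - 4 * (q (\<gamma> s) * (jet 0 s * E 0 s))" for s
  define \<psi> where "\<psi> s = c3 * integrand (\<beta> - 3) x s + c2 * integrand (\<beta> - 2) x s + c1 * integrand (\<beta> - 1) x s" for s
  have E_Suc: "E j s = E (Suc j) s * (x - \<gamma> s)" if "s \<in> {0..1}" for j s
  proof -
    have "E (Suc j) s * exp (L x s) = E j s"
      by (simp add: E_def algebra_simps flip: exp_add)
    then show ?thesis
      using exp_L[OF x that] by simp
  qed
  have contE: "continuous_on {0..1} (E j)" for j
    unfolding E_def by (rule kernel_continuous[OF x])
  have cont\<gamma>: "continuous_on {0..1} (\<lambda>s. \<gamma> s)"
    using path by (simp add: path_def)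
  obtain S where S: "finite S" "\<And>s. s \<in> {0<..<1} - S \<Longrightarrow> (\<gamma> has_vector_derivative speed s) (at s)"
    using speed_exceptions by blast
  have deriv: "(\<Psi> has_vector_derivative \<psi> s) (at s)" if s: "s \<in> {0<..<1} - S" for s
  proof -
    have s01: "s \<in> {0<..<1}" and s': "s \<in> {0..1}" using s by auto
    note d\<gamma> = S(2)[OF s]
    have dj: "(jet 0 has_vector_derivative jet 1 s * speed s) (at s)"
      "(jet 1 has_vector_derivative jet 2 s * speed s) (at s)"
      "(jet 2 has_vector_derivative jet 3 s * speed s) (at s)"
      using jet_vector_derivative[OF s01 d\<gamma>, of 0] jet_vector_derivative[OF s01 d\<gamma>, of 1]
        jet_vector_derivative[OF s01 d\<gamma>, of 2] by (simp_all add: eval_nat_numeral)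
    have "(E j has_vector_derivative - (\<beta> - of_nat j) * E (Suc j) s * speed s) (at s)" for j
      using kernel_vector_derivative[OF x s01 d\<gamma>, of "\<beta> - of_nat j"] by (simp add: E_def[abs_def] algebra_simps)
    from this[of 0] this[of 1] this[of 2]
    have dE: "(E 0 has_vector_derivative - \<beta> * E 1 s * speed s) (at s)"
      "(E 1 has_vector_derivative - (\<beta> - 1) * E 2 s * speed s) (at s)"
      "(E 2 has_vector_derivative - (\<beta> - 2) * E 3 s * speed s) (at s)"
      by (simp_all add: eval_nat_numeral)
    have dp: "((\<lambda>s. p (\<gamma> s)) has_vector_derivative speed s * p1 (\<gamma> s)) (at s)"
      "((\<lambda>s. p1 (\<gamma> s)) has_vector_derivative speed s * p2 (\<gamma> s)) (at s)"
      "((\<lambda>s. q (\<gamma> s)) has_vector_derivative speed s * (n * (n + 1))) (at s)"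
    proof -
      have "(q has_field_derivative n * (n + 1)) (at t)" for t
        unfolding q_def by (auto intro!: derivative_eq_intros)
      then show "((\<lambda>s. q (\<gamma> s)) has_vector_derivative speed s * (n * (n + 1))) (at s)"
        using field_vector_diff_chain_at[OF d\<gamma>, of q] by (simp add: o_def)
    qed (use field_vector_diff_chain_at[OF d\<gamma> lame_p_has_derivs(1)]
        field_vector_diff_chain_at[OF d\<gamma> lame_p_has_derivs(2)] in \<open>simp_all add: o_def p_def p1_def p2_def\<close>)
    \<comment> \<open>\<open>R\<close> is the operator applied to the kernel, so that \<open>\<Psi>\<close> has the derivative \<open>k S f + f S k\<close> with \<open>S f = 0\<close>.\<close>
    define R where "R = - \<beta> * (\<beta> - 1) * (\<beta> - 2) * p (\<gamma> s) * E 3 s + 3/2 * \<beta> * (\<beta> - 1) * p1 (\<gamma> s) * E 2 s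
        - \<beta> * (p2 (\<gamma> s) / 2 - 4 * q (\<gamma> s)) * E 1 s - 2 * (n * (n + 1)) * E 0 s"
    have "(\<Psi> has_vector_derivative speed s * (E 0 s * (p (\<gamma> s) * jet 3 s + 3/2 * p1 (\<gamma> s) * jet 2 s
        + (p2 (\<gamma> s) / 2 - 4 * q (\<gamma> s)) * jet 1 s - 2 * (n * (n + 1)) * jet 0 s) + jet 0 s * R)) (at s)"
      unfolding \<Psi>_def R_def
      by (rule has_vector_derivative_eq_rhs,
          (rule has_vector_derivative_add has_vector_derivative_diff has_vector_derivative_mult_right
             has_vector_derivative_mult dp dj dE)+, simp add: field_simps)
    also have "p (\<gamma> s) * jet 3 s + 3/2 * p1 (\<gamma> s) * jet 2 s
        + (p2 (\<gamma> s) / 2 - 4 * q (\<gamma> s)) * jet 1 s - 2 * (n * (n + 1)) * jet 0 s = 0"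
      unfolding q_def by (rule ode[OF s'])
    also have "R = c3 * E 3 s + c2 * E 2 s + c1 * E 1 s"
    proof -
      have e: "E 2 s = E 3 s * (x - \<gamma> s)" "E 1 s = E 3 s * (x - \<gamma> s)^2" "E 0 s = E 3 s * (x - \<gamma> s)^3"
        using E_Suc[OF s', of 2] E_Suc[OF s', of 1] E_Suc[OF s', of 0]
        by (simp_all add: eval_nat_numeral mult.assoc)
      have "R = E 3 s * (- \<beta> * (\<beta> - 1) * (\<beta> - 2) * p (\<gamma> s) + 3/2 * \<beta> * (\<beta> - 1) * p1 (\<gamma> s) * (x - \<gamma> s)
          - \<beta> * (p2 (\<gamma> s) / 2 - 4 * (n * (n + 1) * \<gamma> s - H)) * (x - \<gamma> s)^2 - 2 * n * (n + 1) * (x - \<gamma> s)^3)"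
        unfolding R_def e q_def by (simp add: algebra_simps)
      also have "\<dots> = E 3 s * (c3 + c2 * (x - \<gamma> s) + c1 * (x - \<gamma> s)^2)"
        unfolding p_def p1_def p2_def adjoint_on_kernel_power \<beta> c1_def c2_def c3_def by simp
      finally show ?thesis
        unfolding e by (simp add: algebra_simps)
    qed
    also have "speed s * (E 0 s * 0 + jet 0 s * (c3 * E 3 s + c2 * E 2 s + c1 * E 1 s)) = \<psi> s"
      by (simp add: \<psi>_def E_def jet_def algebra_simps)
    finally show ?thesis .
  qed
  have int1: "(\<psi> has_integral \<Psi> 1 - \<Psi> 0) {0..1}"
  proof (rule fundamental_theorem_of_calculus_interior_strong[OF S(1) _ deriv])
    have cp: "continuous_on UNIV p" "continuous_on UNIV p1" "continuous_on UNIV q"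
      unfolding p_def p1_def q_def lame_p_def[abs_def] lame_p1_def[abs_def] by (intro continuous_intros)+
    have "continuous_on {0..1} (\<lambda>s. p (\<gamma> s))" "continuous_on {0..1} (\<lambda>s. p1 (\<gamma> s))" "continuous_on {0..1} (\<lambda>s. q (\<gamma> s))"
      using cp by (auto intro: continuous_on_compose2[OF _ cont\<gamma>])
    then show "continuous_on {0..1} \<Psi>"
      unfolding \<Psi>_def by (intro continuous_intros contE jet_continuous)
  qed auto
  have closes: "\<Psi> 1 = \<Psi> 0"
    unfolding \<Psi>_def E_def closed ..
  have int2: "(\<psi> has_integral c3 * kernel_integral (\<beta> - 3) x + c2 * kernel_integral (\<beta> - 2) x
      + c1 * kernel_integral (\<beta> - 1) x) {0..1}"
    unfolding \<psi>_def kernel_integral_def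
    by (intro has_integral_add has_integral_mult_right integrable_integral kernel_integral_deriv(1) x)
  have "c3 * kernel_integral (\<beta> - 3) x + c2 * kernel_integral (\<beta> - 2) x
      + c1 * kernel_integral (\<beta> - 1) x = 0"
    using has_integral_unique[OF int2 int1] closes by simp
  then show ?thesis
    by (simp add: c1_def c2_def c3_def algebra_simps)
qed

end

definition sym_square_coeff :: "complex \<Rightarrow> complex \<Rightarrow> complex \<Rightarrow> complex \<Rightarrow> complex \<Rightarrow> nat \<Rightarrow> complex \<Rightarrow> complex" where
  "sym_square_coeff e1 e2 e3 n H j t =
     (if j = 3 then lame_p e1 e2 e3 t
      else if j = 2 then 3/2 * lame_p1 e1 e2 e3 t
      else if j = 1 then lame_p2 e1 e2 e3 t / 2 - 4 * (n * (n + 1) * t - H)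
      else - 2 * (n * (n + 1)))"

lemma sym_square_coeff_holomorphic: "sym_square_coeff e1 e2 e3 n H j holomorphic_on S"
  unfolding sym_square_coeff_def [abs_def] lame_p_def lame_p1_def lame_p2_def
  by (cases "j = 3"; cases "j = 2"; cases "j = 1"; simp; intro holomorphic_intros; simp)

lemma sym_square_coeff_sum:
  "(\<Sum>j<4. sym_square_coeff e1 e2 e3 n H j t * w j)
    = lame_p e1 e2 e3 t * w 3 + 3/2 * lame_p1 e1 e2 e3 t * w 2
      + (lame_p2 e1 e2 e3 t / 2 - 4 * (n * (n + 1) * t - H)) * w 1 - 2 * (n * (n + 1)) * w 0"
proof -
  have "{..<4::nat} = {0, 1, 2, 3}" by auto
  then show ?thesis
    by (simp add: sym_square_coeff_def)
qed

lemma sym_square_lame_solution_iff: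
  "sym_square_lame_solution e1 e2 e3 n H S y \<longleftrightarrow> y holomorphic_on S \<and>
    (\<forall>x\<in>S. (\<Sum>j<4. sym_square_coeff e1 e2 e3 n H j x * (deriv ^^ j) y x) = 0)"
  unfolding sym_square_lame_solution_def sym_square_coeff_sum deriv_lame_p
  by (simp add: mult.assoc)

text \<open>Off the zeros of \<open>p\<close> the equation can be solved for the third derivative.\<close>

lemma sym_square_germ_extends:
  assumes W: "open W" "simply_connected W" "W \<noteq> UNIV" "b \<in> W" "W \<inter> {e1, e2, e3} = {}"
    and V: "open V" "b \<in> V" "g holomorphic_on V"
    and ode: "\<And>z. z \<in> V \<Longrightarrow> (\<Sum>j<4. sym_square_coeff e1 e2 e3 n H j z * (deriv ^^ j) g z) = 0"
  shows "\<exists>G. G holomorphic_on W \<and> (\<forall>\<^sub>F z in nhds b. G z = g z)"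
proof -
  define c where "c = sym_square_coeff e1 e2 e3 n H"
  have nz: "c 3 z \<noteq> 0" if "z \<in> W" for z
    using W(5) that by (auto simp: c_def sym_square_coeff_def lame_p_def)
  have hol: "(\<lambda>z. - c j z / c 3 z) holomorphic_on W" for j
    unfolding c_def by (intro holomorphic_intros sym_square_coeff_holomorphic) (use nz in \<open>simp add: c_def\<close>)
  have eq: "(deriv ^^ 3) g z = (\<Sum>j<3. - c j z / c 3 z * (deriv ^^ j) g z)" if z: "z \<in> V" "z \<in> W" for z
  proof -
    have "(\<Sum>j<4. h j) = (\<Sum>j<3. h j) + h 3" for h :: "nat \<Rightarrow> complex"
      using sum.lessThan_Suc[of h 3] by simp
    then have "(\<Sum>j<3. c j z * (deriv ^^ j) g z) + c 3 z * (deriv ^^ 3) g z = 0"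
      using ode[OF z(1)] by (simp add: c_def)
    then have "c 3 z * (deriv ^^ 3) g z = - (\<Sum>j<3. c j z * (deriv ^^ j) g z)"
      by (simp add: add_eq_0_iff)
    then have "(deriv ^^ 3) g z = - (\<Sum>j<3. c j z * (deriv ^^ j) g z) / c 3 z"
      using nz[OF z(2)] by (simp add: field_simps)
    then show ?thesis
      by (simp add: sum_negf sum_divide_distrib)
  qed
  obtain G where "G holomorphic_on W" "\<forall>\<^sub>F z in nhds b. G z = g z"
    by (rule linear_ode_germ_extends[OF W(1-4) hol V _ eq]) auto
  then show ?thesis by blast
qed

lemma pochhammer_loops_paths:
  assumes "pochhammer_loops A x a c"
  shows "simple_loop a" "simple_loop c" "pathstart a = pathstart c" "A \<subseteq> outside (path_image a)"
  using assms by (auto simp: pochhammer_loops_def loop_around_def loop_around_infinity_def)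

text \<open>The continued function satisfies the third-order equation all along the double loop, and all
branches return at its end, so \<open>euler_transform_relation\<close> applies. The polynomial
\<open>\<beta>\<^sup>2 / 2 p'' + 4 (H - n (n + 1) x)\<close> is its last coefficient after division by \<open>\<beta>\<close>.\<close>

lemma euler_integral_of_sym_square:
  assumes U: "open U" and f: "sym_square_lame_solution e1 e2 e3 n H U f"
    and X: "open X" and I: "is_euler_integral {e1, e2, e3} U f \<mu> X I"
  defines "\<beta> \<equiv> - 1 - \<mu>"
  shows "I holomorphic_on X"
    and "(2 * \<beta> + 1) * (\<beta> - n) * (\<beta> + n + 1) = 0 \<Longrightarrow> x \<in> X \<Longrightarrow>
      lame_p e1 e2 e3 x * (deriv ^^ 2) (deriv I) x + (1/2 - \<beta>) * lame_p1 e1 e2 e3 x * deriv (deriv I) x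
      + (\<beta>^2 / 2 * lame_p2 e1 e2 e3 x + 4 * (H - n * (n + 1) * x)) * deriv I x = 0"
      (is "_ \<Longrightarrow> _ \<Longrightarrow> ?lhs x = 0")
proof -
  obtain a c \<gamma> F L where \<gamma>: "\<gamma> = commutator_path a c"
    and loops: "\<And>x. x \<in> X \<Longrightarrow> pochhammer_loops {e1, e2, e3} x a c"
    and start: "pathstart \<gamma> \<in> U"
    and cont: "analytic_continuation_along \<gamma> f F"
    and log: "log_branch_along \<gamma> X L"
    and Ix: "\<And>x. x \<in> X \<Longrightarrow> I x = integral {0..1}
        (\<lambda>s. F s (\<gamma> s) * exp ((- 1 - \<mu>) * L x s) * vector_derivative \<gamma> (at s within {0..1}))"
    using I unfolding is_euler_integral_def by blast
  \<comment> \<open>A point of \<open>X\<close> is needed before anything is known about the loops.\<close>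
  have main: "I holomorphic_on X \<and> (\<forall>x\<in>X. (2 * \<beta> + 1) * (\<beta> - n) * (\<beta> + n + 1) = 0 \<longrightarrow>
      ?lhs x = 0)" if x1: "x1 \<in> X" for x1
  proof -
    note pl = pochhammer_loops_paths[OF loops[OF x1]]
    have va: "valid_path a" "pathfinish a = pathstart a" and vc: "valid_path c" "pathfinish c = pathstart c"
      using pl by (auto simp: simple_loop_def)
    have pa: "path a" and pc: "path c"
      using va vc valid_path_imp_path by auto
    have v\<gamma>: "valid_path \<gamma>"
      unfolding \<gamma> commutator_path_def using va vc pl(3) by (intro valid_path_join) auto
    interpret euler_integrand \<gamma> f F X L
      by unfold_locales (use v\<gamma> cont X log in auto)
    have g01: "\<gamma> 0 = pathstart a" "\<gamma> 1 = pathstart a"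
      using pl(3) va vc unfolding \<gamma> commutator_path_def
      by (simp_all add: joinpaths_def reversepath_def pathstart_def pathfinish_def)
    define b where "b = pathstart a"
    define Op where "Op g t = (\<Sum>j<4. sym_square_coeff e1 e2 e3 n H j t * (deriv ^^ j) g t)" for g t
    have opcont: "analytic_continuation_along \<gamma> (Op f) (\<lambda>s. Op (F s))"
      unfolding Op_def
      by (rule continuation_differential_operator[OF cont sym_square_coeff_holomorphic])
    have "\<forall>\<^sub>F t in nhds (\<gamma> 0). t \<in> U"
      using start U by (intro eventually_nhds_in_open) (simp_all add: pathstart_def)
    then have "\<forall>\<^sub>F t in nhds (\<gamma> 0). Op f t = 0"
      by eventually_elim (use f in \<open>simp add: sym_square_lame_solution_iff Op_def\<close>)
    then have Op0: "\<forall>\<^sub>F t in nhds (\<gamma> s). Op (F s) t = 0" if "s \<in> {0..1}" for s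
      using continuation_vanishes[OF opcont path _ that] by blast
    have ode: "lame_p e1 e2 e3 (\<gamma> s) * jet 3 s + 3/2 * lame_p1 e1 e2 e3 (\<gamma> s) * jet 2 s
        + (lame_p2 e1 e2 e3 (\<gamma> s) / 2 - 4 * (n * (n + 1) * \<gamma> s - H)) * jet 1 s - 2 * (n * (n + 1)) * jet 0 s = 0"
      if "s \<in> {0..1}" for s
      using eventually_nhds_x_imp_x[OF Op0[OF that]] by (simp add: Op_def sym_square_coeff_sum jet_def)
    obtain W where W: "open W" "simply_connected W" "W \<noteq> UNIV" "path_image a \<subseteq> W" "W \<inter> {e1, e2, e3} = {}"
      using simply_connected_nbhd_of_simple_loop[OF pl(1) _ pl(4)] by blast
    have "b \<in> W"
      using W(4) pathstart_in_path_image by (auto simp: b_def)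
    \<comment> \<open>The loop \<open>a\<close> surrounds only \<open>x\<close>, which is not a singular point of the equation for \<open>f\<close>.\<close>
    have closes: "\<forall>\<^sub>F t in nhds b. F 1 t = F 0 t"
      unfolding b_def
    proof (rule commutator_continuation_closes_up[OF pa va(2) pc vc(2) pl(3) cont[unfolded \<gamma>]])
      fix s :: real assume s: "s \<in> {0..1}" "commutator_path a c s = pathstart a"
      then have sb: "\<gamma> s = b"
        by (simp add: \<gamma> b_def)
      obtain \<epsilon> where \<epsilon>: "\<epsilon> > 0" "F s holomorphic_on ball (\<gamma> s) \<epsilon>"
        using continuation_ball[OF cont path s(1)] by blast
      obtain T where T: "open T" "b \<in> T" "\<And>t. t \<in> T \<Longrightarrow> Op (F s) t = 0"
        using Op0[OF s(1)] unfolding sb eventually_nhds by blast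
      have "\<exists>G. G holomorphic_on W \<and> (\<forall>\<^sub>F z in nhds b. G z = F s z)"
      proof (rule sym_square_germ_extends[OF W(1-3) \<open>b \<in> W\<close> W(5)])
        show "F s holomorphic_on T \<inter> ball b \<epsilon>"
          using \<epsilon>(2) sb by (auto elim: holomorphic_on_subset)
        show "(\<Sum>j<4. sym_square_coeff e1 e2 e3 n H j z * (deriv ^^ j) (F s) z) = 0" if "z \<in> T \<inter> ball b \<epsilon>" for z
          using T(3)[of z] that by (simp add: Op_def)
      qed (use T \<epsilon> in auto)
      then show "\<exists>W G. open W \<and> path_image a \<subseteq> W \<and> G holomorphic_on W \<and> (\<forall>\<^sub>F t in nhds (pathstart a). G t = F s t)"
        using W(1,4) unfolding b_def by blast
    qed
    have jets: "jet j 1 = jet j 0" for j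
      unfolding jet_def g01 using closes by (intro higher_deriv_cong_ev) (auto simp: b_def)
    have L10: "L x 1 = L x 0" if x: "x \<in> X" for x
    proof (rule commutator_log_closes_up[OF va(2) vc(2) pl(3)])
      have "continuous_on {0..1} (\<lambda>s. case (x, s) of (x, s) \<Rightarrow> L x s)"
        by (rule continuous_on_compose2[of "X \<times> {0..1}"])
           (use log x in \<open>auto simp: log_branch_along_def intro!: continuous_intros\<close>)
      then show "continuous_on {0..1} (L x)" by simp
    qed (use exp_L[OF x] in \<open>simp add: \<gamma>\<close>)
    \<comment> \<open>Three differentiations lower the exponent from \<open>\<beta>\<close> to \<open>\<beta> - 3\<close>.\<close>
    have IK: "I x = kernel_integral \<beta> x" if "x \<in> X" for x
      using Ix[OF that] by (simp add: kernel_integral_def speed_def \<beta>_def)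
    have d1: "(I has_field_derivative \<beta> * kernel_integral (\<beta> - 1) x) (at x)" if "x \<in> X" for x
      by (rule has_field_derivative_transform_within_open[OF kernel_integral_deriv(2)[OF that] X that])
         (simp add: IK)
    then have D1: "deriv I x = \<beta> * kernel_integral (\<beta> - 1) x" if "x \<in> X" for x
      using that by (simp add: DERIV_imp_deriv)
    have "(deriv I has_field_derivative \<beta> * ((\<beta> - 1) * kernel_integral (\<beta> - 2) x)) (at x)" if x: "x \<in> X" for x
    proof (rule has_field_derivative_transform_within_open[OF _ X x])
      have "(kernel_integral (\<beta> - 1) has_field_derivative (\<beta> - 1) * kernel_integral (\<beta> - 2) x) (at x)"
        using kernel_integral_deriv(2)[OF x, of "\<beta> - 1"] by simp
      then show "((\<lambda>x. \<beta> * kernel_integral (\<beta> - 1) x) has_field_derivative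
          \<beta> * ((\<beta> - 1) * kernel_integral (\<beta> - 2) x)) (at x)"
        by (rule DERIV_cmult)
    qed (simp add: D1)
    then have D2: "deriv (deriv I) x = \<beta> * ((\<beta> - 1) * kernel_integral (\<beta> - 2) x)" if "x \<in> X" for x
      using that by (simp add: DERIV_imp_deriv)
    have "(deriv (deriv I) has_field_derivative \<beta> * ((\<beta> - 1) * ((\<beta> - 2) * kernel_integral (\<beta> - 3) x))) (at x)"
      if x: "x \<in> X" for x
    proof (rule has_field_derivative_transform_within_open[OF _ X x])
      have "(kernel_integral (\<beta> - 2) has_field_derivative (\<beta> - 2) * kernel_integral (\<beta> - 3) x) (at x)"
        using kernel_integral_deriv(2)[OF x, of "\<beta> - 2"] by simp
      then show "((\<lambda>x. \<beta> * ((\<beta> - 1) * kernel_integral (\<beta> - 2) x)) has_field_derivative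
          \<beta> * ((\<beta> - 1) * ((\<beta> - 2) * kernel_integral (\<beta> - 3) x))) (at x)"
        by (intro DERIV_cmult)
    qed (simp add: D2)
    then have D3: "deriv (deriv (deriv I)) x = \<beta> * ((\<beta> - 1) * ((\<beta> - 2) * kernel_integral (\<beta> - 3) x))" if "x \<in> X" for x
      using that by (simp add: DERIV_imp_deriv)
    have "I holomorphic_on X"
      using d1 X by (auto simp: holomorphic_on_open)
    moreover have "?lhs x = 0"
      if x: "x \<in> X" and \<beta>: "(2 * \<beta> + 1) * (\<beta> - n) * (\<beta> + n + 1) = 0" for x
    proof -
      have "\<beta> * (\<beta> - 1) * (\<beta> - 2) * lame_p e1 e2 e3 x * kernel_integral (\<beta> - 3) x
          - \<beta> * (\<beta> - 1) * (\<beta> - 1/2) * lame_p1 e1 e2 e3 x * kernel_integral (\<beta> - 2) x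
          + (\<beta>^3 / 2 * lame_p2 e1 e2 e3 x - 4 * \<beta> * (n * (n + 1) * x - H)) * kernel_integral (\<beta> - 1) x = 0"
        using euler_transform_relation[OF x ode _ jets L10[OF x] \<beta>] g01 by simp
      moreover have D3': "(deriv ^^ 2) (deriv I) x = \<beta> * ((\<beta> - 1) * ((\<beta> - 2) * kernel_integral (\<beta> - 3) x))"
        using D3[OF x] by (simp add: numeral_2_eq_2)
      ultimately show ?thesis
        unfolding D1[OF x] D2[OF x] D3' by (simp add: power2_eq_square power3_eq_cube field_simps)
    qed
    ultimately show ?thesis by blast
  qed
  show "I holomorphic_on X"
    using main by (cases "X = {}") (auto simp: holomorphic_on_def)
  show "?lhs x = 0"
    if "(2 * \<beta> + 1) * (\<beta> - n) * (\<beta> + n + 1) = 0" "x \<in> X"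
    using main[OF that(2)] that by blast
qed

text \<open>The three zeros \<open>\<beta> = -1/2\<close>, \<open>-n - 1\<close> and \<open>n\<close> of \<open>(2 \<beta> + 1) (\<beta> - n) (\<beta> + n + 1)\<close>, with \<open>p''\<close>
written out.\<close>

lemma euler_integral_ode:
  assumes U: "open U" and f: "sym_square_lame_solution e1 e2 e3 n H U f"
    and X: "open X" and I: "is_euler_integral {e1, e2, e3} U f \<mu> X I"
  shows "\<mu> = - 1/2 \<Longrightarrow> ode2_solution (euler_ode_a e1 e2 e3 n H) X (deriv I)"
    and "\<mu> = n \<Longrightarrow> ode2_solution (euler_ode_b e1 e2 e3 n H) X (deriv I)"
    and "\<mu> = - n - 1 \<Longrightarrow> ode2_solution (euler_ode_c e1 e2 e3 n H) X (deriv I)"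
proof -
  note main = euler_integral_of_sym_square[OF assms]
  have hol: "deriv I holomorphic_on X"
    by (rule holomorphic_deriv[OF main(1) X])
  show "ode2_solution (euler_ode_a e1 e2 e3 n H) X (deriv I)" if "\<mu> = - 1/2"
    unfolding ode2_solution_def euler_ode_a_def prod.case deriv_lame_p
  proof (intro conjI hol ballI)
    fix x assume x: "x \<in> X"
    have \<beta>: "- 1 - \<mu> = - 1/2" using that by simp
    have coeff: "(- 1/2)^2 / 2 * lame_p2 e1 e2 e3 x + 4 * (H - n * (n + 1) * x) = 4 * H - (e1 + e2 + e3) - (2 * n + 3) * (2 * n - 1) * x"
      by (simp add: lame_p2_def power2_eq_square field_simps)
    show "lame_p e1 e2 e3 x * (deriv ^^ 2) (deriv I) x + lame_p1 e1 e2 e3 x * deriv (deriv I) x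
        + (4 * H - (e1 + e2 + e3) - (2 * n + 3) * (2 * n - 1) * x) * deriv I x = 0"
      using main(2)[OF _ x] unfolding \<beta> coeff by simp
  qed
  show "ode2_solution (euler_ode_b e1 e2 e3 n H) X (deriv I)" if "\<mu> = n"
    unfolding ode2_solution_def euler_ode_b_def prod.case deriv_lame_p
  proof (intro conjI hol ballI)
    fix x assume x: "x \<in> X"
    have \<beta>: "- 1 - \<mu> = - n - 1" using that by simp
    have coeff: "(- n - 1)^2 / 2 * lame_p2 e1 e2 e3 x + 4 * (H - n * (n + 1) * x) = 4 * H - 4 * (n + 1)^2 * (e1 + e2 + e3) + 4 * (n + 1) * (2 * n + 3) * x"
      by (simp add: lame_p2_def power2_eq_square field_simps)
    show "lame_p e1 e2 e3 x * (deriv ^^ 2) (deriv I) x + (3/2 + n) * lame_p1 e1 e2 e3 x * deriv (deriv I) x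
        + (4 * H - 4 * (n + 1)^2 * (e1 + e2 + e3) + 4 * (n + 1) * (2 * n + 3) * x) * deriv I x = 0"
      using main(2)[OF _ x] unfolding \<beta> coeff by simp
  qed
  show "ode2_solution (euler_ode_c e1 e2 e3 n H) X (deriv I)" if "\<mu> = - n - 1"
    unfolding ode2_solution_def euler_ode_c_def prod.case deriv_lame_p
  proof (intro conjI hol ballI)
    fix x assume x: "x \<in> X"
    have \<beta>: "- 1 - \<mu> = n" using that by simp
    have coeff: "(n)^2 / 2 * lame_p2 e1 e2 e3 x + 4 * (H - n * (n + 1) * x) = 4 * (H - n^2 * (e1 + e2 + e3)) + 4 * n * (2 * n - 1) * x"
      by (simp add: lame_p2_def power2_eq_square field_simps)
    show "lame_p e1 e2 e3 x * (deriv ^^ 2) (deriv I) x + (1/2 - n) * lame_p1 e1 e2 e3 x * deriv (deriv I) x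
        + (4 * (H - n^2 * (e1 + e2 + e3)) + 4 * n * (2 * n - 1) * x) * deriv I x = 0"
      using main(2)[OF _ x] unfolding \<beta> coeff by simp
  qed
qed

section \<open>Lattice sums and the Weierstrass function\<close>

lemma summable_on_int_powr:
  "(\<lambda>k::int. (1 + \<bar>real_of_int k\<bar>) powr (- (3/2))) summable_on UNIV"
proof -
  define \<phi> where "\<phi> k = (1 + \<bar>real_of_int k\<bar>) powr (- (3/2))" for k
  have s: "summable (\<lambda>n. real (Suc n) powr (- (3/2)))"
    by (subst summable_Suc_iff) (simp add: summable_real_powr_iff)
  have s': "summable (\<lambda>n. real (Suc (Suc n)) powr (- (3/2)))"
    using summable_Suc_iff[of "\<lambda>n. real (Suc n) powr (- (3/2))"] s by blast
  have "(\<phi> \<circ> int) summable_on UNIV"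
    by (rule summable_nonneg_imp_summable_on) (use s in \<open>auto simp: \<phi>_def o_def add.commute\<close>)
  then have 1: "\<phi> summable_on range int"
    by (subst summable_on_reindex) auto
  have "(\<phi> \<circ> (\<lambda>n. - int (Suc n))) summable_on UNIV"
    by (rule summable_nonneg_imp_summable_on) (use s' in \<open>auto simp: \<phi>_def o_def add.commute\<close>)
  then have 2: "\<phi> summable_on range (\<lambda>n. - int (Suc n))"
    by (subst summable_on_reindex) (auto intro: injI)
  have "range int \<union> range (\<lambda>n. - int (Suc n)) = UNIV"
  proof -
    have "k \<in> range int \<union> range (\<lambda>n. - int (Suc n))" for k
      by (cases k rule: int_cases) auto
    then show ?thesis by blast
  qed
  moreover have "range int \<inter> range (\<lambda>n. - int (Suc n)) = {}"
    by auto
  ultimately show ?thesis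
    using summable_on_Un_disjoint[OF 1 2] by (simp add: \<phi>_def [abs_def])
qed

locale complex_lattice =
  fixes \<omega>1 \<omega>2 :: complex
  assumes independent: "\<omega>2 / \<omega>1 \<notin> \<real>"
begin

abbreviation \<Lambda> :: "complex set" where "\<Lambda> \<equiv> period_lattice \<omega>1 \<omega>2"

text \<open>The imaginary part of \<open>x + y \<tau>\<close> controls \<open>y\<close> because \<open>\<tau> = \<omega>2 / \<omega>1\<close> is not real; then \<open>x\<close> is
controlled by the triangle inequality.\<close>

lemma coordinate_bound:
  "\<exists>c>0. \<forall>x y :: real. c * max \<bar>x\<bar> \<bar>y\<bar> \<le> norm (of_real x * \<omega>1 + of_real y * \<omega>2)"
proof -
  define \<tau> where "\<tau> = \<omega>2 / \<omega>1"
  have w1: "\<omega>1 \<noteq> 0" using independent by auto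
  have im: "\<bar>Im \<tau>\<bar> > 0"
    using independent by (auto simp: \<tau>_def complex_is_Real_iff)
  define K where "K = 1 + norm \<tau> / \<bar>Im \<tau>\<bar> + 1 / \<bar>Im \<tau>\<bar>"
  have K: "K > 0" using im by (auto simp: K_def intro!: add_pos_nonneg)
  have "max \<bar>x\<bar> \<bar>y\<bar> \<le> K * norm (of_real x + of_real y * \<tau>)" for x y :: real
  proof -
    define m where "m = norm (of_real x + of_real y * \<tau>)"
    have m0: "m \<ge> 0" by (simp add: m_def)
    have "\<bar>y\<bar> * \<bar>Im \<tau>\<bar> = \<bar>Im (of_real x + of_real y * \<tau>)\<bar>"
      by (simp add: abs_mult)
    also have "\<dots> \<le> m"
      unfolding m_def by (rule abs_Im_le_cmod)
    finally have y: "\<bar>y\<bar> \<le> m / \<bar>Im \<tau>\<bar>"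
      using im by (simp add: field_simps)
    have "\<bar>x\<bar> = norm ((of_real x + of_real y * \<tau>) - of_real y * \<tau>)"
      by simp
    also have "\<dots> \<le> m + \<bar>y\<bar> * norm \<tau>"
      unfolding m_def by (rule order.trans[OF norm_triangle_ineq4]) (simp add: norm_mult)
    also have "\<dots> \<le> m + m / \<bar>Im \<tau>\<bar> * norm \<tau>"
      using y by (intro add_left_mono mult_right_mono) auto
    also have "\<dots> \<le> K * m"
      using m0 im by (simp add: K_def algebra_simps)
    finally have x: "\<bar>x\<bar> \<le> K * m" .
    have "m / \<bar>Im \<tau>\<bar> \<le> K * m"
      using m0 im by (simp add: K_def algebra_simps)
    with x y show ?thesis
      by (simp add: m_def)
  qed
  then have "norm \<omega>1 / K * max \<bar>x\<bar> \<bar>y\<bar> \<le> norm (of_real x * \<omega>1 + of_real y * \<omega>2)" for x y :: real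
  proof -
    have "norm \<omega>1 / K * max \<bar>x\<bar> \<bar>y\<bar> \<le> norm \<omega>1 / K * (K * norm (of_real x + of_real y * \<tau>))"
      using \<open>\<And>x y. max \<bar>x\<bar> \<bar>y\<bar> \<le> _\<close> K by (intro mult_left_mono) auto
    also have "\<dots> = norm (\<omega>1 * (of_real x + of_real y * \<tau>))"
      using K by (simp add: norm_mult)
    also have "\<omega>1 * (of_real x + of_real y * \<tau>) = of_real x * \<omega>1 + of_real y * \<omega>2"
      using w1 by (simp add: \<tau>_def field_simps)
    finally show ?thesis .
  qed
  then show ?thesis
    using K w1 by (intro exI[of _ "norm \<omega>1 / K"]) auto
qed

lemma lattice_min: "\<exists>c>0. \<forall>\<omega>\<in>\<Lambda> - {0}. c \<le> norm \<omega>"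
proof -
  obtain c where c: "c > 0" "\<And>x y :: real. c * max \<bar>x\<bar> \<bar>y\<bar> \<le> norm (of_real x * \<omega>1 + of_real y * \<omega>2)"
    using coordinate_bound by blast
  have "c \<le> norm \<omega>" if \<omega>: "\<omega> \<in> \<Lambda> - {0}" for \<omega>
  proof -
    obtain j k where jk: "\<omega> = of_int j * \<omega>1 + of_int k * \<omega>2"
      using \<omega> by (auto simp: period_lattice_def)
    with \<omega> have "j \<noteq> 0 \<or> k \<noteq> 0" by auto
    then have "1 \<le> max \<bar>real_of_int j\<bar> \<bar>real_of_int k\<bar>"
      by (auto simp: le_max_iff_disj)
    then have "c * 1 \<le> c * max \<bar>real_of_int j\<bar> \<bar>real_of_int k\<bar>"
      using c(1) by (intro mult_left_mono) auto
    with c(2)[of "real_of_int j" "real_of_int k"] show ?thesis by (simp add: jk)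
  qed
  with c(1) show ?thesis by blast
qed

lemma lattice_pointI: "of_int j * \<omega>1 + of_int k * \<omega>2 \<in> \<Lambda>"
  unfolding period_lattice_def by blast

lemma zero_in_lattice: "0 \<in> \<Lambda>"
  using lattice_pointI[of 0 0] by simp

lemma lattice_add: "u \<in> \<Lambda> \<Longrightarrow> v \<in> \<Lambda> \<Longrightarrow> u + v \<in> \<Lambda>"
proof -
  assume "u \<in> \<Lambda>" "v \<in> \<Lambda>"
  then obtain j k j' k' where "u = of_int j * \<omega>1 + of_int k * \<omega>2" "v = of_int j' * \<omega>1 + of_int k' * \<omega>2"
    by (auto simp: period_lattice_def)
  then have "u + v = of_int (j + j') * \<omega>1 + of_int (k + k') * \<omega>2"
    by (simp add: algebra_simps)
  then show ?thesis using lattice_pointI by metis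
qed

lemma lattice_minus: "u \<in> \<Lambda> \<Longrightarrow> - u \<in> \<Lambda>"
proof -
  assume "u \<in> \<Lambda>"
  then obtain j k where "u = of_int j * \<omega>1 + of_int k * \<omega>2"
    by (auto simp: period_lattice_def)
  then have "- u = of_int (- j) * \<omega>1 + of_int (- k) * \<omega>2"
    by simp
  then show ?thesis using lattice_pointI by metis
qed

lemma lattice_minus_iff: "- u \<in> \<Lambda> \<longleftrightarrow> u \<in> \<Lambda>"
  using lattice_minus[of u] lattice_minus[of "- u"] by auto

lemma lattice_diff: "u \<in> \<Lambda> \<Longrightarrow> v \<in> \<Lambda> \<Longrightarrow> u - v \<in> \<Lambda>"
  using lattice_add[of u "- v"] lattice_minus[of v] by simp

lemma lattice_add_iff: "\<omega> \<in> \<Lambda> \<Longrightarrow> u + \<omega> \<in> \<Lambda> \<longleftrightarrow> u \<in> \<Lambda>"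
  using lattice_add[of u \<omega>] lattice_diff[of "u + \<omega>" \<omega>] by auto

lemma countable_lattice: "countable \<Lambda>"
proof -
  have "\<Lambda> = (\<lambda>(j, k). of_int j * \<omega>1 + of_int k * \<omega>2) ` (UNIV :: (int \<times> int) set)"
    by (auto simp: period_lattice_def image_def)
  then show ?thesis by (metis countable_image countableI_type)
qed

lemma closed_sublattice: "S \<subseteq> \<Lambda> \<Longrightarrow> closed S"
proof -
  assume S: "S \<subseteq> \<Lambda>"
  obtain c where c: "c > 0" "\<And>\<omega>. \<omega> \<in> \<Lambda> - {0} \<Longrightarrow> c \<le> norm \<omega>"
    using lattice_min by blast
  show ?thesis
  proof (rule discrete_imp_closed[OF c(1)], intro ballI impI)
    fix x y assume xy: "x \<in> S" "y \<in> S" "dist y x < c"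
    then have "y - x \<in> \<Lambda>"
      using S lattice_diff by blast
    then show "y = x"
      using c(2)[of "y - x"] xy(3) by (auto simp: dist_norm)
  qed
qed

text \<open>With \<open>m = max \<bar>j\<bar> \<bar>k\<bar> \<ge> 1\<close> one has \<open>(1 + \<bar>j\<bar>) (1 + \<bar>k\<bar>) \<le> (2 m)\<^sup>2\<close>, so \<open>m\<^sup>-\<^sup>3\<close> is dominated by eight times a
product of two convergent series over the integers with exponent \<open>-3/2\<close>. This avoids
counting lattice points in shells.\<close>

lemma summable_lattice_cube: "(\<lambda>\<omega>. 1 / norm \<omega> ^ 3) summable_on \<Lambda> - {0}"
proof -
  obtain c where c: "c > 0" "\<And>x y :: real. c * max \<bar>x\<bar> \<bar>y\<bar> \<le> norm (of_real x * \<omega>1 + of_real y * \<omega>2)"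
    using coordinate_bound by blast
  define pt where "pt = (\<lambda>(j :: int, k :: int). of_int j * \<omega>1 + of_int k * \<omega>2)"
  define \<phi> where "\<phi> k = (1 + \<bar>real_of_int k\<bar>) powr (- (3/2))" for k
  have inj: "inj pt"
  proof (rule injI)
    fix a b :: "int \<times> int" assume "pt a = pt b"
    then have "pt (fst a - fst b, snd a - snd b) = 0"
      by (simp add: pt_def case_prod_beta algebra_simps)
    then have "c * max \<bar>real_of_int (fst a - fst b)\<bar> \<bar>real_of_int (snd a - snd b)\<bar> \<le> 0"
      using c(2)[of "real_of_int (fst a - fst b)" "real_of_int (snd a - snd b)"] by (simp add: pt_def)
    then have "max \<bar>real_of_int (fst a - fst b)\<bar> \<bar>real_of_int (snd a - snd b)\<bar> \<le> 0"
      using c(1) by (simp add: mult_le_0_iff)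
    then show "a = b"
      by (auto simp: prod_eq_iff)
  qed
  have "pt (0, 0) = 0" by (simp add: pt_def)
  moreover have "\<Lambda> = range pt"
    by (auto simp: period_lattice_def pt_def image_def)
  ultimately have img: "\<Lambda> - {0} = pt ` (UNIV - {(0, 0)})"
    using image_set_diff[OF inj, of UNIV "{(0, 0)}"] by simp
  have sum\<phi>: "\<phi> summable_on UNIV"
    unfolding \<phi>_def by (rule summable_on_int_powr)
  have "(\<lambda>p. \<phi> (fst p) * \<phi> (snd p)) summable_on (SIGMA j:UNIV. UNIV)"
  proof (rule summable_on_SigmaI)
    fix j :: int
    show "((\<lambda>k. \<phi> (fst (j, k)) * \<phi> (snd (j, k))) has_sum \<phi> j * infsum \<phi> UNIV) UNIV"
      using has_sum_cmult_right[OF has_sum_infsum[OF sum\<phi>]] by simp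
    show "(\<lambda>j. \<phi> j * infsum \<phi> UNIV) summable_on UNIV"
      by (rule summable_on_cmult_left[OF sum\<phi>])
  qed (auto simp: \<phi>_def)
  then have sum2: "(\<lambda>p. 8 / c ^ 3 * (\<phi> (fst p) * \<phi> (snd p))) summable_on UNIV - {(0, 0)}"
    by (intro summable_on_cmult_right) (rule summable_on_subset_banach, auto)
  have "(\<lambda>p. 1 / norm (pt p) ^ 3) summable_on UNIV - {(0, 0)}"
  proof (rule summable_on_comparison_test[OF sum2])
    fix p :: "int \<times> int" assume p: "p \<in> UNIV - {(0, 0)}"
    obtain j k where jk: "p = (j, k)" by (cases p)
    define m where "m = max \<bar>real_of_int j\<bar> \<bar>real_of_int k\<bar>"
    have m1: "1 \<le> m"
      using p jk by (auto simp: m_def le_max_iff_disj)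
    have cm: "c * m \<le> norm (pt p)"
      using c(2)[of "real_of_int j" "real_of_int k"] by (simp add: pt_def jk m_def)
    have "(1 + \<bar>real_of_int j\<bar>) * (1 + \<bar>real_of_int k\<bar>) \<le> (2 * m) * (2 * m)"
      by (rule mult_mono) (use m1 in \<open>auto simp: m_def\<close>)
    then have "((2 * m) * (2 * m)) powr (- (3/2)) \<le> ((1 + \<bar>real_of_int j\<bar>) * (1 + \<bar>real_of_int k\<bar>)) powr (- (3/2))"
      by (intro powr_mono2') (auto intro: mult_pos_pos)
    also have "\<dots> = \<phi> j * \<phi> k"
      by (simp add: \<phi>_def powr_mult)
    also have "((2 * m) * (2 * m)) powr (- (3/2)) = 1 / (2 * m) ^ 3"
    proof -
      have sq: "(t * t) powr (- (3/2)) = t powr (- 3)" if "t > 0" for t :: real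
        using that by (simp add: powr_mult flip: powr_add)
      have "((2 * m) * (2 * m)) powr (- (3/2)) = (2 * m) powr (- 3)"
        by (rule sq) (use m1 in simp)
      also have "\<dots> = 1 / (2 * m) ^ 3"
      proof -
        have "t powr (- 3) = 1 / t ^ 3" if "t > 0" for t :: real
          using that powr_minus[of t 3] powr_numeral[of t "num.Bit1 num.One"] by (simp add: inverse_eq_divide)
        then show ?thesis
          using m1 by (metis mult_pos_pos zero_less_numeral less_le_trans zero_less_one)
      qed
      finally show ?thesis .
    qed
    finally have \<phi>: "1 / (2 * m) ^ 3 \<le> \<phi> j * \<phi> k" .
    have "1 / norm (pt p) ^ 3 \<le> 1 / (c * m) ^ 3"
    proof (rule divide_left_mono)
      have "0 < c * m" using c(1) m1 by simp
      then show "0 < norm (pt p) ^ 3 * (c * m) ^ 3"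
        using less_le_trans[OF \<open>0 < c * m\<close> cm] by (intro mult_pos_pos[OF zero_less_power zero_less_power])
    qed (use cm c(1) m1 in \<open>auto intro!: power_mono\<close>)
    also have "\<dots> = 8 / c ^ 3 * (1 / (2 * m) ^ 3)"
      by (simp add: power_mult_distrib field_simps)
    also have "\<dots> \<le> 8 / c ^ 3 * (\<phi> j * \<phi> k)"
      using \<phi> c(1) by (intro mult_left_mono) auto
    finally show "1 / norm (pt p) ^ 3 \<le> 8 / c ^ 3 * (\<phi> (fst p) * \<phi> (snd p))"
      by (simp add: jk)
  qed simp
  then show ?thesis
    unfolding img by (subst summable_on_reindex) (use inj in \<open>auto simp: o_def inj_on_def inj_def\<close>)
qed

definition wp_term :: "complex \<Rightarrow> complex \<Rightarrow> complex" where
  "wp_term \<omega> v = 1 / (v - \<omega>)^2 - 1 / \<omega>^2"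

text \<open>The Weierstrass function without its pole at \<open>0\<close>, holomorphic near \<open>0\<close>.\<close>

definition wp_regular :: "complex \<Rightarrow> complex" where
  "wp_regular v = (\<Sum>\<^sub>\<infinity>\<omega>\<in>\<Lambda> - {0}. wp_term \<omega> v)"

abbreviation wp :: "complex \<Rightarrow> complex" where "wp \<equiv> weierstrass_p \<Lambda>"

lemma wp_eq: "wp v = 1 / v^2 + wp_regular v"
  by (simp add: weierstrass_p_def wp_regular_def wp_term_def)

text \<open>Writing \<open>wp_term \<omega> v = v (2 \<omega> - v) / (\<omega>\<^sup>2 (v - \<omega>)\<^sup>2)\<close> shows the decay \<open>\<bar>\<omega>\<bar>\<^sup>-\<^sup>3\<close>. It is uniform
near \<open>v0\<close> because \<open>\<bar>v - \<omega>\<bar> \<ge> \<kappa> \<bar>\<omega>\<bar>\<close> there, including the finitely many \<open>\<omega>\<close> of size comparable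
to \<open>v0\<close>.\<close>

lemma wp_term_bound:
  assumes v0: "v0 \<notin> \<Lambda> - {0}"
  shows "\<exists>r>0. \<exists>C. \<forall>v\<in>ball v0 r. \<forall>\<omega>\<in>\<Lambda> - {0}. v \<noteq> \<omega> \<and> norm (wp_term \<omega> v) \<le> C * (1 / norm \<omega> ^ 3)"
proof -
  have "open (- (\<Lambda> - {0}))"
    by (intro open_Compl closed_sublattice) blast
  then obtain d where d: "d > 0" "ball v0 d \<subseteq> - (\<Lambda> - {0})"
    using v0 open_contains_ball by (metis ComplI)
  obtain c where c: "c > 0" "\<And>\<omega>. \<omega> \<in> \<Lambda> - {0} \<Longrightarrow> c \<le> norm \<omega>"
    using lattice_min by blast
  define r where "r = d / 2"
  define R where "R = norm v0 + r"
  define \<kappa> where "\<kappa> = min (1 / 2) (r / (2 * R))"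
  define C where "C = R * (2 + R / c) / \<kappa>^2"
  have r: "r > 0" and R: "R > 0"
    using d by (auto simp: r_def R_def intro!: add_nonneg_pos)
  then have \<kappa>: "\<kappa> > 0" by (simp add: \<kappa>_def)
  have "v \<noteq> \<omega> \<and> norm (wp_term \<omega> v) \<le> C * (1 / norm \<omega> ^ 3)" if v: "v \<in> ball v0 r" and \<omega>: "\<omega> \<in> \<Lambda> - {0}" for v \<omega>
  proof -
    define m where "m = norm \<omega>"
    have m: "m > 0" "c \<le> m" using \<omega> c(2) by (auto simp: m_def)
    have "\<omega> \<notin> ball v0 d"
      using d(2) \<omega> by blast
    then have "d \<le> dist v0 v + dist v \<omega>"
      using dist_triangle[of v0 \<omega> v] by simp
    then have far: "r \<le> norm (v - \<omega>)"
      using v by (simp add: r_def dist_norm)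
    then have ne: "v \<noteq> \<omega>" "\<omega> \<noteq> 0" using r \<omega> by auto
    have vR: "norm v \<le> R"
      using v norm_triangle_sub[of v v0] by (simp add: R_def dist_norm norm_minus_commute)
    have \<kappa>m: "\<kappa> * m \<le> norm (v - \<omega>)"
    proof (cases "2 * R \<le> m")
      case True
      have "\<kappa> * m \<le> 1 / 2 * m"
        using m by (intro mult_right_mono) (auto simp: \<kappa>_def)
      moreover have "m \<le> norm v + norm (v - \<omega>)"
        using norm_triangle_sub[of \<omega> v] by (simp add: m_def norm_minus_commute)
      ultimately show ?thesis
        using True vR by simp
    next
      case False
      then have "\<kappa> * m \<le> r / (2 * R) * (2 * R)"
        using m R r by (intro mult_mono) (auto simp: \<kappa>_def)
      with far R show ?thesis by simp
    qed
    have "norm (2 * \<omega> - v) \<le> norm (2 * \<omega>) + norm v"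
      by (rule norm_triangle_ineq4)
    also have "\<dots> \<le> 2 * m + R * 1"
      using vR by (simp add: norm_mult m_def)
    also have "\<dots> \<le> 2 * m + R * (m / c)"
      using R m c(1) by (intro add_left_mono mult_left_mono) auto
    finally have num: "norm (2 * \<omega> - v) \<le> (2 + R / c) * m"
      by (simp add: algebra_simps)
    have "1 / e^2 - 1 / \<omega>^2 = (e + \<omega>) * (2 * \<omega> - (e + \<omega>)) / (\<omega>^2 * e^2)" if "e \<noteq> 0" for e
      using that ne(2) by (simp add: field_simps power2_eq_square)
    from this[of "v - \<omega>"] have "wp_term \<omega> v = v * (2 * \<omega> - v) / (\<omega>^2 * (v - \<omega>)^2)"
      using ne(1) by (simp add: wp_term_def)
    then have "norm (wp_term \<omega> v) = norm v * norm (2 * \<omega> - v) / (m^2 * norm (v - \<omega>)^2)"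
      by (simp add: norm_mult norm_divide norm_power m_def)
    also have "\<dots> \<le> R * ((2 + R / c) * m) / (m^2 * (\<kappa> * m)^2)"
      using vR num \<kappa>m \<kappa> m R c(1) by (intro frac_le mult_mono mult_left_mono power_mono) auto
    also have "\<dots> = C * (1 / m ^ 3)"
      using m \<kappa> by (simp add: C_def field_simps power2_eq_square power3_eq_cube)
    finally show ?thesis
      using ne by (simp add: m_def)
  qed
  with r show ?thesis by blast
qed

lemma wp_term_holomorphic: "wp_term \<omega> holomorphic_on - {\<omega>}"
  unfolding wp_term_def [abs_def] by (intro holomorphic_intros) auto

lemma higher_deriv_wp_term:
  assumes "v \<noteq> \<omega>"
  shows "(deriv ^^ Suc m) (wp_term \<omega>) v = (- 1) ^ Suc m * fact (Suc (Suc m)) / (v - \<omega>) ^ (m + 3)"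
  using assms
proof (induction m arbitrary: v)
  case 0
  have "((\<lambda>u. 1 / u^2) has_field_derivative - 2 / u^3) (at u)" if "u \<noteq> 0" for u :: complex
    using that by (auto intro!: derivative_eq_intros simp: field_simps power2_eq_square power3_eq_cube)
  from DERIV_chain2[where g = "\<lambda>v. v - \<omega>", OF this[of "v - \<omega>"] DERIV_diff[OF DERIV_ident DERIV_const]] 0
  have "((\<lambda>v. 1 / (v - \<omega>)^2) has_field_derivative - 2 / (v - \<omega>)^3) (at v)"
    by simp
  from DERIV_diff[OF this DERIV_const]
  have "(wp_term \<omega> has_field_derivative - 2 / (v - \<omega>)^3) (at v)"
    by (simp add: wp_term_def [abs_def])
  then show ?case
    by (simp add: DERIV_imp_deriv)
next
  case (Suc m)
  define c :: complex where "c = (- 1) ^ Suc m * fact (Suc (Suc m))"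
  have "((\<lambda>u. c / u ^ Suc k) has_field_derivative - of_nat (Suc k) * c / u ^ Suc (Suc k)) (at u)"
    if "u \<noteq> 0" for u :: complex and k
  proof -
    have P: "((\<lambda>u. u ^ Suc k) has_field_derivative of_nat (Suc k) * u ^ k) (at u)"
      by (rule DERIV_cong[OF DERIV_power[OF DERIV_ident]]) simp
    have nz: "u ^ Suc k \<noteq> 0"
      using that by simp
    have "((\<lambda>u. c * inverse (u ^ Suc k)) has_field_derivative
        c * (- (inverse (u ^ Suc k) * (of_nat (Suc k) * u ^ k) * inverse (u ^ Suc k)))) (at u)"
      by (rule DERIV_cmult[OF DERIV_inverse'[OF P nz]])
    also have "c * (- (inverse (u ^ Suc k) * (of_nat (Suc k) * u ^ k) * inverse (u ^ Suc k)))
        = - of_nat (Suc k) * c / u ^ Suc (Suc k)"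
      using that by (simp add: field_simps)
    finally show ?thesis
      by (simp add: divide_inverse)
  qed
  from DERIV_chain2[where g = "\<lambda>v. v - \<omega>", OF this[of "v - \<omega>" "m + 2"] DERIV_diff[OF DERIV_ident DERIV_const]]
  have "((\<lambda>v. c / (v - \<omega>) ^ (m + 3)) has_field_derivative - of_nat (m + 3) * c / (v - \<omega>) ^ Suc (m + 3)) (at v)"
    using Suc.prems by (simp add: numeral_3_eq_3 numeral_2_eq_2)
  moreover have "- of_nat (m + 3) * c = (- 1) ^ Suc (Suc m) * fact (Suc (Suc (Suc m)))"
    by (simp add: c_def algebra_simps)
  ultimately have "((\<lambda>v. c / (v - \<omega>) ^ (m + 3)) has_field_derivative
      (- 1) ^ Suc (Suc m) * fact (Suc (Suc (Suc m))) / (v - \<omega>) ^ (Suc m + 3)) (at v)"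
    by (simp only: add_Suc)
  then have "((deriv ^^ Suc m) (wp_term \<omega>) has_field_derivative
      (- 1) ^ Suc (Suc m) * fact (Suc (Suc (Suc m))) / (v - \<omega>) ^ (Suc m + 3)) (at v)"
    by (rule has_field_derivative_transform_within_open[of _ _ _ "- {\<omega>}"])
       (use Suc.prems Suc.IH in \<open>auto simp: c_def simp del: funpow.simps\<close>)
  then have "deriv ((deriv ^^ Suc m) (wp_term \<omega>)) v =
      (- 1) ^ Suc (Suc m) * fact (Suc (Suc (Suc m))) / (v - \<omega>) ^ (Suc m + 3)"
    by (rule DERIV_imp_deriv)
  then show ?case
    by (simp only: funpow.simps(2)[of "Suc m"] o_apply)
qed

lemma higher_deriv_sum_holomorphic:
  assumes "finite A" "\<And>i. i \<in> A \<Longrightarrow> f i holomorphic_on S" "open S" "z \<in> S"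
  shows "(deriv ^^ m) (\<lambda>w. \<Sum>i\<in>A. f i w) z = (\<Sum>i\<in>A. (deriv ^^ m) (f i) z)"
  using assms
proof (induction A rule: finite_induct)
  case empty
  have "(deriv ^^ m) (\<lambda>w. 0) = (\<lambda>w. 0 :: complex)"
    by (induction m) auto
  then show ?case by simp
next
  case (insert i A)
  have "(deriv ^^ m) (\<lambda>w. f i w + (\<Sum>i\<in>A. f i w)) z = (deriv ^^ m) (f i) z + (deriv ^^ m) (\<lambda>w. \<Sum>i\<in>A. f i w) z"
    by (rule higher_deriv_add[where S = S]) (use insert in \<open>auto intro!: holomorphic_intros\<close>)
  with insert show ?case by simp
qed

text \<open>By the cubic bound, Weierstrass's M-test gives uniform convergence near \<open>v0\<close>, and uniform limits
of holomorphic functions may be differentiated term by term.\<close>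

lemma
  assumes v0: "v0 \<notin> \<Lambda> - {0}"
  shows higher_deriv_wp_regular:
      "((\<lambda>\<omega>. (deriv ^^ m) (wp_term \<omega>) v0) has_sum (deriv ^^ m) wp_regular v0) (\<Lambda> - {0})"
    and wp_regular_differentiable: "wp_regular field_differentiable at v0"
proof -
  obtain r C where r: "r > 0" and b: "\<And>v \<omega>. v \<in> ball v0 r \<Longrightarrow> \<omega> \<in> \<Lambda> - {0} \<Longrightarrow>
      v \<noteq> \<omega> \<and> norm (wp_term \<omega> v) \<le> C * (1 / norm \<omega> ^ 3)"
    using wp_term_bound[OF v0] by blast
  let ?F = "finite_subsets_at_top (\<Lambda> - {0})"
  have lim: "uniform_limit (ball v0 r) (\<lambda>X v. \<Sum>\<omega>\<in>X. wp_term \<omega> v) wp_regular ?F"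
    unfolding wp_regular_def
  proof (rule Weierstrass_m_test_general)
    show "(\<lambda>\<omega>. C * (1 / norm \<omega> ^ 3)) summable_on \<Lambda> - {0}"
      by (rule summable_on_cmult_right[OF summable_lattice_cube])
  qed (use b in blast)
  have hol: "wp_term \<omega> holomorphic_on ball v0 r" if "\<omega> \<in> \<Lambda> - {0}" for \<omega>
    using b that by (intro holomorphic_on_subset[OF wp_term_holomorphic]) auto
  have ev: "\<forall>\<^sub>F X in ?F. (\<lambda>v. \<Sum>\<omega>\<in>X. wp_term \<omega> v) holomorphic_on ball v0 r"
    by (rule eventually_finite_subsets_at_top_weakI) (auto intro!: holomorphic_on_sum hol)
  have "((\<lambda>X. (deriv ^^ m) (\<lambda>v. \<Sum>\<omega>\<in>X. wp_term \<omega> v) v0) \<longlongrightarrow> (deriv ^^ m) wp_regular v0) ?F"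
    by (rule higher_deriv_complex_uniform_limit[OF lim ev]) (use r in auto)
  moreover have "\<forall>\<^sub>F X in ?F. (deriv ^^ m) (\<lambda>v. \<Sum>\<omega>\<in>X. wp_term \<omega> v) v0 = (\<Sum>\<omega>\<in>X. (deriv ^^ m) (wp_term \<omega>) v0)"
    by (rule eventually_finite_subsets_at_top_weakI)
       (use r in \<open>auto intro!: higher_deriv_sum_holomorphic[where S = "ball v0 r"] hol\<close>)
  ultimately show "((\<lambda>\<omega>. (deriv ^^ m) (wp_term \<omega>) v0) has_sum (deriv ^^ m) wp_regular v0) (\<Lambda> - {0})"
    unfolding has_sum_def by (rule Lim_transform_eventually)
  have sub: "cball v0 (r / 2) \<subseteq> ball v0 r" "ball v0 (r / 2) \<subseteq> ball v0 r"
    using r by auto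
  have "wp_regular holomorphic_on ball v0 (r / 2)"
  proof (rule holomorphic_uniform_limit)
    show "uniform_limit (cball v0 (r / 2)) (\<lambda>X v. \<Sum>\<omega>\<in>X. wp_term \<omega> v) wp_regular ?F"
      by (rule uniform_limit_on_subset[OF lim sub(1)])
    show "\<forall>\<^sub>F X in ?F. continuous_on (cball v0 (r / 2)) (\<lambda>v. \<Sum>\<omega>\<in>X. wp_term \<omega> v) \<and>
        (\<lambda>v. \<Sum>\<omega>\<in>X. wp_term \<omega> v) holomorphic_on ball v0 (r / 2)"
      using ev
    proof eventually_elim
      case (elim X)
      show ?case
        using continuous_on_subset[OF holomorphic_on_imp_continuous_on[OF elim] sub(1)]
          holomorphic_on_subset[OF elim sub(2)] by blast
    qed
  qed auto
  then show "wp_regular field_differentiable at v0"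
    by (rule holomorphic_on_imp_differentiable_at) (use r in auto)
qed

lemma open_off_lattice: "open (- \<Lambda>)" "open (- (\<Lambda> - {0}))"
  by (intro open_Compl closed_sublattice; blast)+

lemma connected_off_countable: "countable S \<Longrightarrow> connected (- S)" for S :: "complex set"
  using connected_open_diff_countable[of "UNIV :: complex set" S] by (simp add: Compl_eq_Diff_UNIV connected_UNIV)

lemma wp_regular_holomorphic: "wp_regular holomorphic_on - (\<Lambda> - {0})"
  unfolding holomorphic_on_def
proof
  fix v assume "v \<in> - (\<Lambda> - {0})"
  then show "wp_regular field_differentiable (at v within - (\<Lambda> - {0}))"
    by (intro field_differentiable_at_within[OF wp_regular_differentiable]) blast
qed

lemma wp_holomorphic: "wp holomorphic_on - \<Lambda>"
proof -
  have "wp_regular holomorphic_on - \<Lambda>"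
    by (rule holomorphic_on_subset[OF wp_regular_holomorphic]) blast
  then have "(\<lambda>v. 1 / v^2 + wp_regular v) holomorphic_on - \<Lambda>"
    by (intro holomorphic_intros) (use zero_in_lattice in auto)
  then show ?thesis by (simp add: wp_eq [abs_def])
qed

lemma wp_even: "wp (- v) = wp v"
proof -
  have img: "uminus ` (\<Lambda> - {0}) = \<Lambda> - {0}"
  proof -
    have sub: "uminus ` (\<Lambda> - {0}) \<subseteq> \<Lambda> - {0}"
    proof (rule image_subsetI)
      show "- u \<in> \<Lambda> - {0}" if "u \<in> \<Lambda> - {0}" for u
        using lattice_minus[of u] that by simp
    qed
    then have "uminus ` uminus ` (\<Lambda> - {0}) \<subseteq> uminus ` (\<Lambda> - {0})"
      by (rule image_mono)
    with sub show ?thesis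
      by (simp add: image_image)
  qed
  have "wp_regular (- v) = infsum (\<lambda>\<omega>. wp_term \<omega> (- v)) (uminus ` (\<Lambda> - {0}))"
    by (simp add: wp_regular_def img)
  also have "\<dots> = infsum (\<lambda>\<omega>. wp_term (- \<omega>) (- v)) (\<Lambda> - {0})"
    by (subst infsum_reindex) (auto simp: o_def)
  also have "(\<lambda>\<omega>. wp_term (- \<omega>) (- v)) = (\<lambda>\<omega>. wp_term \<omega> v)"
  proof
    fix \<omega>
    have "- v - - \<omega> = - (v - \<omega>)" by simp
    then show "wp_term (- \<omega>) (- v) = wp_term \<omega> v"
      unfolding wp_term_def by (simp only: power2_minus)
  qed
  finally have "wp_regular (- v) = wp_regular v"
    by (simp add: wp_regular_def)
  then show ?thesis by (simp add: wp_eq)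
qed

text \<open>Unlike the series of \<open>\<wp>\<close> itself, the series of \<open>\<wp>'\<close> runs over the whole lattice, and
translation by a lattice vector permutes its terms, which makes periodicity evident.\<close>

lemma wp_deriv_has_sum:
  assumes v: "v \<notin> \<Lambda>"
  shows "((\<lambda>\<omega>. - 2 / (v - \<omega>)^3) has_sum deriv wp v) \<Lambda>"
proof -
  have v': "v \<notin> \<Lambda> - {0}" "v \<noteq> 0" using v zero_in_lattice by auto
  have first_deriv: "(deriv ^^ Suc 0) (wp_term \<omega>) v = - 2 / (v - \<omega>)^3" if "\<omega> \<in> \<Lambda> - {0}" for \<omega>
    using higher_deriv_wp_term[of v \<omega> 0] that v by (auto simp: numeral_3_eq_3)
  have "((\<lambda>\<omega>. - 2 / (v - \<omega>)^3) has_sum (deriv ^^ Suc 0) wp_regular v) (\<Lambda> - {0})"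
    by (rule has_sum_cong[THEN iffD1, OF first_deriv higher_deriv_wp_regular[OF v'(1)]])
  then have "((\<lambda>\<omega>. - 2 / (v - \<omega>)^3) has_sum deriv wp_regular v) (\<Lambda> - {0})"
    by simp
  then have "((\<lambda>\<omega>. - 2 / (v - \<omega>)^3) has_sum (- 2 / (v - 0)^3 + deriv wp_regular v)) (insert 0 (\<Lambda> - {0}))"
    by (intro has_sum_insert) auto
  moreover have "insert 0 (\<Lambda> - {0}) = \<Lambda>" using zero_in_lattice by auto
  moreover have "deriv wp v = - 2 / (v - 0)^3 + deriv wp_regular v"
  proof -
    have "(wp_regular has_field_derivative deriv wp_regular v) (at v)"
      using wp_regular_differentiable[OF v'(1)] by (simp add: DERIV_deriv_iff_field_differentiable)
    then have "((\<lambda>v. 1 / v^2 + wp_regular v) has_field_derivative - 2 / v^3 + deriv wp_regular v) (at v)"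
      using v'(2) by (auto intro!: derivative_eq_intros simp: field_simps power2_eq_square power3_eq_cube)
    then show ?thesis by (simp add: wp_eq [abs_def] DERIV_imp_deriv)
  qed
  ultimately show ?thesis by simp
qed

lemma wp_deriv_periodic:
  assumes v: "v \<notin> \<Lambda>" and w: "w \<in> \<Lambda>"
  shows "deriv wp (v + w) = deriv wp v"
proof -
  have vw: "v + w \<notin> \<Lambda>" using v lattice_add_iff[OF w] by blast
  have "((\<lambda>\<omega>. - 2 / (v - \<omega>)^3) has_sum deriv wp (v + w)) \<Lambda>"
  proof (rule has_sum_reindex_bij_witness[THEN iffD1, OF _ _ _ _ _ refl wp_deriv_has_sum[OF vw]])
    show "\<omega> - w + w = \<omega>" "\<omega> + w - w = \<omega>" for \<omega> by auto
    show "\<omega> - w \<in> \<Lambda>" "\<omega> + w \<in> \<Lambda>" if "\<omega> \<in> \<Lambda>" for \<omega>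
      using that w lattice_add lattice_diff by auto
  qed (simp add: algebra_simps)
  then show ?thesis
    using has_sum_unique wp_deriv_has_sum[OF v] by blast
qed

text \<open>Since \<open>\<wp>'\<close> is periodic, \<open>\<wp>(u + w) - \<wp>(u)\<close> is a constant \<open>c\<close>. Taking \<open>u = v\<close> and \<open>u = - v - w\<close>
gives \<open>c = - c\<close>, because \<open>\<wp>\<close> is even.\<close>

lemma wp_periodic:
  assumes v: "v \<notin> \<Lambda>" and w: "w \<in> \<Lambda>"
  shows "wp (v + w) = wp v"
proof -
  have off: "u + w \<notin> \<Lambda>" if "u \<notin> \<Lambda>" for u
    using that lattice_add_iff[OF w] by blast
  have D: "(wp has_field_derivative deriv wp u) (at u)" if "u \<notin> \<Lambda>" for u
    using that by (intro holomorphic_derivI[OF wp_holomorphic open_off_lattice(1)]) auto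
  have "((\<lambda>u. wp (u + w) - wp u) has_field_derivative 0) (at u)" if u: "u \<notin> \<Lambda>" for u
  proof -
    have "((\<lambda>u. wp (u + w)) has_field_derivative deriv wp (u + w)) (at u)"
      using D[OF off[OF u]] by (simp add: DERIV_shift)
    from DERIV_diff[OF this D[OF u]] show ?thesis
      by (simp add: wp_deriv_periodic[OF u w])
  qed
  then have D0: "\<forall>u\<in>- \<Lambda> - {}. ((\<lambda>u. wp (u + w) - wp u) has_field_derivative 0) (at u)"
    by blast
  have "continuous_on (- \<Lambda>) (\<lambda>u. wp (u + w) - wp u)"
    by (rule continuous_at_imp_continuous_on) (use D0 DERIV_isCont in blast)
  then obtain c where c: "\<And>u. u \<in> - \<Lambda> \<Longrightarrow> wp (u + w) - wp u = c"
    using DERIV_zero_connected_constant[OF connected_off_countable[OF countable_lattice] open_off_lattice(1) finite.emptyI _ D0]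
    by blast
  have "wp (- v - w + w) - wp (- v - w) = c"
    using off[OF v] lattice_minus_iff[of "v + w"] by (intro c) (simp add: algebra_simps)
  moreover have "wp (- v - w) = wp (v + w)" "wp (- v) = wp v"
    using wp_even[of "v + w"] wp_even[of v] by (simp_all add: algebra_simps)
  ultimately have "wp v - wp (v + w) = c" by simp
  moreover have "wp (v + w) - wp v = c"
    using v by (intro c) simp
  ultimately show ?thesis by (simp add: algebra_simps)
qed

end

section \<open>The differential equation and the duplication formula of the Weierstrass function\<close>

lemma holomorphic_taylor_remainder:
  assumes f: "f holomorphic_on ball 0 R" and R: "R > 0"
  shows "\<exists>r. r holomorphic_on ball 0 R \<and>
    (\<forall>v\<in>ball 0 R. f v = (\<Sum>k<n. (deriv ^^ k) f 0 / fact k * v ^ k) + v ^ n * r v)"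
proof (intro exI conjI ballI)
  define F where "F = fps_expansion f 0"
  have f': "f holomorphic_on eball 0 (ereal R)" using f by simp
  have rad: "fps_conv_radius F \<ge> ereal R"
    unfolding F_def by (rule conv_radius_fps_expansion[OF f'])
  show "eval_fps (fps_shift n F) holomorphic_on ball 0 R"
    using rad by (intro holomorphic_on_eval_fps) (simp add: ball_eball_mono)
  fix v :: complex assume v: "v \<in> ball 0 R"
  then have vr: "ereal (norm v) < fps_conv_radius F"
    using rad by (intro less_le_trans[OF _ rad]) simp
  have "f v = eval_fps F v"
    using eval_fps_expansion'[OF f', of v] v by (simp add: F_def)
  also have "\<dots> = (\<Sum>k. fps_nth F (k + n) * v ^ (k + n)) + (\<Sum>k<n. fps_nth F k * v ^ k)"
    unfolding eval_fps_def by (rule suminf_split_initial_segment[OF summable_fps[OF vr]])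
  also have "(\<Sum>k. fps_nth F (k + n) * v ^ (k + n)) = (\<Sum>k. v ^ n * (fps_nth (fps_shift n F) k * v ^ k))"
    by (simp add: power_add mult_ac)
  also have "\<dots> = v ^ n * eval_fps (fps_shift n F) v"
    unfolding eval_fps_def using vr by (intro suminf_mult summable_fps) simp
  finally show "f v = (\<Sum>k<n. (deriv ^^ k) f 0 / fact k * v ^ k) + v ^ n * eval_fps (fps_shift n F) v"
    by (simp add: F_def fps_expansion_def)
qed

text \<open>A solution that vanishes to order \<open>m\<close> at \<open>0\<close> satisfies \<open>- 4 m = 12\<close> by comparison of the leading
terms of \<open>u d' A = d B\<close>. The only possible exponent, \<open>-3\<close>, is negative, so a holomorphic
solution is zero. The values \<open>-4\<close> and \<open>12\<close> are those that occur for the difference of two functions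
with principal part \<open>1 / u\<^sup>2\<close> that satisfy the differential equation of \<open>\<wp>\<close>.\<close>

lemma vanishes_by_initial_exponents:
  fixes d A B :: "complex \<Rightarrow> complex"
  assumes d: "d holomorphic_on ball 0 R" and R: "R > 0"
    and A: "isCont A 0" "A 0 = - 4" and B: "isCont B 0" "B 0 = 12"
    and eq: "\<And>u. u \<in> ball 0 R \<Longrightarrow> u \<noteq> 0 \<Longrightarrow> u * deriv d u * A u = d u * B u"
    and u: "u \<in> ball 0 R"
  shows "d u = 0"
proof (rule ccontr)
  assume du: "d u \<noteq> 0"
  have near: "\<forall>\<^sub>F u in at (0::complex). u \<in> ball 0 r \<and> u \<noteq> 0" if "r > 0" for r :: real
  proof -
    have "\<forall>\<^sub>F u in at 0. u \<in> ball (0::complex) r - {0}"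
      using that by (intro eventually_at_in_open) auto
    then show ?thesis
      by (rule eventually_mono) auto
  qed
  have cont0: "isCont g 0" if "g holomorphic_on ball 0 r" "r > 0" for g :: "complex \<Rightarrow> complex" and r
    using that by (meson centre_in_ball continuous_on_eq_continuous_at holomorphic_on_imp_continuous_on open_ball)
  have lim: "(g \<longlongrightarrow> g 0) (at 0)" if "isCont g 0" for g :: "complex \<Rightarrow> complex"
    using that by (simp add: isCont_def)
  have A': "(A \<longlongrightarrow> - 4) (at 0)" and B': "(B \<longlongrightarrow> 12) (at 0)"
    using lim[OF A(1)] lim[OF B(1)] A(2) B(2) by simp_all
  show False
  proof (cases "d 0 = 0")
    case False
    have lhs: "((\<lambda>u. u * deriv d u * A u) \<longlongrightarrow> 0 * deriv d 0 * (- 4)) (at 0)"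
      using d R by (intro tendsto_intros A' lim cont0[OF holomorphic_deriv]) auto
    have rhs: "((\<lambda>u. d u * B u) \<longlongrightarrow> d 0 * 12) (at 0)"
      using d R by (intro tendsto_intros B' lim cont0)
    have ev: "\<forall>\<^sub>F u in at 0. u * deriv d u * A u = d u * B u"
      using near[OF R] by eventually_elim (use eq in blast)
    have "0 * deriv d 0 * (- 4) = d 0 * 12"
      by (rule tendsto_unique[OF at_neq_bot Lim_transform_eventually[OF lhs ev] rhs])
    with False show False by simp
  next
    case True
    have in0: "(0::complex) \<in> ball 0 R" using R by simp
    have nc: "\<not> d constant_on ball 0 R"
    proof
      assume "d constant_on ball 0 R"
      then obtain y where "\<And>x. x \<in> ball 0 R \<Longrightarrow> d x = y"
        unfolding constant_on_def by blast
      from this[OF u] this[OF in0] have "d u = d 0"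
        by simp
      with True du show False by simp
    qed
    obtain g r n where n: "0 < n" and r: "0 < r" "ball (0::complex) r \<subseteq> ball 0 R"
      and g: "g holomorphic_on ball 0 r" "\<And>w. w \<in> ball 0 r \<Longrightarrow> d w = (w - 0) ^ n * g w"
      and nz: "\<And>w. w \<in> ball 0 r \<Longrightarrow> g w \<noteq> 0"
      by (rule holomorphic_factor_zero_nonconstant[OF d open_ball connected_ball in0 True nc], rule that)
    have "(of_nat n * g w + w * deriv g w) * A w = g w * B w" if w: "w \<in> ball 0 r" "w \<noteq> 0" for w
    proof -
      have "(g has_field_derivative deriv g w) (at w)"
        using g(1) w by (intro holomorphic_derivI) auto
      then have "((\<lambda>w. w ^ n * g w) has_field_derivative of_nat n * w ^ (n - 1) * g w + w ^ n * deriv g w) (at w)"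
        by (auto intro!: derivative_eq_intros)
      then have "(d has_field_derivative of_nat n * w ^ (n - 1) * g w + w ^ n * deriv g w) (at w)"
        by (rule has_field_derivative_transform_within_open[OF _ open_ball w(1)]) (simp add: g(2))
      then have "deriv d w = of_nat n * w ^ (n - 1) * g w + w ^ n * deriv g w"
        by (rule DERIV_imp_deriv)
      then have "w * deriv d w = w ^ n * (of_nat n * g w + w * deriv g w)"
        using n by (cases n) (simp_all add: algebra_simps)
      then have "w ^ n * ((of_nat n * g w + w * deriv g w) * A w) = w ^ n * (g w * B w)"
        using eq[of w] w r g(2)[OF w(1)] by (auto simp: mult.assoc)
      then show ?thesis
        using w(2) by simp
    qed
    then have ev: "\<forall>\<^sub>F w in at 0. (of_nat n * g w + w * deriv g w) * A w = g w * B w"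
      using near[OF r(1)] by (auto elim: eventually_mono)
    have lhs: "((\<lambda>w. (of_nat n * g w + w * deriv g w) * A w) \<longlongrightarrow> (of_nat n * g 0 + 0 * deriv g 0) * (- 4)) (at 0)"
      using g r by (intro tendsto_intros A' lim cont0[OF g(1)] cont0[OF holomorphic_deriv[OF g(1)]]) auto
    have rhs: "((\<lambda>w. g w * B w) \<longlongrightarrow> g 0 * 12) (at 0)"
      using g r by (intro tendsto_intros B' lim cont0[OF g(1)])
    have zero: "(of_nat n * g 0 + 0 * deriv g 0) * (- 4) = g 0 * 12"
      by (rule tendsto_unique[OF at_neq_bot Lim_transform_eventually[OF lhs ev] rhs])
    have "- 4 * (g 0 * of_nat (n + 3)) = (of_nat n * g 0 + 0 * deriv g 0) * (- 4) - g 0 * 12"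
      by (simp add: algebra_simps)
    also have "\<dots> = 0"
      using zero by simp
    finally have "g 0 * of_nat (n + 3) = 0"
      by (simp del: of_nat_add)
    then show False
      using nz[of 0] r(1) by (simp del: of_nat_add)
  qed
qed

context complex_lattice
begin

abbreviation g2 :: complex where "g2 \<equiv> weierstrass_g2 \<Lambda>"
abbreviation g3 :: complex where "g3 \<equiv> weierstrass_g3 \<Lambda>"

lemma has_sum_lattice_odd:
  assumes f: "(f has_sum s) (\<Lambda> - {0})" and odd: "\<And>\<omega>. f (- \<omega>) = - f \<omega>"
  shows "s = (0 :: complex)"
proof -
  have "((\<lambda>\<omega>. - f \<omega>) has_sum s) (\<Lambda> - {0})"
  proof (rule has_sum_reindex_bij_witness[THEN iffD1, OF _ _ _ _ _ refl f])
    show "- \<omega> \<in> \<Lambda> - {0}" if "\<omega> \<in> \<Lambda> - {0}" for \<omega>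
      using that lattice_minus[of \<omega>] by simp
    then show "- \<omega> \<in> \<Lambda> - {0}" if "\<omega> \<in> \<Lambda> - {0}" for \<omega>
      using that by blast
  qed (simp_all add: odd)
  moreover have "((\<lambda>\<omega>. - f \<omega>) has_sum - s) (\<Lambda> - {0})"
    using f by (simp add: has_sum_uminus)
  ultimately have "s = - s"
    by (rule has_sum_unique)
  then show ?thesis by simp
qed

text \<open>The derivatives of odd order are lattice sums of odd functions; those of order two and four are
the Eisenstein sums \<open>6 \<Sum> \<omega>\<^sup>-\<^sup>4\<close> and \<open>120 \<Sum> \<omega>\<^sup>-\<^sup>6\<close>.\<close>

lemma wp_regular_derivs_at_0:
  "wp_regular 0 = 0" "deriv wp_regular 0 = 0" "(deriv ^^ 2) wp_regular 0 = g2 / 10"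
  "(deriv ^^ 3) wp_regular 0 = 0" "(deriv ^^ 4) wp_regular 0 = 6 / 7 * g3"
proof -
  have 0: "0 \<notin> \<Lambda> - {0}" by simp
  have D: "((\<lambda>\<omega>. (- 1) ^ Suc m * fact (Suc (Suc m)) / (- \<omega>) ^ (m + 3)) has_sum (deriv ^^ Suc m) wp_regular 0) (\<Lambda> - {0})" for m
  proof (rule has_sum_cong[THEN iffD1, OF _ higher_deriv_wp_regular[OF 0]])
    fix \<omega> assume "\<omega> \<in> \<Lambda> - {0}"
    then show "(deriv ^^ Suc m) (wp_term \<omega>) 0 = (- 1) ^ Suc m * fact (Suc (Suc m)) / (- \<omega>) ^ (m + 3)"
      using higher_deriv_wp_term[of 0 \<omega> m] by simp
  qed
  show "wp_regular 0 = 0"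
    by (simp add: wp_regular_def wp_term_def)
  show "deriv wp_regular 0 = 0"
    using has_sum_lattice_odd[OF D[of 0]] by (simp add: numeral_3_eq_3)
  show "(deriv ^^ 3) wp_regular 0 = 0"
    using has_sum_lattice_odd[OF D[of 2]] by (simp add: eval_nat_numeral)
  have "((\<lambda>\<omega>. 6 * (1 / \<omega> ^ 4)) has_sum (deriv ^^ 2) wp_regular 0) (\<Lambda> - {0})"
    using D[of 1] by (simp add: eval_nat_numeral)
  then have "((\<lambda>\<omega>. 1 / \<omega> ^ 4) has_sum (deriv ^^ 2) wp_regular 0 / 6) (\<Lambda> - {0})"
    using has_sum_cmult_right[of _ _ _ "1 / 6"] by fastforce
  then show "(deriv ^^ 2) wp_regular 0 = g2 / 10"
    unfolding weierstrass_g2_def by (simp add: infsumI)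
  have "((\<lambda>\<omega>. 120 * (1 / \<omega> ^ 6)) has_sum (deriv ^^ 4) wp_regular 0) (\<Lambda> - {0})"
    using D[of 3] by (simp add: eval_nat_numeral)
  then have "((\<lambda>\<omega>. 1 / \<omega> ^ 6) has_sum (deriv ^^ 4) wp_regular 0 / 120) (\<Lambda> - {0})"
    using has_sum_cmult_right[of _ _ _ "1 / 120"] by fastforce
  then show "(deriv ^^ 4) wp_regular 0 = 6 / 7 * g3"
    unfolding weierstrass_g3_def by (simp add: infsumI)
qed

lemma wp_regular_taylor:
  "\<exists>\<rho>>0. \<exists>r. ball 0 \<rho> \<inter> \<Lambda> = {0} \<and> wp_regular holomorphic_on ball 0 \<rho> \<and> r holomorphic_on ball 0 \<rho> \<and>
    (\<forall>v\<in>ball 0 \<rho>. wp_regular v = g2 / 20 * v^2 + g3 / 28 * v^4 + v^5 * r v)"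
proof -
  obtain \<rho> where \<rho>: "\<rho> > 0" "\<And>\<omega>. \<omega> \<in> \<Lambda> - {0} \<Longrightarrow> \<rho> \<le> norm \<omega>"
    using lattice_min by blast
  have disj: "ball 0 \<rho> \<inter> \<Lambda> = {0}"
    using \<rho> zero_in_lattice by fastforce
  have hol: "wp_regular holomorphic_on ball 0 \<rho>"
    by (rule holomorphic_on_subset[OF wp_regular_holomorphic]) (use disj in blast)
  obtain r where r: "r holomorphic_on ball 0 \<rho>"
    "\<And>v. v \<in> ball 0 \<rho> \<Longrightarrow> wp_regular v = (\<Sum>k<5. (deriv ^^ k) wp_regular 0 / fact k * v ^ k) + v ^ 5 * r v"
    using holomorphic_taylor_remainder[OF hol \<rho>(1), of 5] by blast
  have "{..<5::nat} = {0, 1, 2, 3, 4}" by auto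
  then have "(\<Sum>k<5. (deriv ^^ k) wp_regular 0 / fact k * v ^ k) = g2 / 20 * v^2 + g3 / 28 * v^4" for v
    by (simp add: wp_regular_derivs_at_0 fact_numeral field_simps)
  with \<rho>(1) disj hol r show ?thesis
    by (intro exI[of _ \<rho>] conjI exI[of _ r]) auto
qed

lemma wp_derivs:
  assumes "v \<notin> \<Lambda>"
  shows "(wp has_field_derivative deriv wp v) (at v)"
    and "(deriv wp has_field_derivative deriv (deriv wp) v) (at v)"
    and "(deriv (deriv wp) has_field_derivative deriv (deriv (deriv wp)) v) (at v)"
  using assms wp_holomorphic open_off_lattice(1)
  by (auto intro!: holomorphic_derivI[of _ "- \<Lambda>"] holomorphic_deriv)

lemma wp_derivs_eq:
  assumes v: "v \<notin> \<Lambda>"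
  shows "deriv wp v = - 2 / v^3 + deriv wp_regular v"
    and "deriv (deriv wp) v = 6 / v^4 + deriv (deriv wp_regular) v"
proof -
  have nz: "v \<noteq> 0" if "v \<notin> \<Lambda>" for v using that zero_in_lattice by auto
  have sub: "- \<Lambda> \<subseteq> - (\<Lambda> - {0})" by blast
  have R: "(wp_regular has_field_derivative deriv wp_regular v) (at v)"
    "(deriv wp_regular has_field_derivative deriv (deriv wp_regular) v) (at v)" if "v \<notin> \<Lambda>" for v
    using that wp_regular_holomorphic open_off_lattice(2)
    by (auto intro!: holomorphic_derivI[of _ "- (\<Lambda> - {0})"] holomorphic_deriv)
  have D1: "((\<lambda>v. 1 / v^2) has_field_derivative - 2 / v^3) (at v)"
    "((\<lambda>v. - 2 / v^3) has_field_derivative 6 / v^4) (at v)" if "v \<noteq> 0" for v :: complex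
    using that by (auto intro!: derivative_eq_intros simp: field_simps eval_nat_numeral)
  have 1: "deriv wp v = - 2 / v^3 + deriv wp_regular v" if v: "v \<notin> \<Lambda>" for v
    using DERIV_add[OF D1(1)[OF nz[OF v]] R(1)[OF v]] by (simp add: wp_eq [abs_def] DERIV_imp_deriv)
  show "deriv wp v = - 2 / v^3 + deriv wp_regular v"
    by (rule 1[OF v])
  have "(deriv wp has_field_derivative 6 / v^4 + deriv (deriv wp_regular) v) (at v)"
    by (rule has_field_derivative_transform_within_open[OF DERIV_add[OF D1(2)[OF nz[OF v]] R(2)[OF v]] open_off_lattice(1)])
       (use v 1 in auto)
  then show "deriv (deriv wp) v = 6 / v^4 + deriv (deriv wp_regular) v"
    by (rule DERIV_imp_deriv)
qed

text \<open>The Taylor expansion of \<open>wp_regular\<close> up to order four, inserted into the equation: all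
negative powers of \<open>v\<close> and the constant term cancel by the choice of \<open>g2\<close> and \<open>g3\<close>.\<close>

lemma wp_ode_defect_tendsto_0:
  "((\<lambda>v. (deriv wp v)^2 - 4 * wp v ^ 3 + g2 * wp v + g3) \<longlongrightarrow> 0) (at 0)"
proof -
  obtain \<rho> r where \<rho>: "\<rho> > 0" "ball 0 \<rho> \<inter> \<Lambda> = {0}" and hol: "wp_regular holomorphic_on ball 0 \<rho>" "r holomorphic_on ball 0 \<rho>"
    and T: "\<And>v. v \<in> ball 0 \<rho> \<Longrightarrow> wp_regular v = g2 / 20 * v^2 + g3 / 28 * v^4 + v^5 * r v"
    using wp_regular_taylor by blast
  define a where "a = g2 / 20"
  define b where "b = g3 / 28"
  \<comment> \<open>\<open>v ^ 4 * s v\<close> is the derivative of \<open>v ^ 5 * r v\<close>; \<open>E\<close> is the defect after all cancellations.\<close>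
  define s where "s v = 5 * r v + v * deriv r v" for v
  define h where "h = wp_regular"
  define E where "E v = - 4 * (v * s v) + (deriv h v)^2 - 12 * (v * r v) - 12 * (v * (a + b * v^2 + v^3 * r v))^2 - 4 * (h v)^3 + 20 * a * h v" for v
  have h': "deriv h v = 2 * a * v + 4 * b * v^3 + v^4 * s v" if v: "v \<in> ball 0 \<rho>" for v
  proof (rule DERIV_imp_deriv, rule has_field_derivative_transform_within_open[OF _ open_ball v])
    have "(r has_field_derivative deriv r v) (at v)"
      using hol(2) v by (intro holomorphic_derivI) auto
    then show "((\<lambda>v. a * v^2 + b * v^4 + v^5 * r v) has_field_derivative 2 * a * v + 4 * b * v^3 + v^4 * s v) (at v)"
      unfolding s_def by (auto intro!: derivative_eq_intros simp: algebra_simps eval_nat_numeral)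
  qed (simp add: T h_def a_def b_def)
  have cont: "isCont g 0" if "g holomorphic_on ball 0 \<rho>" for g :: "complex \<Rightarrow> complex"
    using that \<rho>(1) by (meson centre_in_ball continuous_on_eq_continuous_at holomorphic_on_imp_continuous_on open_ball)
  have "isCont E 0"
    unfolding E_def s_def h_def
    by (intro continuous_intros cont hol holomorphic_deriv open_ball)
  moreover have "E 0 = 0"
    using wp_regular_derivs_at_0 by (simp add: E_def h_def)
  ultimately have "(E \<longlongrightarrow> 0) (at 0)"
    by (simp add: isCont_def)
  moreover have "\<forall>\<^sub>F v in at 0. E v = (deriv wp v)^2 - 4 * wp v ^ 3 + g2 * wp v + g3"
  proof -
    have "\<forall>\<^sub>F v in at 0. v \<in> ball 0 \<rho> - {0}"
      using \<rho>(1) by (intro eventually_at_in_open) auto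
    then show ?thesis
    proof eventually_elim
      case (elim v)
      then have v12: "v \<in> ball 0 \<rho>" "v \<noteq> 0" by auto
      have "v \<notin> \<Lambda>"
        using \<rho>(2) v12 by blast
      note v = v12 this
      define w where "w = 1 / v"
      have vw: "w * v = 1" using v by (simp add: w_def)
      have wp: "wp v = w^2 + h v" and wp': "deriv wp v = - 2 * w^3 + deriv h v"
        using wp_eq[of v] wp_derivs_eq(1)[OF v(3)] by (simp_all add: w_def h_def power_divide)
      have hv: "h v = a * v^2 + b * v^4 + v^5 * r v"
        using T[OF v(1)] by (simp add: h_def a_def b_def)
      have e1: "w^3 * deriv h v = 2 * a * w^2 + 4 * b + v * s v"
        unfolding h'[OF v(1)] w_def using v(2) by (simp add: field_simps eval_nat_numeral)
      have e2: "w^4 * h v = a * w^2 + b + v * r v"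
        unfolding hv w_def using v(2) by (simp add: field_simps eval_nat_numeral)
      have e3: "w * h v = v * (a + b * v^2 + v^3 * r v)"
        unfolding hv w_def using v(2) by (simp add: field_simps eval_nat_numeral)
      have "(deriv wp v)^2 - 4 * wp v ^ 3 + g2 * wp v + g3
          = - 4 * (w^3 * deriv h v) + (deriv h v)^2 - 12 * (w^4 * h v) - 12 * (w * h v)^2 - 4 * (h v)^3
            + 20 * a * w^2 + 20 * a * h v + 28 * b"
        unfolding wp wp' a_def b_def by (simp add: algebra_simps eval_nat_numeral)
      also have "\<dots> = E v"
        unfolding e1 e2 e3 E_def by (simp add: algebra_simps)
      finally show ?case by simp
    qed
  qed
  ultimately show ?thesis
    by (rule Lim_transform_eventually)
qed

lemma real_coordinates: "\<exists>x y :: real. z = of_real x * \<omega>1 + of_real y * \<omega>2"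
proof -
  define \<tau> where "\<tau> = \<omega>2 / \<omega>1"
  have w1: "\<omega>1 \<noteq> 0" using independent by auto
  have im: "Im \<tau> \<noteq> 0"
    using independent by (auto simp: \<tau>_def complex_is_Real_iff)
  define y where "y = Im (z / \<omega>1) / Im \<tau>"
  define x where "x = Re (z / \<omega>1) - y * Re \<tau>"
  have "z / \<omega>1 = of_real x + of_real y * \<tau>"
    using im by (simp add: complex_eq_iff x_def y_def)
  then have "z = (of_real x + of_real y * \<tau>) * \<omega>1"
    using w1 by (simp add: field_simps)
  then have "z = of_real x * \<omega>1 + of_real y * \<omega>2"
    using w1 by (simp add: \<tau>_def algebra_simps)
  then show ?thesis by blast
qed

lemma lattice_translate_to_compact:
  obtains K where "compact K" "\<And>z. \<exists>\<omega>\<in>\<Lambda>. z + \<omega> \<in> K"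
proof
  define K where "K = (\<lambda>p :: real \<times> real. of_real (fst p) * \<omega>1 + of_real (snd p) * \<omega>2) ` ({0..1} \<times> {0..1})"
  show "compact K"
    unfolding K_def by (intro compact_continuous_image continuous_intros compact_Times compact_Icc)
  fix z
  obtain x y :: real where z: "z = of_real x * \<omega>1 + of_real y * \<omega>2"
    using real_coordinates by blast
  have "z + (of_int (- \<lfloor>x\<rfloor>) * \<omega>1 + of_int (- \<lfloor>y\<rfloor>) * \<omega>2) = of_real (frac x) * \<omega>1 + of_real (frac y) * \<omega>2"
    by (simp add: z frac_def algebra_simps)
  also have "\<dots> \<in> K"
    unfolding K_def
    by (rule image_eqI[of _ _ "(frac x, frac y)"]) (auto simp: frac_ge_0 less_imp_le[OF frac_lt_1])
  finally show "\<exists>\<omega>\<in>\<Lambda>. z + \<omega> \<in> K"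
    using lattice_pointI by blast
qed

text \<open>By periodicity the removable singularity at \<open>0\<close> is removable at every lattice point. The extended
function takes all its values on a period parallelogram, so it is bounded and Liouville's theorem
applies.\<close>

lemma elliptic_without_poles_constant:
  assumes f: "f holomorphic_on - \<Lambda>"
    and per: "\<And>v \<omega>. v \<notin> \<Lambda> \<Longrightarrow> \<omega> \<in> \<Lambda> \<Longrightarrow> f (v + \<omega>) = f v"
    and lim: "(f \<longlongrightarrow> c) (at 0)" and v: "v \<notin> \<Lambda>"
  shows "f v = c"
proof -
  define g where "g z = (if z \<in> \<Lambda> then c else f z)" for z
  have per_g: "g (z + \<omega>) = g z" if "\<omega> \<in> \<Lambda>" for z \<omega>
    using per[of z \<omega>] that lattice_add_iff[OF that] by (simp add: g_def)
  have g_off: "g holomorphic_on - \<Lambda>"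
    using f by (rule holomorphic_transform) (simp add: g_def)
  obtain \<rho> where \<rho>: "\<rho> > 0" "\<And>\<omega>. \<omega> \<in> \<Lambda> - {0} \<Longrightarrow> \<rho> \<le> norm \<omega>"
    using lattice_min by blast
  have disj: "z \<notin> \<Lambda>" if "z \<in> ball 0 \<rho> - {0}" for z
    using \<rho>(2)[of z] that by auto
  have "g holomorphic_on ball 0 \<rho>"
  proof (rule no_isolated_singularity'[of "{0}"])
    show "g holomorphic_on ball 0 \<rho> - {0}"
      by (rule holomorphic_on_subset[OF g_off]) (use disj in blast)
    have "\<forall>\<^sub>F z in at 0. z \<in> ball 0 \<rho> - {0}"
      using \<rho>(1) by (intro eventually_at_in_open) auto
    then have "\<forall>\<^sub>F z in at 0. f z = g z"
      by (rule eventually_mono) (use disj in \<open>simp add: g_def\<close>)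
    then have "(g \<longlongrightarrow> c) (at 0)"
      by (rule Lim_transform_eventually[OF lim])
    moreover have "g 0 = c"
      using zero_in_lattice by (simp add: g_def)
    ultimately show "(g \<longlongrightarrow> g z) (at z within ball 0 \<rho>)" if "z \<in> {0}" for z
      using that by (simp add: Lim_at_imp_Lim_at_within)
  qed auto
  then have D0: "g field_differentiable at 0"
    by (rule holomorphic_on_imp_differentiable_at) (use \<rho> in auto)
  have "g field_differentiable at z" for z
  proof (cases "z \<in> \<Lambda>")
    case False
    then show ?thesis
      by (intro holomorphic_on_imp_differentiable_at[OF g_off open_off_lattice(1)]) simp
  next
    case True
    obtain D where "(g has_field_derivative D) (at (z + - z))"
      using D0 by (auto simp: field_differentiable_def)
    then have "((\<lambda>u. g (u + - z)) has_field_derivative D) (at z)"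
      by (simp only: DERIV_shift)
    then have "(g has_field_derivative D) (at z)"
      using per_g[OF lattice_minus[OF True]] by simp
    then show ?thesis
      by (auto simp: field_differentiable_def)
  qed
  then have hol: "g holomorphic_on UNIV"
    by (simp add: holomorphic_on_def)
  obtain K where K: "compact K" "\<And>z. \<exists>\<omega>\<in>\<Lambda>. z + \<omega> \<in> K"
    using lattice_translate_to_compact by blast
  have "g z \<in> g ` K" for z
    using K(2)[of z] per_g by (metis image_eqI)
  moreover have "bounded (g ` K)"
    using K(1) hol by (intro compact_imp_bounded compact_continuous_image)
      (auto intro: continuous_on_subset holomorphic_on_imp_continuous_on)
  ultimately have "bounded (range g)"
    by (meson bounded_subset image_subset_iff)
  then have "g constant_on UNIV"
    by (rule Liouville_theorem[OF hol])
  then have "g v = g 0"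
    by (auto simp: constant_on_def)
  then show ?thesis
    using v zero_in_lattice by (simp add: g_def)
qed

theorem wp_differential_equation:
  assumes "v \<notin> \<Lambda>"
  shows "(deriv wp v)^2 = 4 * wp v ^ 3 - g2 * wp v - g3"
proof -
  have "(\<lambda>v. (deriv wp v)^2 - 4 * wp v ^ 3 + g2 * wp v + g3) holomorphic_on - \<Lambda>"
    by (intro holomorphic_intros holomorphic_deriv wp_holomorphic open_off_lattice)
  then have "(deriv wp v)^2 - 4 * wp v ^ 3 + g2 * wp v + g3 = 0"
    using elliptic_without_poles_constant[OF _ _ wp_ode_defect_tendsto_0 assms]
    by (simp add: wp_periodic wp_deriv_periodic)
  then show ?thesis by (simp add: algebra_simps)
qed

text \<open>Differentiate the first-order equation and cancel \<open>\<wp>'\<close>.\<close>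

lemma wp_deriv2:
  assumes v: "v \<notin> \<Lambda>" and nz: "deriv wp v \<noteq> 0"
  shows "deriv (deriv wp) v = 6 * wp v ^ 2 - g2 / 2"
proof -
  note D = wp_derivs[OF v]
  have "((\<lambda>v. (deriv wp v)^2) has_field_derivative 2 * deriv wp v * deriv (deriv wp) v) (at v)"
    by (rule derivative_eq_intros D refl)+ simp
  moreover have "((\<lambda>v. (deriv wp v)^2) has_field_derivative (12 * wp v ^ 2 - g2) * deriv wp v) (at v)"
  proof (rule has_field_derivative_transform_within_open[OF _ open_off_lattice(1)])
    show "((\<lambda>v. 4 * wp v ^ 3 - g2 * wp v - g3) has_field_derivative (12 * wp v ^ 2 - g2) * deriv wp v) (at v)"
      by (rule derivative_eq_intros D refl)+ (simp add: algebra_simps)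
  qed (use v wp_differential_equation in auto)
  ultimately have "2 * deriv wp v * deriv (deriv wp) v = (12 * wp v ^ 2 - g2) * deriv wp v"
    by (rule DERIV_unique)
  then have "deriv wp v * (2 * deriv (deriv wp) v - (12 * wp v ^ 2 - g2)) = 0"
    by (simp add: algebra_simps)
  then have "2 * deriv (deriv wp) v - (12 * wp v ^ 2 - g2) = 0"
    using nz mult_eq_0_iff by blast
  then show ?thesis
    by (simp add: field_simps)
qed

lemma wp_deriv3:
  assumes v: "v \<notin> \<Lambda>" and nz: "deriv wp v \<noteq> 0"
  shows "deriv (deriv (deriv wp)) v = 12 * wp v * deriv wp v"
proof -
  note D = wp_derivs[OF v]
  have "continuous_on (- \<Lambda>) (deriv wp)"
    by (intro holomorphic_on_imp_continuous_on holomorphic_deriv wp_holomorphic open_off_lattice)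
  then have "open (- \<Lambda> \<inter> deriv wp -` (- {0}))"
    by (intro continuous_open_preimage open_off_lattice) auto
  then have "(deriv (deriv wp) has_field_derivative 12 * wp v * deriv wp v) (at v)"
  proof (rule has_field_derivative_transform_within_open[rotated])
    show "((\<lambda>v. 6 * wp v ^ 2 - g2 / 2) has_field_derivative 12 * wp v * deriv wp v) (at v)"
      by (rule derivative_eq_intros D refl)+ simp
    show "6 * wp z ^ 2 - g2 / 2 = deriv (deriv wp) z" if "z \<in> - \<Lambda> \<inter> deriv wp -` (- {0})" for z
      using wp_deriv2[of z] that by auto
  qed (use v nz in auto)
  then show ?thesis by (rule DERIV_imp_deriv)
qed

text \<open>Half of \<open>\<wp>''/\<wp>'\<close>, the slope of the tangent to the cubic \<open>Y\<^sup>2 = 4 X\<^sup>3 - g2 X - g3\<close> at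
\<open>(\<wp>(v), \<wp>'(v))\<close>. The tangent meets the cubic again at a point with abscissa \<open>doubled v\<close>.\<close>

definition half_slope :: "complex \<Rightarrow> complex" where
  "half_slope v = deriv (deriv wp) v / (2 * deriv wp v)"

definition doubled :: "complex \<Rightarrow> complex" where
  "doubled v = half_slope v ^ 2 - 2 * wp v"

lemma doubled_has_derivative:
  assumes v: "v \<notin> \<Lambda>" and nz: "deriv wp v \<noteq> 0"
  shows "(doubled has_field_derivative
    - 2 * deriv wp v + 12 * wp v * half_slope v - 4 * half_slope v ^ 3) (at v)"
proof -
  note D = wp_derivs[OF v]
  define X P Y where "X = wp v" and "P = deriv wp v" and "Y = deriv (deriv wp) v"
  have D3: "deriv (deriv (deriv wp)) v = 12 * X * P"
    using wp_deriv3[OF v nz] by (simp add: X_def P_def)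
  have "(half_slope has_field_derivative (12 * X * P * (2 * P) - Y * (2 * Y)) / (2 * P * (2 * P))) (at v)"
    unfolding half_slope_def [abs_def] using nz D3
    by (auto intro!: derivative_eq_intros D simp: X_def P_def Y_def)
  also have "(12 * X * P * (2 * P) - Y * (2 * Y)) / (2 * P * (2 * P)) = 6 * X - 2 * half_slope v ^ 2"
    using nz by (simp add: half_slope_def X_def P_def Y_def field_simps power2_eq_square)
  finally have "(half_slope has_field_derivative 6 * X - 2 * half_slope v ^ 2) (at v)" .
  then have "((\<lambda>v. half_slope v ^ 2 - 2 * wp v) has_field_derivative
      2 * half_slope v * (6 * X - 2 * half_slope v ^ 2) - 2 * P) (at v)"
    unfolding P_def by (auto intro!: derivative_eq_intros D)
  then show ?thesis
    by (simp add: doubled_def [abs_def] X_def P_def algebra_simps eval_nat_numeral)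
qed

text \<open>Together with \<open>doubled_has_derivative\<close> this says that \<open>u \<mapsto> doubled (u / 2)\<close> satisfies the
differential equation of \<open>\<wp>\<close>; the factor \<open>4\<close> comes from the argument \<open>u / 2\<close>.\<close>

lemma doubled_ode:
  assumes v: "v \<notin> \<Lambda>" and nz: "deriv wp v \<noteq> 0"
  shows "(- 2 * deriv wp v + 12 * wp v * half_slope v - 4 * half_slope v ^ 3)^2
    = 4 * (4 * doubled v ^ 3 - g2 * doubled v - g3)"
proof -
  define X P q where "X = wp v" and "P = deriv wp v" and "q = half_slope v"
  have PP: "P * P = 4 * X^3 - g2 * X - g3"
    using wp_differential_equation[OF v] by (simp add: X_def P_def power2_eq_square)
  have Pq: "P * q = 3 * X^2 - g2 / 4"
    using wp_deriv2[OF v nz] nz by (simp add: X_def P_def q_def half_slope_def field_simps)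
  have "(- 2 * P + 12 * X * q - 4 * q ^ 3)^2
      = 4 * (P * P) - 48 * X * (P * q) + 16 * (P * q) * q^2 + (12 * X * q - 4 * q^3)^2"
    by (simp add: algebra_simps eval_nat_numeral)
  also have "\<dots> = 4 * (4 * (q^2 - 2 * X) ^ 3 - g2 * (q^2 - 2 * X) - g3)"
    unfolding PP Pq by (simp add: algebra_simps eval_nat_numeral)
  finally show ?thesis
    by (simp add: X_def P_def q_def doubled_def)
qed

text \<open>What remains of \<open>doubled v\<close> after its principal part \<open>1 / (2 v)\<^sup>2\<close> is removed. The bracket is
\<open>((6 + v\<^sup>4 h2)\<^sup>2 - 9 (2 - v\<^sup>3 h1)\<^sup>2) / v\<^sup>3\<close>, a polynomial in \<open>v\<close>, \<open>h1\<close> and \<open>h2\<close>. Hence the expression is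
holomorphic near \<open>0\<close>.\<close>

definition doubled_correction :: "complex \<Rightarrow> complex" where
  "doubled_correction v = (let h = wp_regular v; h1 = deriv wp_regular v; h2 = deriv (deriv wp_regular) v in
     - 2 * h + v / 4 * (12 * v * h2 + v^5 * h2^2 + 36 * h1 - 9 * v^3 * h1^2) / (2 - v^3 * h1)^2)"

text \<open>Near \<open>0\<close> the denominators of \<open>half_slope\<close> and \<open>doubled_correction\<close> do not vanish, because
\<open>- v\<^sup>3 \<wp>'(v) = 2 - v\<^sup>3 h1\<close> tends to \<open>2\<close>.\<close>

lemma wp_deriv_near_0:
  "\<exists>\<rho>>0. ball 0 \<rho> \<inter> \<Lambda> = {0} \<and> wp_regular holomorphic_on ball 0 \<rho> \<and>
    (\<forall>v\<in>ball 0 \<rho>. 2 - v^3 * deriv wp_regular v \<noteq> 0) \<and> (\<forall>v\<in>ball 0 \<rho> - {0}. deriv wp v \<noteq> 0)"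
proof -
  obtain \<rho>1 where \<rho>1: "\<rho>1 > 0" "ball 0 \<rho>1 \<inter> \<Lambda> = {0}" "wp_regular holomorphic_on ball 0 \<rho>1"
    using wp_regular_taylor by blast
  have "isCont (deriv wp_regular) 0"
    using holomorphic_deriv[OF \<rho>1(3) open_ball] \<rho>1(1)
    by (meson centre_in_ball continuous_on_eq_continuous_at holomorphic_on_imp_continuous_on open_ball)
  then have "isCont (\<lambda>v. 2 - v^3 * deriv wp_regular v) 0"
    by (intro continuous_intros)
  then have "\<exists>e>0. \<forall>v. dist 0 v < e \<longrightarrow> 2 - v^3 * deriv wp_regular v \<noteq> 0"
    by (rule continuous_at_avoid) simp
  then obtain e where e: "e > 0" "\<And>v. dist 0 v < e \<Longrightarrow> 2 - v^3 * deriv wp_regular v \<noteq> 0"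
    by blast
  define \<rho> where "\<rho> = min \<rho>1 e"
  have \<rho>: "\<rho> > 0" "ball 0 \<rho> \<subseteq> ball (0 :: complex) \<rho>1"
    using \<rho>1 e by (auto simp: \<rho>_def)
  have 1: "2 - v^3 * deriv wp_regular v \<noteq> 0" if "v \<in> ball 0 \<rho>" for v
    using e(2)[of v] that by (simp add: \<rho>_def)
  have "deriv wp v \<noteq> 0" if v: "v \<in> ball 0 \<rho> - {0}" for v
  proof -
    have "v \<notin> \<Lambda>" using v \<rho> \<rho>1(2) by blast
    then have "deriv wp v * v^3 = - (2 - v^3 * deriv wp_regular v)"
      using wp_derivs_eq(1)[of v] v by (simp add: field_simps)
    then show ?thesis
      using 1[of v] v by auto
  qed
  moreover have "ball 0 \<rho> \<inter> \<Lambda> = {0}"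
    using \<rho> \<rho>1(2) zero_in_lattice by auto
  moreover have "wp_regular holomorphic_on ball 0 \<rho>"
    using \<rho>1(3) \<rho>(2) by (rule holomorphic_on_subset)
  ultimately show ?thesis
    using \<rho>(1) 1 by blast
qed

lemma doubled_principal_part:
  assumes v: "v \<notin> \<Lambda>" and nz: "2 - v^3 * deriv wp_regular v \<noteq> 0"
  shows "doubled v = 1 / (2 * v)^2 + doubled_correction v"
proof -
  have v0: "v \<noteq> 0" using v zero_in_lattice by auto
  define h h1 h2 where "h = wp_regular v" and "h1 = deriv wp_regular v" and "h2 = deriv (deriv wp_regular) v"
  define D where "D = 2 - v^3 * h1"
  define E where "E = 12 * v * h2 + v^5 * h2^2 + 36 * h1 - 9 * v^3 * h1^2"
  have D0: "D \<noteq> 0" using nz by (simp add: D_def h1_def)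
  have P: "deriv wp v = - D / v^3"
    using wp_derivs_eq(1)[OF v] v0 by (simp add: D_def h1_def field_simps)
  have Y: "deriv (deriv wp) v = (6 + v^4 * h2) / v^4"
    using wp_derivs_eq(2)[OF v] v0 by (simp add: h2_def field_simps)
  have hs: "half_slope v = - (6 + v^4 * h2) / (2 * v * D)"
    unfolding half_slope_def P Y using v0 D0 by (simp add: field_simps eval_nat_numeral)
  have sq: "(6 + v^4 * h2)^2 = 9 * D^2 + v^3 * E"
    by (simp add: D_def E_def algebra_simps eval_nat_numeral)
  have "half_slope v ^ 2 = (6 + v^4 * h2)^2 / (2 * v * D)^2"
    unfolding hs by (simp only: power_divide power2_minus)
  also have "\<dots> = 9 / (4 * v^2) + v / 4 * E / D^2"
    unfolding sq using v0 D0 by (simp add: field_simps eval_nat_numeral)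
  finally have hs2: "half_slope v ^ 2 = 9 / (4 * v^2) + v / 4 * E / D^2" .
  have "doubled v = 9 / (4 * v^2) + v / 4 * E / D^2 - 2 * (1 / v^2 + h)"
    unfolding doubled_def hs2 wp_eq h_def ..
  also have "\<dots> = 1 / (2 * v)^2 + (- 2 * h + v / 4 * E / D^2)"
    using v0 by (simp add: field_simps)
  finally show ?thesis
    by (simp add: doubled_correction_def Let_def h_def h1_def h2_def D_def E_def)
qed

text \<open>Let \<open>1 / u\<^sup>2 + k\<close> and \<open>1 / u\<^sup>2 + h\<close> be the expansions of \<open>doubled (u / 2)\<close> and \<open>\<wp>(u)\<close>. Subtracting
their first-order equations and multiplying by \<open>u\<^sup>4\<close> gives a linear homogeneous equation for
\<open>d = k - h\<close> of the form treated in \<open>vanishes_by_initial_exponents\<close>. This replaces an analysis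
of the poles of the duplication formula at all half-periods.\<close>

lemma wp_double_near_0:
  "\<exists>\<rho>>0. \<forall>v\<in>ball 0 \<rho> - {0}. 2 * v \<notin> \<Lambda> \<and> v \<notin> \<Lambda> \<and> deriv wp v \<noteq> 0 \<and> wp (2 * v) = doubled v"
proof -
  obtain \<rho> where \<rho>: "\<rho> > 0" "ball 0 \<rho> \<inter> \<Lambda> = {0}" "wp_regular holomorphic_on ball 0 \<rho>"
    and D: "\<And>v. v \<in> ball 0 \<rho> \<Longrightarrow> 2 - v^3 * deriv wp_regular v \<noteq> 0"
    and P: "\<And>v. v \<in> ball 0 \<rho> - {0} \<Longrightarrow> deriv wp v \<noteq> 0"
    using wp_deriv_near_0 by blast
  define k where "k u = doubled_correction (u / 2)" for u
  define h where "h = wp_regular"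
  have off: "u \<notin> \<Lambda>" if "u \<in> ball 0 \<rho>" "u \<noteq> 0" for u
    using \<rho>(2) that by blast
  have half: "u / 2 \<in> ball 0 \<rho>" if "u \<in> ball 0 \<rho>" for u :: complex
    using that \<rho>(1) by simp
  have "doubled_correction holomorphic_on ball 0 \<rho>"
    unfolding doubled_correction_def [abs_def] Let_def
    by (intro holomorphic_intros holomorphic_deriv \<rho>(3) open_ball) (use D in auto)
  moreover have "(\<lambda>u. u / 2) holomorphic_on ball 0 \<rho>" "(\<lambda>u. u / 2) ` ball 0 \<rho> \<subseteq> ball (0 :: complex) \<rho>"
    using half by (auto intro!: holomorphic_intros)
  ultimately have holk: "k holomorphic_on ball 0 \<rho>"
    unfolding k_def using holomorphic_on_compose_gen[of "\<lambda>u. u / 2" "ball 0 \<rho>" doubled_correction "ball 0 \<rho>"]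
    by (simp add: o_def)
  have holh: "h holomorphic_on ball 0 \<rho>"
    using \<rho>(3) by (simp add: h_def)
  define A where "A u = - 4 + u^3 * (deriv k u + deriv h u)" for u
  define B where "B u = 4 * ((1 + u^2 * k u)^2 + (1 + u^2 * k u) * (1 + u^2 * h u) + (1 + u^2 * h u)^2) - g2 * u^4" for u
  have cont: "isCont g 0" if "g holomorphic_on ball 0 \<rho>" for g :: "complex \<Rightarrow> complex"
    using that \<rho>(1) by (meson centre_in_ball continuous_on_eq_continuous_at holomorphic_on_imp_continuous_on open_ball)
  have "k u - h u = 0" if u: "u \<in> ball 0 \<rho>" for u
  proof (rule vanishes_by_initial_exponents[of "\<lambda>u. k u - h u" \<rho> A B])
    show "(\<lambda>u. k u - h u) holomorphic_on ball 0 \<rho>"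
      by (intro holomorphic_intros holk holh)
    show "isCont A 0" "isCont B 0"
      unfolding A_def B_def
      by (intro continuous_intros cont holk holh holomorphic_deriv open_ball)+
    show "A 0 = - 4" "B 0 = 12"
      by (simp_all add: A_def B_def)
    fix u :: complex assume u: "u \<in> ball 0 \<rho>" "u \<noteq> 0"
    \<comment> \<open>Powers of \<open>w = 1 / u\<close> turn the remaining identities into polynomial ones.\<close>
    define w where "w = 1 / u"
    have wu: "w * u = 1" using u by (simp add: w_def)
    have v: "u / 2 \<in> ball 0 \<rho> - {0}" "u / 2 \<notin> \<Lambda>" "deriv wp (u / 2) \<noteq> 0"
      using half[OF u(1)] u off[of "u / 2"] P[of "u / 2"] by auto
    have Dk: "(k has_field_derivative deriv k u) (at u)" and Dh: "(h has_field_derivative deriv h u) (at u)"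
      using u by (auto intro: holomorphic_derivI[OF holk] holomorphic_derivI[OF holh])
    have val: "doubled (u / 2) = w^2 + k u"
      using doubled_principal_part[OF v(2) D] v(1) by (simp add: k_def w_def power_divide)
    have val': "wp u = w^2 + h u"
      by (simp add: wp_eq h_def w_def power_divide)
    define q where "q = - 2 * deriv wp (u / 2) + 12 * wp (u / 2) * half_slope (u / 2) - 4 * half_slope (u / 2) ^ 3"
    have "(doubled has_field_derivative q) (at (u / 2))"
      unfolding q_def by (rule doubled_has_derivative[OF v(2,3)])
    then have "((\<lambda>u. doubled (u / 2)) has_field_derivative q * (1 / 2)) (at u)"
      by (rule DERIV_chain2) (auto intro!: derivative_eq_intros)
    moreover have "((\<lambda>u. doubled (u / 2)) has_field_derivative - 2 * w^3 + deriv k u) (at u)"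
    proof (rule has_field_derivative_transform_within_open)
      have "((\<lambda>u. 1 / u^2) has_field_derivative - 2 * w^3) (at u)"
        using u by (auto intro!: derivative_eq_intros simp: w_def field_simps eval_nat_numeral)
      then show "((\<lambda>u. 1 / u^2 + k u) has_field_derivative - 2 * w^3 + deriv k u) (at u)"
        by (rule DERIV_add[OF _ Dk])
      show "open (ball 0 \<rho> - {0} :: complex set)" by auto
      show "1 / z^2 + k z = doubled (z / 2)" if "z \<in> ball 0 \<rho> - {0}" for z
        using doubled_principal_part[of "z / 2"] D[OF half[of z]] off[of "z / 2"] half[of z] that
        by (simp add: k_def power_divide)
    qed (use u in auto)
    ultimately have q: "q * (1 / 2) = - 2 * w^3 + deriv k u"
      by (rule DERIV_unique)
    have ode1: "(- 2 * w^3 + deriv k u)^2 = 4 * (w^2 + k u)^3 - g2 * (w^2 + k u) - g3"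
    proof -
      have "(- 2 * w^3 + deriv k u)^2 = (1 / 4) * (q^2)"
        unfolding q [symmetric] by (simp add: power2_eq_square)
      also have "q^2 = 4 * (4 * (w^2 + k u)^3 - g2 * (w^2 + k u) - g3)"
        unfolding q_def doubled_ode[OF v(2,3)] val ..
      also have "1 / 4 * (4 * z) = z" for z :: complex
        by simp
      finally show ?thesis .
    qed
    have ode2: "(- 2 * w^3 + deriv h u)^2 = 4 * (w^2 + h u)^3 - g2 * (w^2 + h u) - g3"
    proof -
      have "deriv wp u = - 2 * w^3 + deriv h u"
        using wp_derivs_eq(1)[OF off[OF u]] by (simp add: w_def h_def power_divide)
      then show ?thesis
        using wp_differential_equation[OF off[OF u]] by (simp add: val')
    qed
    have "(deriv k u - deriv h u) * (- 4 * w^3 + (deriv k u + deriv h u))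
        = (- 2 * w^3 + deriv k u)^2 - (- 2 * w^3 + deriv h u)^2"
      by (simp add: algebra_simps power2_eq_square)
    also have "\<dots> = (k u - h u) * (4 * ((w^2 + k u)^2 + (w^2 + k u) * (w^2 + h u) + (w^2 + h u)^2) - g2)"
      unfolding ode1 ode2 by (simp add: algebra_simps eval_nat_numeral)
    finally have main: "(deriv k u - deriv h u) * (- 4 * w^3 + (deriv k u + deriv h u))
        = (k u - h u) * (4 * ((w^2 + k u)^2 + (w^2 + k u) * (w^2 + h u) + (w^2 + h u)^2) - g2)" .
    have A: "A u = u^3 * (- 4 * w^3 + (deriv k u + deriv h u))"
      using u by (simp add: A_def w_def field_simps)
    have B: "B u = u^4 * (4 * ((w^2 + k u)^2 + (w^2 + k u) * (w^2 + h u) + (w^2 + h u)^2) - g2)"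
    proof -
      have 1: "1 + u^2 * z = u^2 * (w^2 + z)" for z
        using u by (simp add: w_def field_simps)
      show ?thesis
        unfolding B_def 1 by (simp add: algebra_simps eval_nat_numeral)
    qed
    have dd: "deriv (\<lambda>u. k u - h u) u = deriv k u - deriv h u"
      by (rule DERIV_imp_deriv[OF DERIV_diff[OF Dk Dh]])
    have "u * deriv (\<lambda>u. k u - h u) u * A u
        = u^4 * ((deriv k u - deriv h u) * (- 4 * w^3 + (deriv k u + deriv h u)))"
      unfolding A dd by (simp add: algebra_simps eval_nat_numeral)
    also have "\<dots> = (k u - h u) * B u"
      unfolding main B by (simp add: mult_ac)
    finally show "u * deriv (\<lambda>u. k u - h u) u * A u = (k u - h u) * B u" .
  qed (use u \<rho> in auto)
  then have kh: "k u = h u" if "u \<in> ball 0 \<rho>" for u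
    using that by simp
  have "2 * v \<notin> \<Lambda> \<and> v \<notin> \<Lambda> \<and> deriv wp v \<noteq> 0 \<and> wp (2 * v) = doubled v" if v: "v \<in> ball 0 (\<rho> / 2) - {0}" for v
  proof -
    have v': "v \<in> ball 0 \<rho>" "v \<noteq> 0" "2 * v \<in> ball 0 \<rho>"
      using v norm_ge_zero[of v] by (auto simp: norm_mult simp del: norm_ge_zero)
    have "wp (2 * v) = 1 / (2 * v)^2 + k (2 * v)"
      using kh[OF v'(3)] by (simp add: wp_eq h_def)
    also have "\<dots> = doubled v"
      using doubled_principal_part[OF off[OF v'(1,2)] D[OF v'(1)]] by (simp add: k_def)
    finally show ?thesis
      using off[OF v'(1,2)] off[OF v'(3)] v'(2) P[of v] v'(1) by auto
  qed
  then show ?thesis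
    using \<rho>(1) by (intro exI[of _ "\<rho> / 2"]) auto
qed

text \<open>Multiplied by \<open>4 \<wp>'\<^sup>2\<close>, the formula is an identity between functions holomorphic off the half-lattice,
whose complement is connected; near \<open>0\<close> it is known.\<close>

theorem wp_duplication:
  assumes v: "2 * v \<notin> \<Lambda>" and nz: "deriv wp v \<noteq> 0"
  shows "wp (2 * v) = (deriv (deriv wp) v / (2 * deriv wp v))^2 - 2 * wp v"
proof -
  define S where "S = (\<lambda>\<omega>. \<omega> / 2) ` \<Lambda>"
  have S: "v \<in> S \<longleftrightarrow> 2 * v \<in> \<Lambda>" for v
  proof
    assume "v \<in> S"
    then obtain \<omega> where "\<omega> \<in> \<Lambda>" "v = \<omega> / 2"
      by (auto simp only: S_def)
    moreover have "2 * (\<omega> / 2) = \<omega>" by simp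
    ultimately show "2 * v \<in> \<Lambda>" by (simp only:)
  next
    assume "2 * v \<in> \<Lambda>"
    then show "v \<in> S"
      unfolding S_def by (intro image_eqI[of _ _ "2 * v"]) simp
  qed
  have "- S = (\<lambda>v. 2 * v) -` (- \<Lambda>)"
    using S by auto
  then have opS: "open (- S)"
    by (simp add: open_off_lattice(1) open_vimage continuous_intros)
  have conS: "connected (- S)"
    unfolding S_def by (intro connected_off_countable countable_image countable_lattice)
  have sub: "- S \<subseteq> - \<Lambda>"
  proof (rule subsetI)
    fix v assume "v \<in> - S"
    then have "2 * v \<notin> \<Lambda>"
      using S[of v] by blast
    then show "v \<in> - \<Lambda>"
      using lattice_add[of v v] unfolding mult_2 by blast
  qed
  define G where "G v = 4 * (deriv wp v)^2 * (wp (2 * v) + 2 * wp v) - (deriv (deriv wp) v)^2" for v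
  have hol2: "(\<lambda>v. wp (2 * v)) holomorphic_on - S"
    using holomorphic_on_compose_gen[of "\<lambda>v. 2 * v" "- S" wp "- \<Lambda>"] wp_holomorphic S
    by (auto simp: o_def intro!: holomorphic_intros)
  have hol: "G holomorphic_on - S"
    unfolding G_def
    by (intro holomorphic_intros hol2 holomorphic_on_subset[OF _ sub] holomorphic_deriv wp_holomorphic open_off_lattice)
  obtain \<rho> where \<rho>: "\<rho> > 0" and near: "\<And>v. v \<in> ball 0 \<rho> - {0} \<Longrightarrow>
      2 * v \<notin> \<Lambda> \<and> v \<notin> \<Lambda> \<and> deriv wp v \<noteq> 0 \<and> wp (2 * v) = doubled v"
    using wp_double_near_0 by blast
  have "G v = 0"
  proof (rule analytic_continuation_open[of "ball 0 \<rho> - {0}" "- S" G "\<lambda>_. 0"])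
    have "of_real (\<rho> / 2) \<in> ball 0 \<rho> - {0 :: complex}"
      using \<rho> by simp
    then show "ball 0 \<rho> - {0 :: complex} \<noteq> {}" by blast
    show "ball 0 \<rho> - {0} \<subseteq> - S"
      using near S by blast
    show "G z = 0" if "z \<in> ball 0 \<rho> - {0}" for z
      using near[OF that] by (simp add: G_def doubled_def half_slope_def field_simps)
  qed (use hol opS conS S v in auto)
  then have "wp (2 * v) + 2 * wp v = (deriv (deriv wp) v)^2 / (4 * (deriv wp v)^2)"
    using nz by (simp add: G_def field_simps)
  then show ?thesis
    by (simp add: power_divide power_mult_distrib algebra_simps)
qed

section \<open>The Halphen substitution\<close>

text \<open>The chain rule, applied to \<open>y(2 v) = \<wp>'(v)\<^sup>-\<^sup>n z(\<wp>(v))\<close>. The duplication formula turns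
\<open>n (n + 1) \<wp>(2 v)\<close> into \<open>n (n + 1) (\<wp>''/\<wp>')\<^sup>2 / 4\<close> and a multiple of \<open>\<wp>(v)\<close>. The first term
cancels against the second derivative of the factor \<open>\<wp>'\<^sup>-\<^sup>n\<close>, and the rest is a polynomial in
\<open>\<wp>(v)\<close>.\<close>

lemma halphen_substitution_pointwise:
  fixes l y z :: "complex \<Rightarrow> complex" and n H :: complex
  assumes V: "open V" "\<And>v. v \<in> V \<Longrightarrow> 2 * v \<notin> \<Lambda>"
    and l: "l holomorphic_on V" "\<And>v. v \<in> V \<Longrightarrow> exp (l v) = deriv wp v"
    and z: "z holomorphic_on wp ` V"
    and y: "\<And>v. v \<in> V \<Longrightarrow> y (2 * v) = exp (- n * l v) * z (wp v)"
  shows "y holomorphic_on (\<lambda>v. 2 * v) ` V"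
    and "v \<in> V \<Longrightarrow> (deriv ^^ 2) y (2 * v) - (n * (n + 1) * wp (2 * v) - H) * y (2 * v)
      = exp (- n * l v) / 4 * ((4 * wp v ^ 3 - g2 * wp v - g3) * (deriv ^^ 2) z (wp v)
          + (1/2 - n) * (12 * wp v ^ 2 - g2) * deriv z (wp v) + 4 * (n * (2 * n - 1) * wp v + H) * z (wp v))"
proof -
  have off: "v \<notin> \<Lambda>" if "v \<in> V" for v
    using V(2)[OF that] lattice_add[of v v] unfolding mult_2 by blast
  have nz: "deriv wp v \<noteq> 0" if "v \<in> V" for v
    using l(2)[OF that] exp_not_eq_zero by metis
  \<comment> \<open>The derivatives of \<open>z\<close> make sense because \<open>\<wp>\<close> is locally injective on \<open>V\<close>, hence open.\<close>
  have open_image: "open (wp ` V)"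
  proof -
    have holV: "wp holomorphic_on V"
      by (rule holomorphic_on_subset[OF wp_holomorphic]) (use off in blast)
    have "\<exists>r>0. ball v r \<subseteq> V \<and> open (wp ` ball v r)" if v: "v \<in> V" for v
    proof -
      obtain r where r: "r > 0" "ball v r \<subseteq> V" "inj_on wp (ball v r)"
        using has_complex_derivative_locally_injective[OF holV v V(1) nz[OF v]] by blast
      have "open (wp ` ball v r)"
        by (rule open_mapping_thm3[OF holomorphic_on_subset[OF holV r(2)] open_ball r(3)])
      with r show ?thesis by blast
    qed
    then obtain r where r: "\<And>v. v \<in> V \<Longrightarrow> r v > 0 \<and> ball v (r v) \<subseteq> V \<and> open (wp ` ball v (r v))"
      by metis
    have "wp ` V = (\<Union>v\<in>V. wp ` ball v (r v))"
    proof
      show "wp ` V \<subseteq> (\<Union>v\<in>V. wp ` ball v (r v))"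
      proof (rule image_subsetI)
        fix v assume "v \<in> V"
        with r[of v] show "wp v \<in> (\<Union>v\<in>V. wp ` ball v (r v))"
          by (intro UN_I[of v] imageI) auto
      qed
      show "(\<Union>v\<in>V. wp ` ball v (r v)) \<subseteq> wp ` V"
        using r by blast
    qed
    then show ?thesis
      using r by (auto intro!: open_UN)
  qed
  have open_double: "open ((\<lambda>v. 2 * v) ` V)"
    using open_scaling[of 2 V] V(1) by (simp add: scaleR_conv_of_real)
  have half: "u / 2 \<in> V" if "u \<in> (\<lambda>v. 2 * v) ` V" for u
    using that by auto
  have D: "(wp has_field_derivative deriv wp v) (at v)"
    "(deriv wp has_field_derivative 6 * wp v ^ 2 - g2 / 2) (at v)" if "v \<in> V" for v
    using wp_derivs(1,2)[OF off[OF that]] wp_deriv2[OF off[OF that] nz[OF that]] by auto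
  have Dl: "(l has_field_derivative (6 * wp v ^ 2 - g2 / 2) / deriv wp v) (at v)" if v: "v \<in> V" for v
  proof -
    have dl: "(l has_field_derivative deriv l v) (at v)"
      by (rule holomorphic_derivI[OF l(1) V(1) v])
    then have "((\<lambda>v. exp (l v)) has_field_derivative exp (l v) * deriv l v) (at v)"
      by (rule DERIV_chain2[OF DERIV_exp])
    then have "(deriv wp has_field_derivative exp (l v) * deriv l v) (at v)"
      by (rule has_field_derivative_transform_within_open[OF _ V(1) v]) (simp add: l(2))
    then have "deriv wp v * deriv l v = 6 * wp v ^ 2 - g2 / 2"
      using D(2)[OF v] DERIV_unique l(2)[OF v] by metis
    then have "deriv l v = (6 * wp v ^ 2 - g2 / 2) / deriv wp v"
      using nz[OF v] by (simp add: field_simps)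
    with dl show ?thesis by simp
  qed
  have Dz: "((\<lambda>v. z (wp v)) has_field_derivative deriv z (wp v) * deriv wp v) (at v)"
    "((\<lambda>v. deriv z (wp v)) has_field_derivative deriv (deriv z) (wp v) * deriv wp v) (at v)" if v: "v \<in> V" for v
  proof -
    have x: "wp v \<in> wp ` V" using v by blast
    show "((\<lambda>v. z (wp v)) has_field_derivative deriv z (wp v) * deriv wp v) (at v)"
      by (rule DERIV_chain2[OF holomorphic_derivI[OF z open_image x] D(1)[OF v]])
    show "((\<lambda>v. deriv z (wp v)) has_field_derivative deriv (deriv z) (wp v) * deriv wp v) (at v)"
      by (rule DERIV_chain2[OF holomorphic_derivI[OF holomorphic_deriv[OF z open_image] open_image x] D(1)[OF v]])
  qed
  \<comment> \<open>\<open>w\<close> is \<open>y\<close> in the variable \<open>v\<close>; \<open>w1\<close> and \<open>w2\<close> are its first two derivatives.\<close>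
  define w where "w v = exp (- n * l v) * z (wp v)" for v
  define w1 where "w1 v = exp (- n * l v) * (deriv z (wp v) * deriv wp v - n * ((6 * wp v ^ 2 - g2 / 2) / deriv wp v) * z (wp v))" for v
  define w2 where "w2 v = exp (- n * l v) * ((deriv wp v)^2 * deriv (deriv z) (wp v)
      + (1 - 2 * n) * (6 * wp v ^ 2 - g2 / 2) * deriv z (wp v)
      + (n * (n + 1) * ((6 * wp v ^ 2 - g2 / 2) / deriv wp v)^2 - 12 * n * wp v) * z (wp v))" for v
  have De: "((\<lambda>v. exp (- n * l v)) has_field_derivative
      exp (- n * l v) * (- n * ((6 * wp v ^ 2 - g2 / 2) / deriv wp v))) (at v)" if v: "v \<in> V" for v
    by (rule DERIV_chain2[OF DERIV_exp DERIV_cmult[OF Dl[OF v]]])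
  have Dw: "(w has_field_derivative w1 v) (at v)" if v: "v \<in> V" for v
  proof -
    have "e * (- n * q) * c + c1 * e = e * (c1 - n * q * c)" for e q c c1 :: complex
      by (simp add: algebra_simps)
    then show ?thesis
      unfolding w_def w1_def by (rule DERIV_cong[OF DERIV_mult[OF De[OF v] Dz(1)[OF v]]])
  qed
  have Dw1: "(w1 has_field_derivative w2 v) (at v)" if v: "v \<in> V" for v
  proof -
    define X P Y E Z Z1 Z2 where "X = wp v" and "P = deriv wp v" and "Y = 6 * wp v ^ 2 - g2 / 2"
      and "E = exp (- n * l v)" and "Z = z (wp v)" and "Z1 = deriv z (wp v)" and "Z2 = deriv (deriv z) (wp v)"
    have P0: "P \<noteq> 0" using nz[OF v] by (simp add: P_def)
    have "((\<lambda>v. 6 * wp v ^ 2 - g2 / 2) has_field_derivative 12 * X * P) (at v)"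
      unfolding X_def P_def by (rule derivative_eq_intros D(1)[OF v] refl)+ simp
    then have DQ: "((\<lambda>v. (6 * wp v ^ 2 - g2 / 2) / deriv wp v) has_field_derivative 12 * X - (Y / P)^2) (at v)"
      by (rule DERIV_cong[OF DERIV_divide[OF _ D(2)[OF v] nz[OF v]]])
         (use P0 in \<open>simp add: X_def P_def Y_def field_simps power2_eq_square\<close>)
    have "((\<lambda>v. deriv z (wp v) * deriv wp v - n * ((6 * wp v ^ 2 - g2 / 2) / deriv wp v) * z (wp v)) has_field_derivative
        (Z2 * P * P + Y * Z1) - (n * (12 * X - (Y / P)^2) * Z + Z1 * P * (n * (Y / P)))) (at v)"
      unfolding Z_def Z1_def Z2_def P_def Y_def
      by (rule DERIV_diff[OF DERIV_mult[OF Dz(2)[OF v] D(2)[OF v]]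
            DERIV_mult[OF DERIV_cmult[OF DQ[unfolded P_def Y_def]] Dz(1)[OF v]]])
    from DERIV_mult[OF De[OF v] this]
    have "(w1 has_field_derivative E * (- n * (Y / P)) * (Z1 * P - n * (Y / P) * Z)
        + ((Z2 * P * P + Y * Z1) - (n * (12 * X - (Y / P)^2) * Z + Z1 * P * (n * (Y / P)))) * E) (at v)"
      unfolding w1_def X_def P_def Y_def E_def Z_def Z1_def Z2_def .
    also have "E * (- n * (Y / P)) * (Z1 * P - n * (Y / P) * Z)
        + ((Z2 * P * P + Y * Z1) - (n * (12 * X - (Y / P)^2) * Z + Z1 * P * (n * (Y / P)))) * E = w2 v"
    proof -
      define t where "t = Y / P"
      have Y: "Y = t * P" using P0 by (simp add: t_def)
      have "w2 v = E * (P^2 * Z2 + (1 - 2 * n) * Y * Z1 + (n * (n + 1) * t^2 - 12 * n * X) * Z)"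
        by (simp add: w2_def X_def P_def Y_def E_def Z_def Z1_def Z2_def t_def)
      then show ?thesis
        unfolding t_def [symmetric] Y using P0 by (simp add: algebra_simps power2_eq_square)
    qed
    finally show ?thesis .
  qed
  have y_eq: "y u = w (u / 2)" if "u \<in> (\<lambda>v. 2 * v) ` V" for u
    using y[OF half[OF that]] by (simp add: w_def)
  have Dh: "((\<lambda>u. u / 2) has_field_derivative 1 / 2) (at u)" for u :: complex
    by (auto intro!: derivative_eq_intros)
  have Dy: "(y has_field_derivative w1 (u / 2) * (1 / 2)) (at u)" if u: "u \<in> (\<lambda>v. 2 * v) ` V" for u
    by (rule has_field_derivative_transform_within_open[OF DERIV_chain2[OF Dw[OF half[OF u]] Dh] open_double u])
       (simp add: y_eq)
  then show "y holomorphic_on (\<lambda>v. 2 * v) ` V"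
    using open_double by (auto simp: holomorphic_on_open)
  have dy: "deriv y u = w1 (u / 2) * (1 / 2)" if "u \<in> (\<lambda>v. 2 * v) ` V" for u
    by (rule DERIV_imp_deriv[OF Dy[OF that]])
  have Ddy: "(deriv y has_field_derivative w2 (u / 2) * (1 / 2) * (1 / 2)) (at u)" if u: "u \<in> (\<lambda>v. 2 * v) ` V" for u
    by (rule has_field_derivative_transform_within_open[OF DERIV_cmult_right[OF DERIV_chain2[OF Dw1[OF half[OF u]] Dh]] open_double u])
       (simp add: dy)
  show "(deriv ^^ 2) y (2 * v) - (n * (n + 1) * wp (2 * v) - H) * y (2 * v)
      = exp (- n * l v) / 4 * ((4 * wp v ^ 3 - g2 * wp v - g3) * (deriv ^^ 2) z (wp v)
          + (1/2 - n) * (12 * wp v ^ 2 - g2) * deriv z (wp v) + 4 * (n * (2 * n - 1) * wp v + H) * z (wp v))"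
    if v: "v \<in> V"
  proof -
    define X P Y E Z Z1 Z2 where "X = wp v" and "P = deriv wp v" and "Y = 6 * wp v ^ 2 - g2 / 2"
      and "E = exp (- n * l v)" and "Z = z (wp v)" and "Z1 = deriv z (wp v)" and "Z2 = deriv (deriv z) (wp v)"
    have "deriv (deriv y) (2 * v) = w2 (2 * v / 2) * (1 / 2) * (1 / 2)"
      using v by (intro DERIV_imp_deriv[OF Ddy]) blast
    then have "(deriv ^^ 2) y (2 * v) = w2 v / 4"
      by (simp add: numeral_2_eq_2)
    also have "w2 v = E * (P^2 * Z2 + (1 - 2 * n) * Y * Z1 + (n * (n + 1) * (Y / P)^2 - 12 * n * X) * Z)"
      by (simp add: w2_def X_def P_def Y_def E_def Z_def Z1_def Z2_def)
    finally have y2: "(deriv ^^ 2) y (2 * v)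
        = E * (P^2 * Z2 + (1 - 2 * n) * Y * Z1 + (n * (n + 1) * (Y / P)^2 - 12 * n * X) * Z) / 4" .
    have dup: "wp (2 * v) = (Y / P)^2 / 4 - 2 * X"
      using wp_duplication[OF V(2)[OF v] nz[OF v]] wp_deriv2[OF off[OF v] nz[OF v]]
      by (simp add: X_def P_def Y_def power_divide power_mult_distrib)
    have y0: "y (2 * v) = E * Z"
      using y[OF v] by (simp add: E_def Z_def)
    have PP: "4 * X ^ 3 - g2 * X - g3 = P^2"
      using wp_differential_equation[OF off[OF v]] by (simp add: X_def P_def)
    have YY: "12 * X ^ 2 - g2 = 2 * Y"
      by (simp add: X_def Y_def)
    have "(deriv ^^ 2) y (2 * v) - (n * (n + 1) * wp (2 * v) - H) * y (2 * v)
        = E / 4 * (P^2 * Z2 + (1/2 - n) * (2 * Y) * Z1 + 4 * (n * (2 * n - 1) * X + H) * Z)"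
    proof -
      define Q where "Q = (Y / P)^2"
      show ?thesis
        unfolding y2 dup y0 Q_def [symmetric] by (simp add: field_simps)
    qed
    also have "\<dots> = E / 4 * ((4 * X ^ 3 - g2 * X - g3) * Z2 + (1/2 - n) * (12 * X ^ 2 - g2) * Z1
        + 4 * (n * (2 * n - 1) * X + H) * Z)"
      unfolding PP YY ..
    finally show ?thesis
      by (simp add: X_def E_def Z_def Z1_def Z2_def numeral_2_eq_2)
  qed
qed

lemma halphen_substitution_euler_ode_c:
  assumes sum0: "e1 + e2 + e3 = 0"
    and p: "\<And>x. lame_p e1 e2 e3 x = 4 * x^3 - g2 * x - g3"
  shows "halphen_substitution \<Lambda> n H (euler_ode_c e1 e2 e3 n H)"
  unfolding halphen_substitution_def
proof (intro allI impI, elim conjE)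
  fix V l y z
  assume V: "open V" "\<forall>v\<in>V. 2 * v \<notin> \<Lambda>"
    and l: "l holomorphic_on V" "\<forall>v\<in>V. exp (l v) = deriv wp v"
    and z: "z holomorphic_on wp ` V"
    and y: "\<forall>v\<in>V. y (2 * v) = exp (- n * l v) * z (wp v)"
  have dp: "deriv (lame_p e1 e2 e3) x = 12 * x^2 - g2" for x
  proof -
    have "((\<lambda>x. 4 * x^3 - g2 * x - g3) has_field_derivative 12 * x^2 - g2) (at x)"
      by (auto intro!: derivative_eq_intros)
    moreover have "lame_p e1 e2 e3 = (\<lambda>x. 4 * x^3 - g2 * x - g3)"
      using p by auto
    ultimately show ?thesis
      by (simp add: DERIV_imp_deriv)
  qed
  define Ry where "Ry v = (deriv ^^ 2) y (2 * v) - (n * (n + 1) * wp (2 * v) - H) * y (2 * v)" for v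
  define Rz where "Rz x = (4 * x ^ 3 - g2 * x - g3) * (deriv ^^ 2) z x
    + (1/2 - n) * (12 * x ^ 2 - g2) * deriv z x + 4 * (n * (2 * n - 1) * x + H) * z x" for x
  have holy: "y holomorphic_on (\<lambda>v. 2 * v) ` V"
    by (rule halphen_substitution_pointwise(1)[OF V(1) _ l(1) _ z]) (use V l y in auto)
  have key: "Ry v = exp (- n * l v) / 4 * Rz (wp v)" if "v \<in> V" for v
    unfolding Ry_def Rz_def
    by (rule halphen_substitution_pointwise(2)[OF V(1) _ l(1) _ z _ that]) (use V l y in auto)
  have "ode2_solution (elliptic_lame_ode \<Lambda> n H) ((\<lambda>v. 2 * v) ` V) y \<longleftrightarrow> (\<forall>v\<in>V. Ry v = 0)"
  proof -
    have e: "1 * a + 0 * b + - c * d = a - c * d" for a b c d :: complex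
      by simp
    show ?thesis
      unfolding ode2_solution_def elliptic_lame_ode_def prod.case e Ry_def using holy by simp
  qed
  also have "\<dots> \<longleftrightarrow> (\<forall>v\<in>V. Rz (wp v) = 0)"
  proof -
    have "Ry v = 0 \<longleftrightarrow> Rz (wp v) = 0" if "v \<in> V" for v
      unfolding key[OF that] by simp
    then show ?thesis by blast
  qed
  also have "\<dots> \<longleftrightarrow> ode2_solution (euler_ode_c e1 e2 e3 n H) (wp ` V) z"
  proof -
    have c: "4 * (H - n^2 * 0) + 4 * n * (2 * n - 1) * x = 4 * (n * (2 * n - 1) * x + H)" for x
      by (simp add: algebra_simps)
    show ?thesis
      unfolding ode2_solution_def euler_ode_c_def prod.case dp p sum0 c Rz_def using z by simp
  qed
  finally show "ode2_solution (elliptic_lame_ode \<Lambda> n H) ((\<lambda>v. 2 * v) ` V) y \<longleftrightarrow>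
      ode2_solution (euler_ode_c e1 e2 e3 n H) (wp ` V) z" .
qed

end

theorem corollary2p3:
  fixes e1 e2 e3 n H :: complex
  assumes "e1 \<noteq> e2" "e1 \<noteq> e3" "e2 \<noteq> e3"
  shows "(\<forall>U f \<mu> X I.
            open U \<and> sym_square_lame_solution e1 e2 e3 n H U f \<and>
            open X \<and> is_euler_integral {e1, e2, e3} U f \<mu> X I \<longrightarrow>
              I holomorphic_on X \<and>
              (\<mu> = - 1/2 \<longrightarrow> ode2_solution (euler_ode_a e1 e2 e3 n H) X (deriv I)) \<and>
              (\<mu> = n \<longrightarrow> ode2_solution (euler_ode_b e1 e2 e3 n H) X (deriv I)) \<and>
              (\<mu> = - n - 1 \<longrightarrow> ode2_solution (euler_ode_c e1 e2 e3 n H) X (deriv I)))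
       \<and> (e1 + e2 + e3 = 0 \<longrightarrow>
            euler_ode_c e1 e2 e3 n H = halphen_ode e1 e2 e3 n H \<and>
            (\<forall>\<omega>1 \<omega>2 \<Lambda>.
               \<omega>2 / \<omega>1 \<notin> \<real> \<and> \<Lambda> = period_lattice \<omega>1 \<omega>2 \<and>
               (\<forall>x. lame_p e1 e2 e3 x = 4 * x^3 - weierstrass_g2 \<Lambda> * x - weierstrass_g3 \<Lambda>) \<longrightarrow>
               halphen_substitution \<Lambda> n H (euler_ode_c e1 e2 e3 n H)))"
proof (intro conjI allI impI)
  fix U f \<mu> X I
  assume "open U \<and> sym_square_lame_solution e1 e2 e3 n H U f \<and>
    open X \<and> is_euler_integral {e1, e2, e3} U f \<mu> X I"
  then have A: "open U" "sym_square_lame_solution e1 e2 e3 n H U f"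
      "open X" "is_euler_integral {e1, e2, e3} U f \<mu> X I"
    by auto
  show "I holomorphic_on X"
    by (rule euler_integral_of_sym_square(1)[OF A])
  show "ode2_solution (euler_ode_a e1 e2 e3 n H) X (deriv I)" if "\<mu> = - 1/2"
    by (rule euler_integral_ode(1)[OF A that])
  show "ode2_solution (euler_ode_b e1 e2 e3 n H) X (deriv I)" if "\<mu> = n"
    by (rule euler_integral_ode(2)[OF A that])
  show "ode2_solution (euler_ode_c e1 e2 e3 n H) X (deriv I)" if "\<mu> = - n - 1"
    by (rule euler_integral_ode(3)[OF A that])
next
  assume sum0: "e1 + e2 + e3 = 0"
  show "euler_ode_c e1 e2 e3 n H = halphen_ode e1 e2 e3 n H"
    unfolding euler_ode_c_def halphen_ode_def sum0 by (simp add: algebra_simps)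
  fix \<omega>1 \<omega>2 \<Lambda>
  assume *: "\<omega>2 / \<omega>1 \<notin> \<real> \<and> \<Lambda> = period_lattice \<omega>1 \<omega>2 \<and>
    (\<forall>x. lame_p e1 e2 e3 x = 4 * x^3 - weierstrass_g2 \<Lambda> * x - weierstrass_g3 \<Lambda>)"
  then interpret complex_lattice \<omega>1 \<omega>2
    by unfold_locales blast
  show "halphen_substitution \<Lambda> n H (euler_ode_c e1 e2 e3 n H)"
    using halphen_substitution_euler_ode_c[OF sum0, of n H] * by simp
qed

end
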